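(* Let $d$ be a fixed constant. The container packing problem (defined in the context) with a constant number of containers admits a PTAS, both when items may not be rotated and when items may be rotated by 90 degrees: for every fixed $\epsilon>0$ there is a polynomial-time algorithm that outputs a feasible solution of profit at least $(1-\epsilon)$ times the optimum.
   Context: Container packing problem: the input is a set $I$ of items, each with width $w(i)$, height $h(i)$, profit $p(i)\ge0$ and nonnegative weights $v_1(i),\dots,v_d(i)$; a constant-size set $C$ of containers (axis-parallel rectangles with given widths and heights), each labeled as large, wide, tall or area; and a constant $\epsilon'\in(0,1)$. A feasible solution packs a subset of $I$ into the containers (axis-parallel, non-overlapping, each item inside one container; in the rotation version an item may be turned by 90 degrees) such that: a large container is empty or contains exactly one item; in a wide container all items are stacked one on top of another; in a tall container all items are arranged side by side; an area container of width $w$ and height $h$ contains only items of width at most $\epsilon' w$ and height at most $\epsilon' h$, with total item area at most $(1-\epsilon')^2wh$; and for every $j\in[d]$ the total $j$-th weight of all packed items is at most $1$. The objective is to maximize total profit of packed items. *)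

theory Defs
  imports Complex_Main "HOL-Computational_Algebra.Polynomial" "HOL-Library.Log_Nat"
begin

section \<open>Model of computation\<close>

text \<open>
  Algorithms are programs of a first-order functional language over binary trees with integer
  leaves. A program is a finite list of unary functions; variables are de Bruijn indices into the
  local environment, and a call evaluates the callee's body in the environment that consists of
  the argument alone. Running time follows the logarithmic cost criterion: an integer operation is
  charged the binary lengths of its operands and every other step is charged 1 (trees are shared,
  so a step on trees moves a pointer). Every integer operation is polynomial-time computable and
  produces at most as many bits as it charges for, so that the functions computable in polynomial
  time are those of polynomial-time Turing machines.
\<close>

datatype val = IntV int | PairV val val

datatype arith = Add | Sub | Mul | Div | Less

datatype exp =
    EVar nat
  | EInt int
  | EArith arith exp exp
  | EPair exp exp
  | EFst exp
  | ESnd exp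
  | EIsPair exp
  | EIf exp exp exp
  | ELet exp exp
  | ECall nat exp

type_synonym prog = "exp list"

fun arith_op :: "arith \<Rightarrow> int \<Rightarrow> int \<Rightarrow> int" where
  "arith_op Add a b = a + b"
| "arith_op Sub a b = a - b"
| "arith_op Mul a b = a * b"
| "arith_op Div a b = a div b"
| "arith_op Less a b = of_bool (a < b)"

definition bitlength :: "int \<Rightarrow> nat" where
  "bitlength a = floorlog 2 (nat \<bar>a\<bar>)"

inductive evals_to :: "prog \<Rightarrow> val list \<Rightarrow> exp \<Rightarrow> val \<Rightarrow> nat \<Rightarrow> bool" for P where
  Var: "i < length \<Gamma> \<Longrightarrow> evals_to P \<Gamma> (EVar i) (\<Gamma> ! i) 1"
| Int: "evals_to P \<Gamma> (EInt a) (IntV a) 1"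
| Arith: "\<lbrakk>evals_to P \<Gamma> e1 (IntV a) t1; evals_to P \<Gamma> e2 (IntV b) t2\<rbrakk>
    \<Longrightarrow> evals_to P \<Gamma> (EArith f e1 e2) (IntV (arith_op f a b))
          (t1 + t2 + 1 + bitlength a + bitlength b)"
| Pair: "\<lbrakk>evals_to P \<Gamma> e1 u t1; evals_to P \<Gamma> e2 v t2\<rbrakk>
    \<Longrightarrow> evals_to P \<Gamma> (EPair e1 e2) (PairV u v) (t1 + t2 + 1)"
| Fst: "evals_to P \<Gamma> e (PairV u v) t \<Longrightarrow> evals_to P \<Gamma> (EFst e) u (t + 1)"
| Snd: "evals_to P \<Gamma> e (PairV u v) t \<Longrightarrow> evals_to P \<Gamma> (ESnd e) v (t + 1)"
| IsPair: "evals_to P \<Gamma> e (PairV u v) t \<Longrightarrow> evals_to P \<Gamma> (EIsPair e) (IntV 1) (t + 1)"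
| IsNoPair: "evals_to P \<Gamma> e (IntV a) t \<Longrightarrow> evals_to P \<Gamma> (EIsPair e) (IntV 0) (t + 1)"
| IfTrue: "\<lbrakk>evals_to P \<Gamma> e (IntV a) t1; a \<noteq> 0; evals_to P \<Gamma> e1 v t2\<rbrakk>
    \<Longrightarrow> evals_to P \<Gamma> (EIf e e1 e2) v (t1 + t2 + 1)"
| IfFalse: "\<lbrakk>evals_to P \<Gamma> e (IntV 0) t1; evals_to P \<Gamma> e2 v t2\<rbrakk>
    \<Longrightarrow> evals_to P \<Gamma> (EIf e e1 e2) v (t1 + t2 + 1)"
| Let: "\<lbrakk>evals_to P \<Gamma> e1 u t1; evals_to P (u # \<Gamma>) e2 v t2\<rbrakk>
    \<Longrightarrow> evals_to P \<Gamma> (ELet e1 e2) v (t1 + t2 + 1)"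
| Call: "\<lbrakk>f < length P; evals_to P \<Gamma> e u t1; evals_to P [u] (P ! f) v t2\<rbrakk>
    \<Longrightarrow> evals_to P \<Gamma> (ECall f e) v (t1 + t2 + 1)"

inductive_cases evals_to_elims:
  "evals_to P \<Gamma> (EVar i) v t"
  "evals_to P \<Gamma> (EInt a) v t"
  "evals_to P \<Gamma> (EArith f e1 e2) v t"
  "evals_to P \<Gamma> (EPair e1 e2) v t"
  "evals_to P \<Gamma> (EFst e) v t"
  "evals_to P \<Gamma> (ESnd e) v t"
  "evals_to P \<Gamma> (EIsPair e) v t"
  "evals_to P \<Gamma> (EIf e e1 e2) v t"
  "evals_to P \<Gamma> (ELet e1 e2) v t"
  "evals_to P \<Gamma> (ECall f e) v t"

lemma evals_to_deterministic:
  "evals_to P \<Gamma> e v t \<Longrightarrow> evals_to P \<Gamma> e v' t' \<Longrightarrow> v = v' \<and> t = t'"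
proof (induction arbitrary: v' t' rule: evals_to.induct)
  case Var
  then show ?case by (auto elim: evals_to_elims)
next
  case Int
  then show ?case by (auto elim: evals_to_elims)
next
  case Arith
  from Arith.prems show ?case by (rule evals_to_elims) (drule Arith.IH(1), drule Arith.IH(2), simp)
next
  case Pair
  from Pair.prems show ?case by (rule evals_to_elims) (metis Pair.IH Suc_eq_plus1 val.inject val.distinct)
next
  case Fst
  from Fst.prems show ?case by (rule evals_to_elims) (metis Fst.IH Suc_eq_plus1 val.inject val.distinct)
next
  case Snd
  from Snd.prems show ?case by (rule evals_to_elims) (metis Snd.IH Suc_eq_plus1 val.inject val.distinct)
next
  case IsPair
  from IsPair.prems show ?case by (rule evals_to_elims) (metis IsPair.IH Suc_eq_plus1 val.inject val.distinct)+
next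
  case IsNoPair
  from IsNoPair.prems show ?case by (rule evals_to_elims) (metis IsNoPair.IH Suc_eq_plus1 val.inject val.distinct)+
next
  case IfTrue
  from IfTrue.prems show ?case by (rule evals_to_elims) (metis Suc_eq_plus1 IfTrue.IH IfTrue.hyps val.inject)+
next
  case IfFalse
  from IfFalse.prems show ?case by (rule evals_to_elims) (metis IfFalse.IH Suc_eq_plus1 val.inject val.distinct)+
next
  case Let
  from Let.prems show ?case by (rule evals_to_elims) (metis Suc_eq_plus1 Let.IH)
next
  case Call
  from Call.prems show ?case by (rule evals_to_elims) (metis Suc_eq_plus1 Call.IH)
qed

definition runs :: "prog \<Rightarrow> val \<Rightarrow> val \<Rightarrow> nat \<Rightarrow> bool" where
  "runs P x y t \<longleftrightarrow> evals_to P [x] (ECall 0 (EVar 0)) y t"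

fun val_size :: "val \<Rightarrow> nat" where
  "val_size (IntV a) = 1 + bitlength a"
| "val_size (PairV u v) = 1 + val_size u + val_size v"


section \<open>Approximation schemes for maximization problems\<close>

record ('i, 's) max_problem =
  instances :: "'i set"
  encode :: "'i \<Rightarrow> val"
  represents :: "val \<Rightarrow> 's \<Rightarrow> bool"
  feasible :: "'i \<Rightarrow> 's \<Rightarrow> bool"
  objective :: "'i \<Rightarrow> 's \<Rightarrow> real"

definition opt :: "('i, 's) max_problem \<Rightarrow> 'i \<Rightarrow> real" where
  "opt \<Pi> I = (SUP S \<in> {S. feasible \<Pi> I S}. objective \<Pi> I S)"

definition poly_time_approx :: "('i, 's) max_problem \<Rightarrow> real \<Rightarrow> prog \<Rightarrow> bool" where
  "poly_time_approx \<Pi> \<alpha> P \<longleftrightarrow>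
     (\<exists>q :: nat poly. \<forall>I \<in> instances \<Pi>. \<exists>y t.
        runs P (encode \<Pi> I) y t \<and> t \<le> poly q (val_size (encode \<Pi> I)) \<and>
        (\<exists>S. represents \<Pi> y S \<and> feasible \<Pi> I S \<and> objective \<Pi> I S \<ge> \<alpha> * opt \<Pi> I))"

definition admits_PTAS :: "('i, 's) max_problem \<Rightarrow> bool" where
  "admits_PTAS \<Pi> \<longleftrightarrow> (\<forall>\<epsilon>>0. \<exists>P. poly_time_approx \<Pi> (1 - \<epsilon>) P)"


section \<open>The container packing problem\<close>

record item =
  width :: rat
  height :: rat
  profit :: rat
  weights :: "rat list"

datatype label = Large | Wide | Tall | Area

record container =
  cwidth :: rat
  cheight :: rat
  clabel :: label

text \<open>Items and containers are identified by their positions in the lists, so that distinct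
  items (containers) may have the same data.\<close>

record cp_instance =
  items :: "item list"
  containers :: "container list"
  eps' :: rat

definition valid_instance :: "nat \<Rightarrow> nat \<Rightarrow> cp_instance \<Rightarrow> bool" where
  "valid_instance d k I \<longleftrightarrow>
     (\<forall>a \<in> set (items I). width a > 0 \<and> height a > 0 \<and> profit a \<ge> 0 \<and>
        length (weights a) = d \<and> (\<forall>w \<in> set (weights a). w \<ge> 0)) \<and>
     (\<forall>c \<in> set (containers I). cwidth c > 0 \<and> cheight c > 0) \<and>
     length (containers I) \<le> k \<and>
     0 < eps' I \<and> eps' I < 1"

text \<open>A placement gives the lower left corner of an item relative to the lower left corner of its
  container. The entry at position \<open>i\<close> of a solution tells whether and how item \<open>i\<close> is packed.\<close>

record placement =
  cont :: nat
  rotated :: bool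
  xpos :: real
  ypos :: real

type_synonym solution = "placement option list"

definition packed :: "solution \<Rightarrow> nat set" where
  "packed S = {i. i < length S \<and> S ! i \<noteq> None}"

definition packed_in :: "solution \<Rightarrow> nat \<Rightarrow> nat set" where
  "packed_in S c = {i \<in> packed S. cont (the (S ! i)) = c}"

definition pwidth :: "cp_instance \<Rightarrow> solution \<Rightarrow> nat \<Rightarrow> real" where
  "pwidth I S i =
     of_rat (if rotated (the (S ! i)) then height (items I ! i) else width (items I ! i))"

definition pheight :: "cp_instance \<Rightarrow> solution \<Rightarrow> nat \<Rightarrow> real" where
  "pheight I S i =
     of_rat (if rotated (the (S ! i)) then width (items I ! i) else height (items I ! i))"

definition left_edge :: "solution \<Rightarrow> nat \<Rightarrow> real" where
  "left_edge S i = xpos (the (S ! i))"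

definition right_edge :: "cp_instance \<Rightarrow> solution \<Rightarrow> nat \<Rightarrow> real" where
  "right_edge I S i = left_edge S i + pwidth I S i"

definition bottom_edge :: "solution \<Rightarrow> nat \<Rightarrow> real" where
  "bottom_edge S i = ypos (the (S ! i))"

definition top_edge :: "cp_instance \<Rightarrow> solution \<Rightarrow> nat \<Rightarrow> real" where
  "top_edge I S i = bottom_edge S i + pheight I S i"

definition rect :: "cp_instance \<Rightarrow> solution \<Rightarrow> nat \<Rightarrow> (real \<times> real) set" where
  "rect I S i = {left_edge S i..right_edge I S i} \<times> {bottom_edge S i..top_edge I S i}"

definition open_rect :: "cp_instance \<Rightarrow> solution \<Rightarrow> nat \<Rightarrow> (real \<times> real) set" where
  "open_rect I S i = {left_edge S i<..<right_edge I S i} \<times> {bottom_edge S i<..<top_edge I S i}"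

definition container_ok :: "cp_instance \<Rightarrow> solution \<Rightarrow> nat \<Rightarrow> bool" where
  "container_ok I S c \<longleftrightarrow>
     (let W = of_rat (cwidth (containers I ! c)); H = of_rat (cheight (containers I ! c));
          \<epsilon>' = of_rat (eps' I); A = packed_in S c
      in (\<forall>i \<in> A. rect I S i \<subseteq> {0..W} \<times> {0..H}) \<and>
         (\<forall>i \<in> A. \<forall>j \<in> A. i \<noteq> j \<longrightarrow> open_rect I S i \<inter> open_rect I S j = {}) \<and>
         (case clabel (containers I ! c) of
            Large \<Rightarrow> card A \<le> 1
          | Wide \<Rightarrow> (\<forall>i \<in> A. \<forall>j \<in> A. i \<noteq> j \<longrightarrow> top_edge I S i \<le> bottom_edge S j \<or> top_edge I S j \<le> bottom_edge S i)
          | Tall \<Rightarrow> (\<forall>i \<in> A. \<forall>j \<in> A. i \<noteq> j \<longrightarrow> right_edge I S i \<le> left_edge S j \<or> right_edge I S j \<le> left_edge S i)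
          | Area \<Rightarrow> (\<forall>i \<in> A. pwidth I S i \<le> \<epsilon>' * W \<and> pheight I S i \<le> \<epsilon>' * H) \<and>
              (\<Sum>i \<in> A. pwidth I S i * pheight I S i) \<le> (1 - \<epsilon>')\<^sup>2 * W * H))"

definition feasible_packing :: "bool \<Rightarrow> nat \<Rightarrow> cp_instance \<Rightarrow> solution \<Rightarrow> bool" where
  "feasible_packing rotation d I S \<longleftrightarrow>
     length S = length (items I) \<and>
     (\<forall>i \<in> packed S. cont (the (S ! i)) < length (containers I)) \<and>
     (\<forall>i \<in> packed S. rotated (the (S ! i)) \<longrightarrow> rotation) \<and>
     (\<forall>c < length (containers I). container_ok I S c) \<and>
     (\<forall>j < d. (\<Sum>i \<in> packed S. weights (items I ! i) ! j) \<le> 1)"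

definition total_profit :: "cp_instance \<Rightarrow> solution \<Rightarrow> real" where
  "total_profit I S = (\<Sum>i \<in> packed S. of_rat (profit (items I ! i)))"


subsection \<open>Encodings\<close>

fun enc_list :: "val list \<Rightarrow> val" where
  "enc_list [] = IntV 0"
| "enc_list (v # vs) = PairV v (enc_list vs)"

definition enc_rat :: "rat \<Rightarrow> val" where
  "enc_rat r = (case quotient_of r of (a, b) \<Rightarrow> PairV (IntV a) (IntV b))"

definition enc_item :: "item \<Rightarrow> val" where
  "enc_item a = enc_list
     [enc_rat (width a), enc_rat (height a), enc_rat (profit a), enc_list (map enc_rat (weights a))]"

fun enc_label :: "label \<Rightarrow> val" where
  "enc_label Large = IntV 0"
| "enc_label Wide = IntV 1"
| "enc_label Tall = IntV 2"
| "enc_label Area = IntV 3"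

definition enc_container :: "container \<Rightarrow> val" where
  "enc_container c = enc_list [enc_rat (cwidth c), enc_rat (cheight c), enc_label (clabel c)]"

definition enc_instance :: "cp_instance \<Rightarrow> val" where
  "enc_instance I = enc_list
     [enc_list (map enc_item (items I)), enc_list (map enc_container (containers I)),
      enc_rat (eps' I)]"

text \<open>In the output, coordinates are fractions that need not be in lowest terms.\<close>

definition repr_coord :: "val \<Rightarrow> real \<Rightarrow> bool" where
  "repr_coord v x \<longleftrightarrow>
     (\<exists>a b. v = PairV (IntV a) (IntV b) \<and> b \<noteq> 0 \<and> x = real_of_int a / real_of_int b)"

fun repr_entry :: "val \<Rightarrow> placement option \<Rightarrow> bool" where
  "repr_entry v None \<longleftrightarrow> v = IntV 0"
| "repr_entry v (Some p) \<longleftrightarrow>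
     (\<exists>x y. v = enc_list [IntV (int (cont p)), IntV (of_bool (rotated p)), x, y] \<and>
        repr_coord x (xpos p) \<and> repr_coord y (ypos p))"

definition repr_solution :: "val \<Rightarrow> solution \<Rightarrow> bool" where
  "repr_solution v S \<longleftrightarrow> (\<exists>vs. v = enc_list vs \<and> list_all2 repr_entry vs S)"

text \<open>\<open>d\<close> is the number of weights per item and \<open>k\<close> bounds the number of containers.\<close>

definition container_packing :: "bool \<Rightarrow> nat \<Rightarrow> nat \<Rightarrow> (cp_instance, solution) max_problem" where
  "container_packing rotation d k =
     \<lparr>instances = {I. valid_instance d k I},
      encode = enc_instance,
      represents = repr_solution,
      feasible = feasible_packing rotation d,
      objective = total_profit\<rparr>"

text \<open>The supremum in the definition of the optimum is attained.\<close>

lemma opt_container_packing_attained: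
  assumes "valid_instance d k I"
  shows "\<exists>S. feasible_packing rotation d I S \<and>
     total_profit I S = opt (container_packing rotation d k) I \<and>
     (\<forall>S'. feasible_packing rotation d I S' \<longrightarrow> total_profit I S' \<le> total_profit I S)"
proof -
  let ?F = "{S. feasible_packing rotation d I S}"
  let ?X = "total_profit I ` ?F"
  have "?X \<subseteq> (\<lambda>A. \<Sum>i \<in> A. of_rat (profit (items I ! i))) ` Pow {..<length (items I)}"
    by (auto simp: total_profit_def feasible_packing_def packed_def)
  then have fin: "finite ?X"
    by (rule finite_subset) simp
  have none: "packed (replicate (length (items I)) None) = {}"
    by (auto simp: packed_def)
  have pos: "cwidth (containers I ! c) > 0 \<and> cheight (containers I ! c) > 0"
    if "c < length (containers I)" for c
    using assms that by (simp add: valid_instance_def)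
  have "container_ok I (replicate (length (items I)) None) c" if "c < length (containers I)" for c
    using pos[OF that] none
    by (simp add: container_ok_def packed_in_def Let_def less_imp_le split: label.split)
  then have "feasible_packing rotation d I (replicate (length (items I)) None)"
    using none by (simp add: feasible_packing_def)
  then have "?X \<noteq> {}"
    by blast
  with fin have "Max ?X \<in> ?X" and "Sup ?X = Max ?X"
    by (auto simp: cSup_eq_Max)
  then obtain S where S: "S \<in> ?F" "total_profit I S = Max ?X"
    by (metis (no_types, lifting) imageE)
  moreover have "opt (container_packing rotation d k) I = Max ?X"
    using \<open>Sup ?X = Max ?X\<close> by (simp add: opt_def container_packing_def)
  ultimately show ?thesis
    using fin by (intro exI[of _ S]) auto
qed

end

theory Submission
  imports Defs
begin

text \<open>
  By the area argument for next fit decreasing height, an area container can hold every set of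
  sufficiently small items whose total area respects the bound. Hence every container imposes only a
  knapsack constraint on the items assigned to it, and the problem becomes a multiple-choice
  knapsack problem with the constant number \<open>m = |C| + d\<close> of dimensions.

  Let \<open>P\<close> be the optimal profit. At most \<open>r\<close> of the packed items have profit above \<open>P / r\<close>; they are
  guessed. For one dimension with residual capacity \<open>R\<close>, either the remaining items leave a fraction
  \<open>1 / (2 r + 1)\<close> of \<open>R\<close> free, or a single item fills that much, or the items split into \<open>r\<close> groups
  that each do; so discarding profit at most \<open>P / r\<close> frees this fraction. After this has been done in
  all dimensions (which costs \<open>m P / r\<close>), sizes can be rounded up to multiples of
  \<open>R / ((2 r + 1) n)\<close> without exceeding \<open>R\<close>, and the rounded problem has a polynomial number of load
  vectors, so that dynamic programming solves it exactly.

  Running times are bounded through closure properties of the class of polynomial-time computable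
  functions on encoded data; a fold stays in the class when its intermediate results are polynomially
  bounded.
\<close>


section \<open>Binary lengths\<close>

lemma abs_less_power_bitlength: "\<bar>a\<bar> < 2 ^ bitlength a"
proof -
  have "nat \<bar>a\<bar> < 2 ^ bitlength a"
    unfolding bitlength_def by (rule floorlog_leD) auto
  then have "int (nat \<bar>a\<bar>) < int (2 ^ bitlength a)"
    by (simp only: of_nat_less_iff)
  then show ?thesis by simp
qed

lemma bitlength_leI:
  assumes "\<bar>a\<bar> < 2 ^ w"
  shows "bitlength a \<le> w"
proof -
  have "int (nat \<bar>a\<bar>) < int (2 ^ w)" using assms by simp
  then have "nat \<bar>a\<bar> < 2 ^ w" by (simp only: of_nat_less_iff)
  then show ?thesis unfolding bitlength_def by (intro floorlog_leI) auto
qed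

lemma bitlength_0 [simp]: "bitlength 0 = 0"
  and bitlength_1 [simp]: "bitlength 1 = 1"
  and bitlength_uminus [simp]: "bitlength (- a) = bitlength a"
  and bitlength_abs [simp]: "bitlength \<bar>a\<bar> = bitlength a"
  by (simp_all add: bitlength_def floorlog_def)

lemma bitlength_mono: "\<bar>a\<bar> \<le> \<bar>b\<bar> \<Longrightarrow> bitlength a \<le> bitlength b"
  by (rule bitlength_leI) (rule le_less_trans[OF _ abs_less_power_bitlength])

lemma bitlength_le_nat: "\<bar>a\<bar> \<le> int n \<Longrightarrow> bitlength a \<le> n"
proof (rule bitlength_leI)
  assume "\<bar>a\<bar> \<le> int n"
  also have "int n < 2 ^ n"
    using less_exp[of n] by (metis of_nat_less_iff of_nat_numeral of_nat_power)
  finally show "\<bar>a\<bar> < 2 ^ n" .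
qed

lemma bitlength_mult: "bitlength (a * b) \<le> bitlength a + bitlength b"
proof (rule bitlength_leI)
  have "\<bar>a\<bar> * \<bar>b\<bar> < 2 ^ bitlength a * 2 ^ bitlength b"
    using abs_less_power_bitlength[of a] abs_less_power_bitlength[of b]
    by (intro mult_strict_mono) auto
  then show "\<bar>a * b\<bar> < 2 ^ (bitlength a + bitlength b)"
    by (simp add: abs_mult power_add)
qed

lemma bitlength_add: "bitlength (a + b) \<le> max (bitlength a) (bitlength b) + 1"
proof (rule bitlength_leI)
  let ?m = "max (bitlength a) (bitlength b)"
  have "\<bar>a\<bar> < 2 ^ ?m" "\<bar>b\<bar> < 2 ^ ?m"
    by (rule less_le_trans[OF abs_less_power_bitlength], simp add: power_increasing)+
  then show "\<bar>a + b\<bar> < 2 ^ (?m + 1)" by simp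
qed

lemma abs_div_le_abs: "\<bar>a div b\<bar> \<le> \<bar>a :: int\<bar>"
proof -
  have pos: "\<bar>a div b\<bar> \<le> \<bar>a\<bar>" if "0 < b" for a b :: int
  proof (cases "0 \<le> a")
    case True
    then show ?thesis using zdiv_mono2[of a 1 b] that by (simp add: pos_imp_zdiv_nonneg_iff)
  next
    case False
    then show ?thesis using zdiv_mono2_neg[of a 1 b] div_neg_pos_less0[of a b] that by simp
  qed
  consider (neg) "b < 0" | (zero) "b = 0" | (pos) "0 < b" by linarith
  then show ?thesis
  proof cases
    case neg
    then show ?thesis using pos[of "- b" "- a"] by simp
  qed (simp_all add: pos)
qed

lemma bitlength_arith_op: "bitlength (arith_op f a b) \<le> bitlength a + bitlength b + 1"
proof (cases f)
  case Add
  with bitlength_add[of a b] show ?thesis by simp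
next
  case Sub
  with bitlength_add[of a "- b"] show ?thesis by simp
next
  case Mul
  with bitlength_mult[of a b] show ?thesis by simp
next
  case Div
  with bitlength_mono[OF abs_div_le_abs[of a b]] show ?thesis by simp
qed (simp add: of_bool_def)


section \<open>Evaluation within a budget\<close>

fun shift_calls :: "nat \<Rightarrow> exp \<Rightarrow> exp" where
  "shift_calls n (EVar i) = EVar i"
| "shift_calls n (EInt a) = EInt a"
| "shift_calls n (EArith f e1 e2) = EArith f (shift_calls n e1) (shift_calls n e2)"
| "shift_calls n (EPair e1 e2) = EPair (shift_calls n e1) (shift_calls n e2)"
| "shift_calls n (EFst e) = EFst (shift_calls n e)"
| "shift_calls n (ESnd e) = ESnd (shift_calls n e)"
| "shift_calls n (EIsPair e) = EIsPair (shift_calls n e)"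
| "shift_calls n (EIf e e1 e2) = EIf (shift_calls n e) (shift_calls n e1) (shift_calls n e2)"
| "shift_calls n (ELet e1 e2) = ELet (shift_calls n e1) (shift_calls n e2)"
| "shift_calls n (ECall f e) = ECall (n + f) (shift_calls n e)"

lemma evals_to_shift_calls:
  "evals_to P \<Gamma> e v t \<Longrightarrow>
    evals_to (Q @ map (shift_calls (length Q)) P @ R) \<Gamma> (shift_calls (length Q) e) v t"
proof (induction rule: evals_to.induct)
  case (Call f \<Gamma> e u t1 v t2)
  have "(Q @ map (shift_calls (length Q)) P @ R) ! (length Q + f) = shift_calls (length Q) (P ! f)"
    using Call.hyps(1) by (simp add: nth_append)
  then show ?case
    using evals_to.Call[of "length Q + f" "Q @ map (shift_calls (length Q)) P @ R"] Call by simp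
qed (unfold shift_calls.simps, (blast intro: evals_to.intros)+)

lemma evals_to_append: "evals_to P \<Gamma> e v t \<Longrightarrow> evals_to (P @ R) \<Gamma> e v t"
proof (induction rule: evals_to.induct)
  case (Call f \<Gamma> e u t1 v t2)
  then show ?case
    using evals_to.Call[of f "P @ R"] by (simp add: nth_append)
qed (blast intro: evals_to.intros)+

text \<open>Trees are shared, so the running time does not bound the size of the result; the budget has to
  cover both.\<close>

definition evals_within :: "prog \<Rightarrow> val list \<Rightarrow> exp \<Rightarrow> val \<Rightarrow> nat \<Rightarrow> bool" where
  "evals_within P \<Gamma> e v b \<longleftrightarrow> (\<exists>t. evals_to P \<Gamma> e v t \<and> t + val_size v \<le> b)"

lemma evals_withinI: "evals_to P \<Gamma> e v t \<Longrightarrow> t + val_size v \<le> b \<Longrightarrow> evals_within P \<Gamma> e v b"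
  unfolding evals_within_def by blast

lemma evals_withinE:
  assumes "evals_within P \<Gamma> e v b"
  obtains t where "evals_to P \<Gamma> e v t" "t + val_size v \<le> b"
  using assms unfolding evals_within_def by blast

lemma evals_within_mono: "evals_within P \<Gamma> e v b \<Longrightarrow> b \<le> b' \<Longrightarrow> evals_within P \<Gamma> e v b'"
  unfolding evals_within_def by (meson order_trans)

lemma evals_within_append: "evals_within P \<Gamma> e v b \<Longrightarrow> evals_within (P @ R) \<Gamma> e v b"
  unfolding evals_within_def by (meson evals_to_append)

lemma evals_within_shift_calls:
  "evals_within P \<Gamma> e v b \<Longrightarrow>
    evals_within (Q @ map (shift_calls (length Q)) P @ R) \<Gamma> (shift_calls (length Q) e) v b"
  unfolding evals_within_def by (meson evals_to_shift_calls)

lemma evals_within_Var0: "evals_within P [v] (EVar 0) v (1 + val_size v)"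
  using evals_to.Var[of 0 "[v]" P] by (intro evals_withinI[of _ _ _ _ 1]) simp_all

lemma evals_within_Pair:
  assumes "evals_within P \<Gamma> e1 u b1" "evals_within P \<Gamma> e2 v b2"
  shows "evals_within P \<Gamma> (EPair e1 e2) (PairV u v) (b1 + b2 + 2)"
  using assms by (elim evals_withinE) (rule evals_withinI, erule (1) evals_to.Pair, simp)

lemma evals_within_Fst: "evals_within P \<Gamma> e (PairV u v) b \<Longrightarrow> evals_within P \<Gamma> (EFst e) u b"
  by (elim evals_withinE) (rule evals_withinI, erule evals_to.Fst, simp)

lemma evals_within_Snd: "evals_within P \<Gamma> e (PairV u v) b \<Longrightarrow> evals_within P \<Gamma> (ESnd e) v b"
  by (elim evals_withinE) (rule evals_withinI, erule evals_to.Snd, simp)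

lemma evals_within_IsPair:
  assumes "evals_within P \<Gamma> e v b"
  shows "evals_within P \<Gamma> (EIsPair e) (IntV (of_bool (\<exists>u w. v = PairV u w))) (b + 2)"
proof -
  from assms obtain t where t: "evals_to P \<Gamma> e v t" "t + val_size v \<le> b"
    by (rule evals_withinE)
  show ?thesis
  proof (cases v)
    case (IntV a)
    with t show ?thesis using evals_withinI[OF evals_to.IsNoPair[of P \<Gamma> e a t]] by simp
  next
    case (PairV u w)
    with t show ?thesis using evals_withinI[OF evals_to.IsPair[of P \<Gamma> e u w t]] by simp
  qed
qed

lemma evals_within_Arith:
  assumes "evals_within P \<Gamma> e1 (IntV a) b1" "evals_within P \<Gamma> e2 (IntV b) b2"
  shows "evals_within P \<Gamma> (EArith f e1 e2) (IntV (arith_op f a b)) (2 * (b1 + b2))"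
  using assms
proof (elim evals_withinE)
  fix t1 t2
  assume "evals_to P \<Gamma> e1 (IntV a) t1" "t1 + val_size (IntV a) \<le> b1"
    "evals_to P \<Gamma> e2 (IntV b) t2" "t2 + val_size (IntV b) \<le> b2"
  then show ?thesis
    using bitlength_arith_op[of f a b] by (intro evals_withinI[OF evals_to.Arith]) auto
qed

lemma evals_within_If:
  assumes "evals_within P \<Gamma> e (IntV a) b1"
    and "a \<noteq> 0 \<Longrightarrow> evals_within P \<Gamma> e1 v b2" and "a = 0 \<Longrightarrow> evals_within P \<Gamma> e2 v b2"
  shows "evals_within P \<Gamma> (EIf e e1 e2) v (b1 + b2 + 1)"
proof -
  from assms(1) obtain t1 where t1: "evals_to P \<Gamma> e (IntV a) t1" "t1 + val_size (IntV a) \<le> b1"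
    by (rule evals_withinE)
  show ?thesis
  proof (cases "a = 0")
    case True
    with assms(3) obtain t2 where "evals_to P \<Gamma> e2 v t2" "t2 + val_size v \<le> b2"
      by (auto elim: evals_withinE)
    with t1 True show ?thesis by (intro evals_withinI[OF evals_to.IfFalse]) auto
  next
    case False
    with assms(2) obtain t2 where "evals_to P \<Gamma> e1 v t2" "t2 + val_size v \<le> b2"
      by (auto elim: evals_withinE)
    with t1 False show ?thesis by (intro evals_withinI[OF evals_to.IfTrue]) auto
  qed
qed

lemma evals_within_Call:
  assumes "evals_within P \<Gamma> e u b1" "evals_within P [u] e' v b2" "f < length P" "P ! f = e'"
  shows "evals_within P \<Gamma> (ECall f e) v (b1 + b2 + 1)"
  using assms(1,2)
proof (elim evals_withinE)
  fix t1 t2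
  assume "evals_to P \<Gamma> e u t1" "t1 + val_size u \<le> b1" "evals_to P [u] e' v t2" "t2 + val_size v \<le> b2"
  with assms(3,4) show ?thesis by (intro evals_withinI[OF evals_to.Call]) auto
qed

lemma ex_evals_within_const: "\<exists>e b. \<forall>P \<Gamma>. evals_within P \<Gamma> e v b"
proof (induction v)
  case (IntV a)
  show ?case by (blast intro: evals_withinI evals_to.Int)
next
  case (PairV u v)
  then show ?case by (blast intro: evals_within_Pair)
qed

lemma evals_within_loop:
  assumes step: "\<And>i. i < n \<Longrightarrow> evals_within P [v i] e (v (Suc i)) b"
    and test: "\<And>i. i \<le> n \<Longrightarrow> evals_within P [v i] c (IntV (of_bool (i < n))) b"
    and size: "val_size (v n) \<le> b"
  defines "loop \<equiv> EIf c (ECall (length P) e) (EVar 0)"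
  shows "i \<le> n \<Longrightarrow> evals_within (P @ [loop]) [v (n - i)] loop (v n) ((i + 1) * (2 * b + 2))"
proof (induction i)
  case 0
  have "evals_within (P @ [loop]) [v n] (EVar 0) (v n) (1 + b)"
    by (rule evals_within_mono[OF evals_within_Var0]) (use size in simp)
  with evals_within_append[OF test[of n]]
  have "evals_within (P @ [loop]) [v n] loop (v n) (b + (1 + b) + 1)"
    unfolding loop_def by (intro evals_within_If) auto
  then show ?case by (simp add: mult_2)
next
  case (Suc i)
  let ?k = "n - Suc i"
  have k: "?k < n" "Suc ?k = n - i" using Suc.prems by auto
  let ?b = "b + (i + 1) * (2 * b + 2) + 1"
  have "evals_within (P @ [loop]) [v ?k] (ECall (length P) e) (v n) ?b"
    using evals_within_append[OF step[OF k(1)]] Suc.IH Suc.prems unfolding k(2)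
    by (intro evals_within_Call) (simp_all add: loop_def)
  with evals_within_append[OF test[of ?k]] k(1)
  have "evals_within (P @ [loop]) [v ?k] loop (v n) (b + ?b + 1)"
    unfolding loop_def by (intro evals_within_If) auto
  moreover have "b + ?b + 1 = (Suc i + 1) * (2 * b + 2)" by simp
  ultimately show ?case by (simp only:)
qed


section \<open>Encodings and polynomial bounds\<close>

class codable =
  fixes enc :: "'a \<Rightarrow> val"

instantiation val :: codable begin
definition enc_val :: "val \<Rightarrow> val" where "enc_val v = v"
instance ..
end

instantiation int :: codable begin
definition enc_int :: "int \<Rightarrow> val" where "enc_int = IntV"
instance ..
end

instantiation nat :: codable begin
definition enc_nat :: "nat \<Rightarrow> val" where "enc_nat n = IntV (int n)"
instance ..
end

instantiation bool :: codable begin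
definition enc_bool :: "bool \<Rightarrow> val" where "enc_bool b = IntV (of_bool b)"
instance ..
end

instantiation prod :: (codable, codable) codable begin
definition enc_prod :: "'a \<times> 'b \<Rightarrow> val" where "enc_prod p = PairV (enc (fst p)) (enc (snd p))"
instance ..
end

instantiation list :: (codable) codable begin
definition enc_list_inst: "enc (xs :: 'a list) = enc_list (map enc xs)"
instance ..
end

instantiation option :: (codable) codable begin
definition enc_option :: "'a option \<Rightarrow> val" where
  "enc_option x = (case x of None \<Rightarrow> IntV 0 | Some a \<Rightarrow> PairV (enc a) (IntV 0))"
instance ..
end

instantiation rat :: codable begin
definition enc_rat_inst: "enc (r :: rat) = enc_rat r"
instance ..
end

lemma enc_simps [simp]:
  "enc v = v"
  "enc (a :: int) = IntV a"
  "enc (n :: nat) = IntV (int n)"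
  "enc b = IntV (of_bool b)"
  "enc (x, y) = PairV (enc x) (enc y)"
  "enc ([] :: 'a :: codable list) = IntV 0"
  "enc (z # zs) = PairV (enc z) (enc zs)"
  "enc (None :: 'a option) = IntV 0"
  "enc (Some w) = PairV (enc w) (IntV 0)"
  by (simp_all add: enc_val_def enc_int_def enc_nat_def enc_bool_def enc_prod_def enc_list_inst
      enc_option_def)

lemma enc_quotient_of: "enc (quotient_of r) = enc r"
  by (simp add: enc_rat_inst enc_rat_def split: prod.split)

abbreviation esize :: "'a :: codable \<Rightarrow> nat" where
  "esize x \<equiv> val_size (enc x)"

lemma esize_prod: "esize p = 1 + esize (fst p) + esize (snd p)"
  by (cases p) simp

lemma esize_list: "esize xs = 1 + (\<Sum>x\<leftarrow>xs. 1 + esize x)"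
  by (induction xs) simp_all

lemma esize_append: "esize (xs @ ys) + 1 = esize xs + esize ys"
  by (simp add: esize_list)

lemma esize_append_le: "esize (xs @ ys) \<le> esize xs + esize ys"
  using esize_append[of xs ys] by simp

lemma esize_rev: "esize (rev xs) = esize xs"
  by (simp only: esize_list rev_map[symmetric] sum_list_rev)

lemma esize_mset_eq:
  assumes "mset xs = mset ys"
  shows "esize xs = esize ys"
proof -
  have "mset (map (\<lambda>x. 1 + esize x) xs) = mset (map (\<lambda>x. 1 + esize x) ys)"
    by (simp only: mset_map assms)
  then show ?thesis by (simp only: esize_list sum_mset_sum_list[symmetric])
qed

lemma esize_prefix_le: "esize xs \<le> esize (xs @ ys)"
  and esize_suffix_le: "esize ys \<le> esize (xs @ ys)"
  by (simp_all add: esize_list)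

lemma esize_drop_le: "esize (drop n xs) \<le> esize xs"
  using esize_suffix_le[of "drop n xs" "take n xs"] by simp

lemma esize_member_le: "x \<in> set xs \<Longrightarrow> esize x \<le> esize xs"
  by (induction xs) auto

lemma length_le_esize: "length xs \<le> esize xs"
  by (induction xs) auto

lemma esize_list_le:
  assumes "\<And>x. x \<in> set xs \<Longrightarrow> esize x \<le> b" "length xs \<le> n"
  shows "esize xs \<le> 1 + n * (1 + b)"
proof -
  have "(\<Sum>x\<leftarrow>xs. 1 + esize x) \<le> length xs * (1 + b)"
    using assms(1) by (induction xs) fastforce+
  also have "\<dots> \<le> n * (1 + b)"
    using assms(2) by (rule mult_right_mono) simp
  finally show ?thesis by (simp add: esize_list)
qed

lemma esize_map_le: "(\<And>x. esize (f x) \<le> esize x) \<Longrightarrow> esize (map f xs) \<le> esize xs"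
  by (induction xs) (auto intro: add_mono)

lemma poly_nat_mono: "a \<le> b \<Longrightarrow> poly (q :: nat poly) a \<le> poly q b"
  by (induction q) (simp_all add: add_mono mult_le_mono)

definition poly_bounded :: "'a :: codable set \<Rightarrow> ('a \<Rightarrow> nat) \<Rightarrow> bool" where
  "poly_bounded D m \<longleftrightarrow> (\<exists>q. \<forall>x \<in> D. m x \<le> poly q (esize x))"

lemma poly_boundedE:
  assumes "poly_bounded D m"
  obtains q where "\<And>x. x \<in> D \<Longrightarrow> m x \<le> poly q (esize x)"
  using assms unfolding poly_bounded_def by blast

lemma poly_bounded_mono:
  "poly_bounded D m \<Longrightarrow> (\<And>x. x \<in> D \<Longrightarrow> m' x \<le> m x) \<Longrightarrow> poly_bounded D m'"
  unfolding poly_bounded_def by (meson order_trans)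

lemma poly_bounded_subset: "poly_bounded D m \<Longrightarrow> E \<subseteq> D \<Longrightarrow> poly_bounded E m"
  unfolding poly_bounded_def by blast

named_theorems poly_bounded_intros

lemma poly_bounded_const [poly_bounded_intros]: "poly_bounded D (\<lambda>x. c)"
  unfolding poly_bounded_def by (rule exI[of _ "[:c:]"]) simp

lemma poly_bounded_esize [poly_bounded_intros]: "poly_bounded D (\<lambda>x. esize x)"
  unfolding poly_bounded_def by (rule exI[of _ "[:0, 1:]"]) simp

lemma poly_bounded_add [poly_bounded_intros]:
  assumes "poly_bounded D m" "poly_bounded D m'"
  shows "poly_bounded D (\<lambda>x. m x + m' x)"
  using assms
proof (elim poly_boundedE)
  fix q q'
  assume "\<And>x. x \<in> D \<Longrightarrow> m x \<le> poly q (esize x)" "\<And>x. x \<in> D \<Longrightarrow> m' x \<le> poly q' (esize x)"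
  then show ?thesis
    unfolding poly_bounded_def by (intro exI[of _ "q + q'"]) (simp add: add_mono)
qed

lemma poly_bounded_mult [poly_bounded_intros]:
  assumes "poly_bounded D m" "poly_bounded D m'"
  shows "poly_bounded D (\<lambda>x. m x * m' x)"
  using assms
proof (elim poly_boundedE)
  fix q q'
  assume "\<And>x. x \<in> D \<Longrightarrow> m x \<le> poly q (esize x)" "\<And>x. x \<in> D \<Longrightarrow> m' x \<le> poly q' (esize x)"
  then show ?thesis
    unfolding poly_bounded_def by (intro exI[of _ "q * q'"]) (simp add: mult_le_mono)
qed

lemma poly_bounded_poly [poly_bounded_intros]:
  assumes "poly_bounded D m"
  shows "poly_bounded D (\<lambda>x. poly q (m x))"
  using assms
proof (rule poly_boundedE)
  fix q'
  assume "\<And>x. x \<in> D \<Longrightarrow> m x \<le> poly q' (esize x)"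
  then show ?thesis
    unfolding poly_bounded_def
    by (intro exI[of _ "pcompose q q'"]) (simp add: poly_pcompose poly_nat_mono)
qed

lemma poly_bounded_power [poly_bounded_intros]:
  "poly_bounded D m \<Longrightarrow> poly_bounded D (\<lambda>x. m x ^ n)"
  by (induction n) (simp_all add: poly_bounded_const poly_bounded_mult)

lemma poly_bounded_if:
  assumes "poly_bounded {x \<in> D. C x} m" "poly_bounded {x \<in> D. \<not> C x} m'"
  shows "poly_bounded D (\<lambda>x. if C x then m x else m' x)"
  using assms
proof (elim poly_boundedE)
  fix q q'
  assume "\<And>x. x \<in> {x \<in> D. C x} \<Longrightarrow> m x \<le> poly q (esize x)"
    "\<And>x. x \<in> {x \<in> D. \<not> C x} \<Longrightarrow> m' x \<le> poly q' (esize x)"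
  then show ?thesis
    unfolding poly_bounded_def by (intro exI[of _ "q + q'"]) (auto intro: trans_le_add1 trans_le_add2)
qed

lemma poly_bounded_comp:
  assumes m: "poly_bounded E m" and f: "poly_bounded D (\<lambda>x. esize (f x))"
    and sub: "\<And>x. x \<in> D \<Longrightarrow> f x \<in> E"
  shows "poly_bounded D (\<lambda>x. m (f x))"
proof -
  from m obtain q where q: "\<And>y. y \<in> E \<Longrightarrow> m y \<le> poly q (esize y)"
    by (rule poly_boundedE) blast
  show ?thesis
    by (rule poly_bounded_mono[OF poly_bounded_poly[OF f, of q]]) (rule q[OF sub])
qed

lemma poly_bounded_over_set:
  assumes L: "poly_bounded D (\<lambda>x. esize (L x))"
    and G: "poly_bounded (SIGMA x:D. set (L x)) (\<lambda>p. m (fst p) (snd p))"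
  obtains b where "poly_bounded D b" "\<And>x y. x \<in> D \<Longrightarrow> y \<in> set (L x) \<Longrightarrow> m x y \<le> b x"
proof -
  from G obtain q
    where q: "\<And>p. p \<in> (SIGMA x:D. set (L x)) \<Longrightarrow> m (fst p) (snd p) \<le> poly q (esize p)"
    by (rule poly_boundedE) blast
  show ?thesis
  proof
    show "poly_bounded D (\<lambda>x. poly q (1 + esize x + esize (L x)))"
      by (intro poly_bounded_intros L)
    fix x y assume x: "x \<in> D" and y: "y \<in> set (L x)"
    have "m x y \<le> poly q (esize (x, y))"
      using q[of "(x, y)"] x y by simp
    also have "\<dots> \<le> poly q (1 + esize x + esize (L x))"
      using esize_member_le[OF y] by (intro poly_nat_mono) simp
    finally show "m x y \<le> poly q (1 + esize x + esize (L x))" .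
  qed
qed


section \<open>Functions computable in polynomial time\<close>

definition computes_within ::
    "prog \<Rightarrow> exp \<Rightarrow> 'a :: codable set \<Rightarrow> ('a \<Rightarrow> 'b :: codable) \<Rightarrow> ('a \<Rightarrow> nat) \<Rightarrow> bool" where
  "computes_within P e D F b \<longleftrightarrow> (\<forall>x \<in> D. evals_within P [enc x] e (enc (F x)) (b x))"

definition ptime :: "'a :: codable set \<Rightarrow> ('a \<Rightarrow> 'b :: codable) \<Rightarrow> bool" where
  "ptime D F \<longleftrightarrow> (\<exists>P e b. poly_bounded D b \<and> computes_within P e D F b)"

lemma computes_withinI:
  "(\<And>x. x \<in> D \<Longrightarrow> evals_within P [enc x] e (enc (F x)) (b x)) \<Longrightarrow> computes_within P e D F b"
  unfolding computes_within_def by blast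

lemma computes_withinD:
  "computes_within P e D F b \<Longrightarrow> x \<in> D \<Longrightarrow> evals_within P [enc x] e (enc (F x)) (b x)"
  unfolding computes_within_def by blast

lemma computes_within_append: "computes_within P e D F b \<Longrightarrow> computes_within (P @ R) e D F b"
  unfolding computes_within_def by (meson evals_within_append)

lemma computes_within_shift_calls:
  "computes_within P e D F b \<Longrightarrow>
    computes_within (Q @ map (shift_calls (length Q)) P @ R) (shift_calls (length Q) e) D F b"
  unfolding computes_within_def by (meson evals_within_shift_calls)

lemma ptimeI: "poly_bounded D b \<Longrightarrow> computes_within P e D F b \<Longrightarrow> ptime D F"
  unfolding ptime_def by blast

lemma ptimeE:
  assumes "ptime D F"
  obtains P e b where "poly_bounded D b" "computes_within P e D F b"
  using assms unfolding ptime_def by blast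

lemma ptimeE2:
  assumes "ptime D F" "ptime E G"
  obtains P e1 e2 b1 b2 where "poly_bounded D b1" "poly_bounded E b2"
    "computes_within P e1 D F b1" "computes_within P e2 E G b2"
proof -
  obtain P1 e1 b1 where F: "poly_bounded D b1" "computes_within P1 e1 D F b1"
    using assms(1) by (rule ptimeE)
  obtain P2 e2 b2 where G: "poly_bounded E b2" "computes_within P2 e2 E G b2"
    using assms(2) by (rule ptimeE)
  show thesis
    by (rule that[OF F(1) G(1) computes_within_append[OF F(2)]])
      (use computes_within_shift_calls[OF G(2), of P1 "[]"] in simp)
qed

lemma ptimeE3:
  assumes "ptime D F" "ptime E G" "ptime E' H"
  obtains P e1 e2 e3 b1 b2 b3 where "poly_bounded D b1" "poly_bounded E b2" "poly_bounded E' b3"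
    "computes_within P e1 D F b1" "computes_within P e2 E G b2" "computes_within P e3 E' H b3"
proof -
  obtain P1 e1 e2 b1 b2 where FG: "poly_bounded D b1" "poly_bounded E b2"
    "computes_within P1 e1 D F b1" "computes_within P1 e2 E G b2"
    using assms(1,2) by (rule ptimeE2)
  obtain P2 e3 b3 where H: "poly_bounded E' b3" "computes_within P2 e3 E' H b3"
    using assms(3) by (rule ptimeE)
  show thesis
    by (rule that[OF FG(1,2) H(1) FG(3,4)[THEN computes_within_append]])
      (use computes_within_shift_calls[OF H(2), of P1 "[]"] in simp)
qed

lemma ptime_poly_bounded: "ptime D F \<Longrightarrow> poly_bounded D (\<lambda>x. esize (F x))"
proof (erule ptimeE)
  fix P e b
  assume bounded: "poly_bounded D b" and computes: "computes_within P e D F b"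
  show ?thesis
    by (rule poly_bounded_mono[OF bounded])
      (auto dest!: computes_withinD[OF computes] elim: evals_withinE)
qed

lemma ptime_subset: "ptime D F \<Longrightarrow> E \<subseteq> D \<Longrightarrow> ptime E F"
  by (elim ptimeE, rule ptimeI, erule poly_bounded_subset)
    (auto simp: computes_within_def)

lemma ptime_enc_cong:
  assumes "ptime D F" "\<And>x. x \<in> D \<Longrightarrow> enc (G x) = enc (F x)"
  shows "ptime D G"
  using assms unfolding ptime_def computes_within_def by simp

lemma ptime_cong: "ptime D F \<Longrightarrow> (\<And>x. x \<in> D \<Longrightarrow> G x = F x) \<Longrightarrow> ptime D G"
  by (rule ptime_enc_cong) auto

named_theorems ptime_intros

lemma ptime_const [ptime_intros]: "ptime D (\<lambda>x. c)"
proof -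
  obtain e b where "\<forall>P \<Gamma>. evals_within P \<Gamma> e (enc c) b"
    using ex_evals_within_const by blast
  then show ?thesis
    by (intro ptimeI[OF poly_bounded_const] computes_withinI) blast
qed

lemma ptime_ident [ptime_intros]: "ptime D (\<lambda>x. x)"
  by (intro ptimeI[of _ "\<lambda>x. 1 + esize x" "[]" "EVar 0"] poly_bounded_intros computes_withinI
      evals_within_Var0)

lemma ptime_comp:
  assumes G: "ptime E G" and F: "ptime D F" and sub: "\<And>x. x \<in> D \<Longrightarrow> F x \<in> E"
  shows "ptime D (\<lambda>x. G (F x))"
  using G F
proof (rule ptimeE2)
  fix P e1 e2 b1 b2
  assume bounded: "poly_bounded E b1" "poly_bounded D b2"
    and computes: "computes_within P e1 E G b1" "computes_within P e2 D F b2"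
  have "poly_bounded D (\<lambda>x. b2 x + b1 (F x) + 1)"
    by (intro poly_bounded_intros bounded poly_bounded_comp[OF bounded(1)] ptime_poly_bounded F sub)
  moreover have "computes_within (P @ [e1]) (ECall (length P) e2) D (\<lambda>x. G (F x))
      (\<lambda>x. b2 x + b1 (F x) + 1)"
  proof (rule computes_withinI, rule evals_within_Call)
    fix x assume x: "x \<in> D"
    show "evals_within (P @ [e1]) [enc x] e2 (enc (F x)) (b2 x)"
      by (rule evals_within_append[OF computes_withinD[OF computes(2) x]])
    show "evals_within (P @ [e1]) [enc (F x)] e1 (enc (G (F x))) (b1 (F x))"
      by (rule evals_within_append[OF computes_withinD[OF computes(1) sub[OF x]]])
  qed simp_all
  ultimately show ?thesis by (rule ptimeI)
qed

lemma ptime_Pair [ptime_intros]: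
  assumes "ptime D F" "ptime D G"
  shows "ptime D (\<lambda>x. (F x, G x))"
  using assms
proof (rule ptimeE2)
  fix P e1 e2 b1 b2
  assume bounded: "poly_bounded D b1" "poly_bounded D b2"
    and computes: "computes_within P e1 D F b1" "computes_within P e2 D G b2"
  have "computes_within P (EPair e1 e2) D (\<lambda>x. (F x, G x)) (\<lambda>x. b1 x + b2 x + 2)"
    unfolding computes_within_def enc_simps
    by (intro ballI evals_within_Pair computes[THEN computes_withinD])
  then show ?thesis
    by (rule ptimeI[rotated]) (intro poly_bounded_intros bounded)
qed

lemma ptime_fst [ptime_intros]:
  assumes "ptime D F"
  shows "ptime D (\<lambda>x. fst (F x))"
  using assms
proof (rule ptimeE)
  fix P e b
  assume bounded: "poly_bounded D b" and computes: "computes_within P e D F b"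
  have "computes_within P (EFst e) D (\<lambda>x. fst (F x)) b"
    using computes by (auto simp: computes_within_def enc_prod_def intro: evals_within_Fst)
  with bounded show ?thesis by (rule ptimeI)
qed

lemma ptime_snd [ptime_intros]:
  assumes "ptime D F"
  shows "ptime D (\<lambda>x. snd (F x))"
  using assms
proof (rule ptimeE)
  fix P e b
  assume bounded: "poly_bounded D b" and computes: "computes_within P e D F b"
  have "computes_within P (ESnd e) D (\<lambda>x. snd (F x)) b"
    using computes by (auto simp: computes_within_def enc_prod_def intro: evals_within_Snd)
  with bounded show ?thesis by (rule ptimeI)
qed

lemma ptime_comp2:
  assumes "ptime UNIV (\<lambda>p. f (fst p) (snd p))" "ptime D F" "ptime D G"
  shows "ptime D (\<lambda>x. f (F x) (G x))"
  using ptime_comp[OF assms(1) ptime_Pair[OF assms(2,3)]] by simp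

lemma ptime_comp3:
  assumes "ptime UNIV (\<lambda>p. f (fst p) (fst (snd p)) (snd (snd p)))"
    "ptime D F" "ptime D G" "ptime D H"
  shows "ptime D (\<lambda>x. f (F x) (G x) (H x))"
  using ptime_comp[OF assms(1) ptime_Pair[OF assms(2) ptime_Pair[OF assms(3,4)]]] by simp

lemma ptime_comp4:
  assumes "ptime UNIV (\<lambda>p. f (fst p) (fst (snd p)) (fst (snd (snd p))) (snd (snd (snd p))))"
    "ptime D F" "ptime D G" "ptime D H" "ptime D K"
  shows "ptime D (\<lambda>x. f (F x) (G x) (H x) (K x))"
  using ptime_comp[OF assms(1) ptime_Pair[OF assms(2) ptime_Pair[OF assms(3)
    ptime_Pair[OF assms(4,5)]]]]
  by simp

lemma ptime_comp_fst: "ptime D F \<Longrightarrow> ptime (Sigma D A) (\<lambda>p. F (fst p))"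
  by (rule ptime_comp[OF _ ptime_fst[OF ptime_ident]]) auto

lemma ptime_arith_op:
  fixes F G :: "'a :: codable \<Rightarrow> int"
  assumes "ptime D F" "ptime D G"
  shows "ptime D (\<lambda>x. arith_op f (F x) (G x))"
  using assms
proof (rule ptimeE2)
  fix P e1 e2 b1 b2
  assume bounded: "poly_bounded D b1" "poly_bounded D b2"
    and computes: "computes_within P e1 D F b1" "computes_within P e2 D G b2"
  have "computes_within P (EArith f e1 e2) D (\<lambda>x. arith_op f (F x) (G x)) (\<lambda>x. 2 * (b1 x + b2 x))"
    using computes unfolding computes_within_def enc_simps by (blast intro: evals_within_Arith)
  then show ?thesis
    by (rule ptimeI[rotated]) (intro poly_bounded_intros bounded)
qed

lemma
  fixes F G :: "'a :: codable \<Rightarrow> int"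
  assumes "ptime D F" "ptime D G"
  shows ptime_add [ptime_intros]: "ptime D (\<lambda>x. F x + G x)"
    and ptime_diff [ptime_intros]: "ptime D (\<lambda>x. F x - G x)"
    and ptime_mult [ptime_intros]: "ptime D (\<lambda>x. F x * G x)"
    and ptime_div [ptime_intros]: "ptime D (\<lambda>x. F x div G x)"
    and ptime_less [ptime_intros]: "ptime D (\<lambda>x. F x < G x)"
proof -
  show "ptime D (\<lambda>x. F x < G x)"
    by (rule ptime_enc_cong[OF ptime_arith_op[OF assms, of Less]]) simp
qed (use ptime_arith_op[OF assms, of Add] ptime_arith_op[OF assms, of Sub]
    ptime_arith_op[OF assms, of Mul] ptime_arith_op[OF assms, of Div] in simp_all)

lemma ptime_if_on:
  assumes "ptime D C" "ptime {x \<in> D. C x} F" "ptime {x \<in> D. \<not> C x} G"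
  shows "ptime D (\<lambda>x. if C x then F x else G x)"
  using assms
proof (rule ptimeE3)
  fix P c e1 e2 bc b1 b2
  assume bounded: "poly_bounded D bc" "poly_bounded {x \<in> D. C x} b1" "poly_bounded {x \<in> D. \<not> C x} b2"
    and computes: "computes_within P c D C bc" "computes_within P e1 {x \<in> D. C x} F b1"
      "computes_within P e2 {x \<in> D. \<not> C x} G b2"
  let ?b = "\<lambda>x. bc x + (if C x then b1 x else b2 x) + 1"
  have "computes_within P (EIf c e1 e2) D (\<lambda>x. if C x then F x else G x) ?b"
  proof (intro computes_withinI evals_within_If)
    fix x assume x: "x \<in> D"
    show "evals_within P [enc x] c (IntV (of_bool (C x))) (bc x)"
      using computes_withinD[OF computes(1) x] by simp
    show "evals_within P [enc x] e1 (enc (if C x then F x else G x)) (if C x then b1 x else b2 x)"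
      if "of_bool (C x) \<noteq> (0 :: int)"
      using computes_withinD[OF computes(2), of x] x that by simp
    show "evals_within P [enc x] e2 (enc (if C x then F x else G x)) (if C x then b1 x else b2 x)"
      if "of_bool (C x) = (0 :: int)"
      using computes_withinD[OF computes(3), of x] x that by simp
  qed
  then show ?thesis
    by (rule ptimeI[rotated]) (intro poly_bounded_intros poly_bounded_if bounded)
qed

lemma ptime_if [ptime_intros]:
  "ptime D C \<Longrightarrow> ptime D F \<Longrightarrow> ptime D G \<Longrightarrow> ptime D (\<lambda>x. if C x then F x else G x)"
  by (intro ptime_if_on) (auto intro: ptime_subset)

lemma ptime_is_PairV:
  assumes "ptime D F"
  shows "ptime D (\<lambda>x. \<exists>u v. enc (F x) = PairV u v)"
  using assms
proof (rule ptimeE)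
  fix P e b
  assume bounded: "poly_bounded D b" and computes: "computes_within P e D F b"
  have "computes_within P (EIsPair e) D (\<lambda>x. \<exists>u v. enc (F x) = PairV u v) (\<lambda>x. b x + 2)"
    unfolding computes_within_def enc_simps
    by (intro ballI evals_within_IsPair computes[THEN computes_withinD])
  then show ?thesis
    by (rule ptimeI[rotated]) (intro poly_bounded_intros bounded)
qed

lemma ptime_neq_None: "ptime D F \<Longrightarrow> ptime D (\<lambda>x. F x \<noteq> None)"
  by (rule ptime_cong[OF ptime_is_PairV[of D F]]) (auto simp: enc_option_def split: option.splits)

lemma ptime_neq_Nil:
  assumes "ptime D F"
  shows "ptime D (\<lambda>x. F x \<noteq> [])"
proof (rule ptime_cong[OF ptime_is_PairV[OF assms]])
  show "F x \<noteq> [] \<longleftrightarrow> (\<exists>u v. enc (F x) = PairV u v)" for x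
    by (cases "F x") auto
qed

lemma ptime_the:
  assumes F: "ptime D F" and "\<And>x. x \<in> D \<Longrightarrow> F x \<noteq> None"
  shows "ptime D (\<lambda>x. the (F x))"
proof -
  have "ptime D (\<lambda>x. (the (F x), 0 :: int))"
    by (rule ptime_enc_cong[OF F]) (use assms(2) in force)
  from ptime_fst[OF this] show ?thesis by simp
qed

lemma ptime_hd_tl:
  assumes F: "ptime D F" and "\<And>x. x \<in> D \<Longrightarrow> F x \<noteq> []"
  shows "ptime D (\<lambda>x. (hd (F x), tl (F x)))"
  by (rule ptime_enc_cong[OF F]) (use assms(2) in \<open>force simp: neq_Nil_conv\<close>)

lemma ptime_case_option [ptime_intros]:
  assumes L: "ptime D L" and F: "ptime D F"
    and G: "ptime (SIGMA x:D. {a. L x = Some a}) (\<lambda>p. G (fst p) (snd p))"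
  shows "ptime D (\<lambda>x. case L x of None \<Rightarrow> F x | Some a \<Rightarrow> G x a)"
proof -
  have "ptime {x \<in> D. L x \<noteq> None} (\<lambda>x. (x, the (L x)))"
    by (intro ptime_intros ptime_the ptime_subset[OF L]) auto
  from ptime_comp[OF G this] have "ptime {x \<in> D. L x \<noteq> None} (\<lambda>x. G x (the (L x)))" by auto
  then have "ptime D (\<lambda>x. if L x \<noteq> None then G x (the (L x)) else F x)"
    by (intro ptime_if_on ptime_neq_None L ptime_subset[OF F]) auto
  then show ?thesis by (rule ptime_cong) (auto split: option.split)
qed

lemma ptime_case_list [ptime_intros]:
  assumes L: "ptime D L" and F: "ptime D F"
    and G: "ptime (SIGMA x:D. {p. L x = fst p # snd p}) (\<lambda>p. G (fst p) (fst (snd p)) (snd (snd p)))"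
  shows "ptime D (\<lambda>x. case L x of [] \<Rightarrow> F x | a # as \<Rightarrow> G x a as)"
proof -
  have "ptime {x \<in> D. L x \<noteq> []} (\<lambda>x. (x, hd (L x), tl (L x)))"
    by (intro ptime_Pair ptime_ident ptime_hd_tl ptime_subset[OF L]) auto
  from ptime_comp[OF G this] have "ptime {x \<in> D. L x \<noteq> []} (\<lambda>x. G x (hd (L x)) (tl (L x)))" by auto
  then have "ptime D (\<lambda>x. if L x \<noteq> [] then G x (hd (L x)) (tl (L x)) else F x)"
    by (intro ptime_if_on ptime_neq_Nil L ptime_subset[OF F]) auto
  then show ?thesis by (rule ptime_cong) (auto split: list.split)
qed

lemma computes_within_polyE:
  assumes computes: "computes_within P e E F b" and bounded: "poly_bounded E b"
  obtains q where "\<And>s m. s \<in> E \<Longrightarrow> esize s \<le> m \<Longrightarrow> evals_within P [enc s] e (enc (F s)) (poly q m)"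
proof -
  obtain q where q: "\<And>s. s \<in> E \<Longrightarrow> b s \<le> poly q (esize s)"
    using bounded by (rule poly_boundedE) blast
  have "evals_within P [enc s] e (enc (F s)) (poly q m)" if "s \<in> E" "esize s \<le> m" for s m
    using computes_withinD[OF computes that(1)] order_trans[OF q[OF that(1)] poly_nat_mono[OF that(2)]]
    by (rule evals_within_mono)
  then show thesis by (rule that)
qed

lemma ptime_iterate:
  fixes g :: "'b :: codable \<Rightarrow> 'b"
  assumes test: "ptime E c" and step: "ptime {s \<in> E. c s} g" and init: "ptime D I"
    and n: "poly_bounded D n" and b: "poly_bounded D b"
    and orbit: "\<And>x i. x \<in> D \<Longrightarrow> i \<le> n x \<Longrightarrow> (g ^^ i) (I x) \<in> E"
    and c_orbit: "\<And>x i. x \<in> D \<Longrightarrow> i \<le> n x \<Longrightarrow> c ((g ^^ i) (I x)) \<longleftrightarrow> i < n x"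
    and size: "\<And>x i. x \<in> D \<Longrightarrow> i \<le> n x \<Longrightarrow> esize ((g ^^ i) (I x)) \<le> b x"
  shows "ptime D (\<lambda>x. (g ^^ n x) (I x))"
  using test step init
proof (rule ptimeE3)
  fix P ec eg eI bc bg bI
  assume bounded: "poly_bounded E bc" "poly_bounded {s \<in> E. c s} bg" "poly_bounded D bI"
    and computes: "computes_within P ec E c bc" "computes_within P eg {s \<in> E. c s} g bg"
      "computes_within P eI D I bI"
  obtain qc where qc: "\<And>s m. s \<in> E \<Longrightarrow> esize s \<le> m \<Longrightarrow> evals_within P [enc s] ec (enc (c s)) (poly qc m)"
    by (rule computes_within_polyE[OF computes(1) bounded(1)]) blast
  obtain qg where qg: "\<And>s m. s \<in> {s \<in> E. c s} \<Longrightarrow> esize s \<le> m \<Longrightarrow>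
      evals_within P [enc s] eg (enc (g s)) (poly qg m)"
    by (rule computes_within_polyE[OF computes(2) bounded(2)]) blast
  define loop where "loop = EIf ec (ECall (length P) eg) (EVar 0)"
  let ?B = "\<lambda>x. poly qc (b x) + poly qg (b x) + b x"
  let ?b = "\<lambda>x. bI x + (n x + 1) * (2 * ?B x + 2) + 1"
  have "computes_within (P @ [loop]) (ECall (length P) eI) D (\<lambda>x. (g ^^ n x) (I x)) ?b"
  proof (rule computes_withinI, rule evals_within_Call)
    fix x assume x: "x \<in> D"
    show "evals_within (P @ [loop]) [enc x] eI (enc (I x)) (bI x)"
      by (rule evals_within_append[OF computes_withinD[OF computes(3) x]])
    let ?s = "\<lambda>i. (g ^^ i) (I x)"
    have "evals_within P [enc (?s i)] eg (enc (?s (Suc i))) (?B x)" if "i < n x" for i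
      using evals_within_mono[OF qg[of "?s i" "b x"], of "?B x"] orbit c_orbit size x that by simp
    moreover have "evals_within P [enc (?s i)] ec (IntV (of_bool (i < n x))) (?B x)" if "i \<le> n x" for i
      using evals_within_mono[OF qc[of "?s i" "b x"], of "?B x"] orbit c_orbit size x that by simp
    moreover have "esize (?s (n x)) \<le> ?B x" using size[OF x order_refl] by simp
    ultimately have "evals_within (P @ [loop]) [enc (?s (n x - n x))] loop (enc (?s (n x)))
        ((n x + 1) * (2 * ?B x + 2))"
      unfolding loop_def by (rule evals_within_loop[OF _ _ _ order_refl])
    then show "evals_within (P @ [loop]) [enc (I x)] loop (enc (?s (n x))) ((n x + 1) * (2 * ?B x + 2))"
      by simp
  qed simp_all
  then show ?thesis
    by (rule ptimeI[rotated]) (intro poly_bounded_intros bounded b n)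
qed

lemma ptime_fold:
  assumes L: "ptime D L" and init: "ptime D init"
    and step: "ptime (SIGMA x:D. {p. \<exists>ys zs. L x = ys @ fst p # zs \<and> snd p = fold (f x) ys (init x)})
      (\<lambda>p. f (fst p) (fst (snd p)) (snd (snd p)))"
    and b: "poly_bounded D b"
      "\<And>x ys zs. x \<in> D \<Longrightarrow> L x = ys @ zs \<Longrightarrow> esize (fold (f x) ys (init x)) \<le> b x"
  shows "ptime D (\<lambda>x. fold (f x) (L x) (init x))"
proof -
  let ?S = "SIGMA x:D. {p. \<exists>ys zs. L x = ys @ fst p # zs \<and> snd p = fold (f x) ys (init x)}"
  define g where "g = (\<lambda>(zs, x, a). (tl zs, x, f x (hd zs) a))"
  define E where "E = {(zs, x, a). x \<in> D \<and> (\<exists>ys. L x = ys @ zs \<and> a = fold (f x) ys (init x))}"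
  have funpow_g: "(g ^^ i) (L x, x, init x) = (drop i (L x), x, fold (f x) (take i (L x)) (init x))"
    if "i \<le> length (L x)" for i x
    using that
    by (induction i) (simp_all add: g_def take_Suc_conv_app_nth hd_drop_conv_nth tl_drop drop_Suc)
  have "ptime D (\<lambda>x. (g ^^ length (L x)) (L x, x, init x))"
  proof (rule ptime_iterate)
    show "ptime E (\<lambda>s. fst s \<noteq> [])" by (intro ptime_neq_Nil ptime_intros)
    have "ptime {s \<in> E. fst s \<noteq> []} (\<lambda>s. (hd (fst s), tl (fst s)))"
      by (rule ptime_hd_tl) (intro ptime_intros, auto)
    note hd_tl = ptime_fst[OF this] ptime_snd[OF this]
    have "ptime {s \<in> E. fst s \<noteq> []} (\<lambda>s. (fst (snd s), hd (fst s), snd (snd s)))"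
      using hd_tl by (intro ptime_intros) simp_all
    note ptime_comp[OF step this]
    moreover have "(fst (snd s), hd (fst s), snd (snd s)) \<in> ?S" if "s \<in> {s \<in> E. fst s \<noteq> []}" for s
      using that unfolding E_def by (clarsimp simp: neq_Nil_conv) blast
    ultimately have "ptime {s \<in> E. fst s \<noteq> []} (\<lambda>s. f (fst (snd s)) (hd (fst s)) (snd (snd s)))"
      by (simp only: fst_conv snd_conv)
    then show "ptime {s \<in> E. fst s \<noteq> []} g"
      using hd_tl unfolding g_def case_prod_beta by (intro ptime_intros) simp_all
    show "poly_bounded D (\<lambda>x. length (L x))"
      by (rule poly_bounded_mono[OF ptime_poly_bounded[OF L]]) (rule length_le_esize)
    show "poly_bounded D (\<lambda>x. 2 + esize (L x) + esize x + b x)"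
      by (intro poly_bounded_intros b ptime_poly_bounded[OF L])
    fix x i assume x: "x \<in> D" and i: "i \<le> length (L x)"
    show "(g ^^ i) (L x, x, init x) \<in> E"
      unfolding funpow_g[OF i] E_def using x by (auto intro: exI[of _ "take i (L x)"])
    show "fst ((g ^^ i) (L x, x, init x)) \<noteq> [] \<longleftrightarrow> i < length (L x)"
      by (simp add: funpow_g[OF i] not_le)
    show "esize ((g ^^ i) (L x, x, init x)) \<le> 2 + esize (L x) + esize x + b x"
      using esize_drop_le[of i "L x"] b(2)[OF x append_take_drop_id[symmetric], of i]
      by (simp add: funpow_g[OF i])
  qed (intro ptime_intros L init)
  from ptime_snd[OF ptime_snd[OF this]] show ?thesis by (simp add: funpow_g)
qed

lemma ptime_runs:
  assumes "ptime D F"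
  obtains P q where "\<And>x. x \<in> D \<Longrightarrow> \<exists>t. runs P (enc x) (enc (F x)) t \<and> t \<le> poly q (esize x)"
  using assms
proof (rule ptimeE)
  fix P e b
  assume bounded: "poly_bounded D b" and computes: "computes_within P e D F b"
  let ?e = "shift_calls 1 e"
  let ?P = "[?e] @ map (shift_calls 1) P @ []"
  have "poly_bounded D (\<lambda>x. 1 + esize x + b x + 1)" by (intro poly_bounded_intros bounded)
  then obtain q where q: "\<And>x. x \<in> D \<Longrightarrow> 1 + esize x + b x + 1 \<le> poly q (esize x)"
    by (rule poly_boundedE) blast
  have "\<exists>t. runs ?P (enc x) (enc (F x)) t \<and> t \<le> poly q (esize x)" if x: "x \<in> D" for x
  proof -
    have "evals_within ?P [enc x] ?e (enc (F x)) (b x)"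
      using evals_within_shift_calls[OF computes_withinD[OF computes x], of "[?e]" "[]"] by simp
    then have "evals_within ?P [enc x] (ECall 0 (EVar 0)) (enc (F x)) (1 + esize x + b x + 1)"
      by (rule evals_within_Call[OF evals_within_Var0]) simp_all
    then show ?thesis
      using q[OF x] unfolding runs_def by (elim evals_withinE) (meson add_leE order_trans)
  qed
  then show thesis by (rule that)
qed


section \<open>Polynomial-time list processing\<close>

lemma ptime_enc [ptime_intros]: "ptime D F \<Longrightarrow> ptime D (\<lambda>x. enc (F x))"
  by (erule ptime_enc_cong) simp

lemma ptime_quotient_of [ptime_intros]: "ptime D F \<Longrightarrow> ptime D (\<lambda>x. quotient_of (F x))"
  by (erule ptime_enc_cong) (rule enc_quotient_of)

lemma ptime_Some [ptime_intros]: "ptime D F \<Longrightarrow> ptime D (\<lambda>x. Some (F x))"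
  by (rule ptime_enc_cong[OF ptime_Pair[OF _ ptime_const[of D "0 :: int"], of F]]) simp_all

lemma ptime_Cons [ptime_intros]: "ptime D F \<Longrightarrow> ptime D G \<Longrightarrow> ptime D (\<lambda>x. F x # G x)"
  by (rule ptime_enc_cong[OF ptime_Pair[of D F G]]) simp_all

lemma ptime_of_nat [ptime_intros]: "ptime D F \<Longrightarrow> ptime D (\<lambda>x. int (F x))"
  by (erule ptime_enc_cong) simp

lemma ptime_Suc [ptime_intros]: "ptime D F \<Longrightarrow> ptime D (\<lambda>x. Suc (F x))"
  by (rule ptime_enc_cong[OF ptime_add[OF ptime_of_nat[of D F] ptime_const[of D 1]]]) simp_all

lemma ptime_not [ptime_intros]: "ptime D F \<Longrightarrow> ptime D (\<lambda>x. \<not> F x)"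
  by (rule ptime_cong[OF ptime_if[of D F, OF _ ptime_const[of D False]
    ptime_const[of D True]]]) simp_all

lemma ptime_conj [ptime_intros]: "ptime D F \<Longrightarrow> ptime D G \<Longrightarrow> ptime D (\<lambda>x. F x \<and> G x)"
  by (rule ptime_cong[OF ptime_if[of D F G, OF _ _ ptime_const[of D False]]]) simp_all

lemma ptime_le [ptime_intros]:
  fixes F G :: "'a :: codable \<Rightarrow> int"
  shows "ptime D F \<Longrightarrow> ptime D G \<Longrightarrow> ptime D (\<lambda>x. F x \<le> G x)"
  by (rule ptime_cong[OF ptime_not[OF ptime_less[of D G F]]]) auto

lemma ptime_eq_int [ptime_intros]:
  fixes F G :: "'a :: codable \<Rightarrow> int"
  shows "ptime D F \<Longrightarrow> ptime D G \<Longrightarrow> ptime D (\<lambda>x. F x = G x)"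
  by (rule ptime_cong[OF ptime_conj[OF ptime_le[of D F G] ptime_le[of D G F]]]) auto

lemma ptime_eq_nat [ptime_intros]:
  fixes F G :: "'a :: codable \<Rightarrow> nat"
  shows "ptime D F \<Longrightarrow> ptime D G \<Longrightarrow> ptime D (\<lambda>x. F x = G x)"
  by (rule ptime_cong[OF ptime_eq_int[OF ptime_of_nat[of D F] ptime_of_nat[of D G]]]) auto

lemma ptime_case_prod [ptime_intros]:
  "ptime D (\<lambda>x. G x (fst (F x)) (snd (F x))) \<Longrightarrow> ptime D (\<lambda>x. case F x of (a, b) \<Rightarrow> G x a b)"
  by (simp add: case_prod_beta)

lemma ptime_rev [ptime_intros]:
  assumes L: "ptime D L"
  shows "ptime D (\<lambda>x. rev (L x))"
proof -
  have "ptime D (\<lambda>x. fold Cons (L x) [])"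
  proof (rule ptime_fold[OF L ptime_const])
    show "esize (fold Cons ys []) \<le> esize (L x)" if "L x = ys @ zs" for x ys zs
      using esize_prefix_le[of ys zs] that by (simp add: fold_Cons_rev esize_rev)
  qed (intro ptime_intros ptime_poly_bounded L)+
  then show ?thesis by (simp add: fold_Cons_rev)
qed

lemma ptime_append [ptime_intros]:
  assumes L: "ptime D L" and M: "ptime D M"
  shows "ptime D (\<lambda>x. L x @ M x)"
proof -
  have "ptime D (\<lambda>x. fold Cons (rev (L x)) (M x))"
  proof (rule ptime_fold[OF ptime_rev[OF L] M])
    show "poly_bounded D (\<lambda>x. esize (L x) + esize (M x))"
      by (intro poly_bounded_intros ptime_poly_bounded L M)
    fix x ys zs assume "rev (L x) = ys @ zs"
    then have "esize (rev ys) \<le> esize (L x)"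
      using esize_prefix_le[of ys zs] esize_rev[of "L x"] by (simp add: esize_rev)
    then show "esize (fold Cons ys (M x)) \<le> esize (L x) + esize (M x)"
      using esize_append_le[of "rev ys" "M x"] by (simp add: fold_Cons_rev)
  qed (intro ptime_intros)
  then show ?thesis by (simp add: fold_Cons_rev)
qed

lemma ptime_map [ptime_intros]:
  assumes L: "ptime D L" and G: "ptime (SIGMA x:D. set (L x)) (\<lambda>p. g (fst p) (snd p))"
  shows "ptime D (\<lambda>x. map (g x) (L x))"
proof -
  obtain b where b: "poly_bounded D b" "\<And>x y. x \<in> D \<Longrightarrow> y \<in> set (L x) \<Longrightarrow> esize (g x y) \<le> b x"
    using poly_bounded_over_set[OF ptime_poly_bounded[OF L] ptime_poly_bounded[OF G]] by blast
  have fold_map: "fold (\<lambda>y. (#) (h y)) ys zs = rev (map h ys) @ zs" for h :: "'b \<Rightarrow> 'c" and ys zs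
    by (induction ys arbitrary: zs) auto
  have "ptime D (\<lambda>x. fold (\<lambda>y. (#) (g x y)) (L x) [])"
  proof (rule ptime_fold[OF L ptime_const])
    show "poly_bounded D (\<lambda>x. 1 + esize (L x) * (1 + b x))"
      by (intro poly_bounded_intros ptime_poly_bounded L b)
    show "esize (fold (\<lambda>y. (#) (g x y)) ys []) \<le> 1 + esize (L x) * (1 + b x)"
      if "x \<in> D" "L x = ys @ zs" for x ys zs
      unfolding fold_map append_Nil2
      using that length_le_esize[of "L x"] by (intro esize_list_le) (auto intro: b(2))
    let ?S = "SIGMA x:D. {p. \<exists>ys zs. L x = ys @ fst p # zs \<and> snd p = fold (\<lambda>y. (#) (g x y)) ys []}"
    have "ptime ?S (\<lambda>p. (fst p, fst (snd p)))"
      by (intro ptime_intros)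
    from ptime_comp[OF G this] have "ptime ?S (\<lambda>p. g (fst p) (fst (snd p)))"
      by force
    then show "ptime ?S (\<lambda>p. g (fst p) (fst (snd p)) # snd (snd p))"
      by (intro ptime_Cons ptime_intros)
  qed
  from ptime_rev[OF this] show ?thesis
    by (simp add: fold_map)
qed

lemma esize_concat_le: "esize (concat xss) \<le> esize xss"
  by (induction xss) (auto intro: order_trans[OF esize_append_le] simp: le_SucI)

lemma ptime_concat [ptime_intros]:
  assumes L: "ptime D L"
  shows "ptime D (\<lambda>x. concat (L x))"
proof -
  have fold_append: "fold (\<lambda>y s. s @ y) yss zs = zs @ concat yss" for yss and zs :: "'b list"
    by (induction yss arbitrary: zs) auto
  have "ptime D (\<lambda>x. fold (\<lambda>y s. s @ y) (L x) [])"
  proof (rule ptime_fold[OF L ptime_const])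
    show "esize (fold (\<lambda>y s. s @ y) ys []) \<le> esize (L x)" if "L x = ys @ zs" for x ys zs
      using esize_concat_le[of ys] esize_prefix_le[of ys zs] that by (simp add: fold_append)
  qed (intro ptime_intros ptime_poly_bounded L)+
  then show ?thesis by (simp add: fold_append)
qed

lemma ptime_filter [ptime_intros]:
  assumes L: "ptime D L" and G: "ptime (SIGMA x:D. set (L x)) (\<lambda>p. g (fst p) (snd p))"
  shows "ptime D (\<lambda>x. filter (g x) (L x))"
proof -
  have "ptime D (\<lambda>x. concat (map (\<lambda>y. if g x y then [y] else []) (L x)))"
    by (intro ptime_intros L G)
  moreover have "concat (map (\<lambda>y. if h y then [y] else []) ys) = filter h ys" for h and ys :: "'b list"
    by (induction ys) auto
  ultimately show ?thesis by simp
qed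

lemma ptime_ball [ptime_intros]:
  assumes L: "ptime D L" and G: "ptime (SIGMA x:D. set (L x)) (\<lambda>p. g (fst p) (snd p))"
  shows "ptime D (\<lambda>x. \<forall>y \<in> set (L x). g x y)"
proof -
  have "ptime D (\<lambda>x. \<not> filter (\<lambda>y. \<not> g x y) (L x) \<noteq> [])"
    by (intro ptime_not ptime_neq_Nil ptime_filter L G)
  then show ?thesis by (simp add: filter_empty_conv)
qed

lemma ptime_bex [ptime_intros]:
  assumes L: "ptime D L" and G: "ptime (SIGMA x:D. set (L x)) (\<lambda>p. g (fst p) (snd p))"
  shows "ptime D (\<lambda>x. \<exists>y \<in> set (L x). g x y)"
  by (rule ptime_cong[OF ptime_not[OF ptime_ball[OF L ptime_not[OF G]]]]) auto

lemma esize_nat_le: "n \<le> m \<Longrightarrow> esize n \<le> 1 + m"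
  by (simp add: bitlength_le_nat)

lemma ptime_length [ptime_intros]:
  assumes L: "ptime D L"
  shows "ptime D (\<lambda>x. length (L x))"
proof -
  have fold_Suc: "fold (\<lambda>_. Suc) ys n = n + length ys" for ys :: "'b list" and n
    by (induction ys arbitrary: n) auto
  have "ptime D (\<lambda>x. fold (\<lambda>_. Suc) (L x) 0)"
  proof (rule ptime_fold[OF L ptime_const])
    show "poly_bounded D (\<lambda>x. 1 + esize (L x))"
      by (intro poly_bounded_intros ptime_poly_bounded L)
    show "esize (fold (\<lambda>_. Suc) ys 0) \<le> 1 + esize (L x)" if "L x = ys @ zs" for x ys zs
      unfolding fold_Suc using that length_le_esize[of "L x"] by (intro esize_nat_le) auto
  qed (intro ptime_intros)
  then show ?thesis by (simp add: fold_Suc)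
qed

lemma ptime_upt_length:
  assumes L: "ptime D L"
  shows "ptime D (\<lambda>x. [0..<length (L x)])"
proof -
  have fold_upt: "fold (\<lambda>_ s. length s # s) ys [] = rev [0..<length ys]" for ys :: "'b list"
    by (induction ys rule: rev_induct) auto
  have "ptime D (\<lambda>x. fold (\<lambda>_ s. length s # s) (L x) [])"
  proof (rule ptime_fold[OF L ptime_const])
    show "poly_bounded D (\<lambda>x. 1 + esize (L x) * (1 + (1 + esize (L x))))"
      by (intro poly_bounded_intros ptime_poly_bounded L)
    show "esize (fold (\<lambda>_ s. length s # s) ys []) \<le> 1 + esize (L x) * (1 + (1 + esize (L x)))"
      if "L x = ys @ zs" for x ys zs
      unfolding fold_upt using that length_le_esize[of "L x"]
      by (intro esize_list_le esize_nat_le) auto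
  qed (intro ptime_intros)
  from ptime_rev[OF this] show ?thesis by (simp add: fold_upt)
qed

definition zip_step :: "'a \<Rightarrow> 'b list \<times> ('a \<times> 'b) list \<Rightarrow> 'b list \<times> ('a \<times> 'b) list" where
  "zip_step x s = (case fst s of [] \<Rightarrow> ([], snd s) | y # ys \<Rightarrow> (ys, (x, y) # snd s))"

lemma fold_zip_step: "fold zip_step xs (ys, acc) = (drop (length xs) ys, rev (zip xs ys) @ acc)"
  by (induction xs arbitrary: ys acc) (auto simp: zip_step_def split: list.split)

lemma esize_zip_le: "esize (zip xs ys) \<le> 2 * esize xs + esize ys"
proof (induction xs arbitrary: ys)
  case (Cons x xs)
  show ?case
    by (cases ys) (use Cons.IH[of "tl ys"] in auto)
qed simp

lemma ptime_zip [ptime_intros]: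
  assumes L: "ptime D L" and M: "ptime D M"
  shows "ptime D (\<lambda>x. zip (L x) (M x))"
proof -
  have "ptime D (\<lambda>x. fold zip_step (L x) (M x, []))"
  proof (rule ptime_fold[OF L ptime_Pair[OF M ptime_const]])
    show "poly_bounded D (\<lambda>x. 1 + esize (M x) + (2 * esize (L x) + esize (M x)))"
      by (intro poly_bounded_intros ptime_poly_bounded L M)
    show "esize (fold zip_step ys (M x, [])) \<le> 1 + esize (M x) + (2 * esize (L x) + esize (M x))"
      if "L x = ys @ zs" for x ys zs
      using esize_zip_le[of ys "M x"] esize_prefix_le[of ys zs] esize_drop_le[of "length ys" "M x"] that
      by (simp add: fold_zip_step esize_rev)
  qed (unfold zip_step_def, intro ptime_intros)
  from ptime_rev[OF ptime_snd[OF this]] show ?thesis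
    by (simp add: fold_zip_step)
qed

lemma ptime_enumerate [ptime_intros]:
  assumes L: "ptime D L"
  shows "ptime D (\<lambda>x. List.enumerate 0 (L x))"
  using ptime_zip[OF ptime_upt_length[OF L] L] by (simp add: enumerate_eq_zip)

lemma ptime_list_update [ptime_intros]:
  assumes "ptime D L" "ptime D I" "ptime D V"
  shows "ptime D (\<lambda>x. (L x)[I x := V x])"
proof -
  have "ptime D (\<lambda>x. map (\<lambda>p. if fst p = I x then V x else snd p) (List.enumerate 0 (L x)))"
    by (intro ptime_intros assms assms(2,3)[THEN ptime_comp_fst])
  moreover have "map (\<lambda>p. if fst p = i then v else snd p) (List.enumerate 0 xs) = xs[i := v]"
    for xs :: "'b list" and i v
    by (rule nth_equalityI) (auto simp: nth_enumerate_eq nth_list_update)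
  ultimately show ?thesis by simp
qed

lemma ptime_map_of [ptime_intros]:
  fixes K :: "'a :: codable \<Rightarrow> nat"
  assumes "ptime D L" "ptime D K"
  shows "ptime D (\<lambda>x. map_of (L x) (K x))"
proof -
  have "ptime D (\<lambda>x. case filter (\<lambda>q. fst q = K x) (L x) of [] \<Rightarrow> None | q # _ \<Rightarrow> Some (snd q))"
    by (intro ptime_intros assms assms(2)[THEN ptime_comp_fst])
  moreover have "(case filter (\<lambda>q. fst q = k) ps of [] \<Rightarrow> None | q # _ \<Rightarrow> Some (snd q)) = map_of ps k"
    for ps :: "(nat \<times> 'b) list" and k
    by (induction ps) auto
  ultimately show ?thesis by simp
qed

lemma ptime_eq_int_list [ptime_intros]:
  fixes F G :: "'a :: codable \<Rightarrow> int list"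
  assumes "ptime D F" "ptime D G"
  shows "ptime D (\<lambda>x. F x = G x)"
proof (rule ptime_cong)
  show "ptime D (\<lambda>x. length (F x) = length (G x) \<and> (\<forall>p \<in> set (zip (F x) (G x)). fst p = snd p))"
    by (intro ptime_intros assms)
  show "F x = G x \<longleftrightarrow> length (F x) = length (G x) \<and> (\<forall>p \<in> set (zip (F x) (G x)). fst p = snd p)" for x
    by (auto simp: list_eq_iff_zip_eq)
qed

lemma esize_sum_list_le: "esize (sum_list xs) \<le> esize (xs :: int list)"
proof (induction xs)
  case (Cons a xs)
  then show ?case using bitlength_add[of a "sum_list xs"] by simp
qed simp

lemma esize_prod_list_le: "esize (prod_list xs) \<le> 1 + esize (xs :: int list)"
proof (induction xs)
  case (Cons a xs)
  then show ?case using bitlength_mult[of a "prod_list xs"] by simp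
qed simp

lemma ptime_prod_list [ptime_intros]:
  fixes L :: "'a :: codable \<Rightarrow> int list"
  assumes L: "ptime D L"
  shows "ptime D (\<lambda>x. prod_list (L x))"
proof -
  have fold_times: "fold (\<lambda>y s. y * s) ys a = prod_list ys * a" for ys and a :: int
    by (induction ys arbitrary: a) auto
  have "ptime D (\<lambda>x. fold (\<lambda>y s. y * s) (L x) 1)"
  proof (rule ptime_fold[OF L ptime_const])
    show "poly_bounded D (\<lambda>x. 1 + esize (L x))"
      by (intro poly_bounded_intros ptime_poly_bounded L)
    show "esize (fold (\<lambda>y s. y * s) ys 1) \<le> 1 + esize (L x)" if "L x = ys @ zs" for x ys zs
      using esize_prod_list_le[of ys] esize_prefix_le[of ys zs] that by (simp add: fold_times)
  qed (intro ptime_intros)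
  then show ?thesis by (simp add: fold_times)
qed


section \<open>Dynamic programming over load vectors\<close>

definition nonneg_vec :: "nat \<Rightarrow> int list \<Rightarrow> bool" where
  "nonneg_vec n v \<longleftrightarrow> length v = n \<and> (\<forall>a \<in> set v. 0 \<le> a)"

abbreviation vadd :: "int list \<Rightarrow> int list \<Rightarrow> int list" where
  "vadd \<equiv> map2 (+)"

lemma nonneg_vec_vadd: "nonneg_vec n u \<Longrightarrow> nonneg_vec n v \<Longrightarrow> nonneg_vec n (vadd u v)"
  by (auto simp: nonneg_vec_def elim!: in_set_zipE)

lemma nonneg_vec_nth: "nonneg_vec n v \<Longrightarrow> j < n \<Longrightarrow> 0 \<le> v ! j"
  by (simp add: nonneg_vec_def)

text \<open>A profit, a load vector and the choices that lead to them. Moves have the same shape: the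
  effect of one choice.\<close>

type_synonym 'c state = "int \<times> int list \<times> 'c"

abbreviation (input) state_profit :: "'c state \<Rightarrow> int" where "state_profit s \<equiv> fst s"
abbreviation (input) state_load :: "'c state \<Rightarrow> int list" where "state_load s \<equiv> fst (snd s)"
abbreviation (input) state_choice :: "'c state \<Rightarrow> 'c" where "state_choice s \<equiv> snd (snd s)"

definition dominates :: "'c state \<Rightarrow> 'c state \<Rightarrow> bool" where
  "dominates s' s \<longleftrightarrow> state_load s' = state_load s \<and> state_profit s \<le> state_profit s'"

definition insert_state :: "'c state \<Rightarrow> 'c state list \<Rightarrow> 'c state list" where
  "insert_state s L =
     (if \<exists>s' \<in> set L. dominates s' s then L
      else s # filter (\<lambda>s'. state_load s' \<noteq> state_load s) L)"

lemma dominates_refl: "dominates s s"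
  by (simp add: dominates_def)

lemma dominates_trans: "dominates s1 s2 \<Longrightarrow> dominates s2 s3 \<Longrightarrow> dominates s1 s3"
  by (auto simp: dominates_def)

lemma set_insert_state_subset: "set (insert_state s L) \<subseteq> insert s (set L)"
  by (auto simp: insert_state_def)

lemma insert_state_dominates:
  assumes "s \<in> insert t (set L)"
  shows "\<exists>s' \<in> set (insert_state t L). dominates s' s"
proof (cases "\<exists>s' \<in> set L. dominates s' t")
  case True
  then have "insert_state t L = L" by (simp add: insert_state_def)
  with True assms show ?thesis by (metis dominates_refl insert_iff)
next
  case False
  then have eq: "insert_state t L = t # filter (\<lambda>s'. state_load s' \<noteq> state_load t) L"
    by (simp add: insert_state_def)
  show ?thesis
  proof (cases "state_load s = state_load t")
    case True
    then have "dominates t s" using False assms by (force simp: dominates_def)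
    then show ?thesis by (simp add: eq)
  next
    case False
    then have "s \<in> set (insert_state t L)" using assms by (auto simp: eq)
    with dominates_refl show ?thesis by blast
  qed
qed

lemma set_fold_insert_state_subset: "set (fold insert_state xs L) \<subseteq> set xs \<union> set L"
proof (induction xs arbitrary: L)
  case (Cons x xs)
  from Cons.IH[of "insert_state x L"] set_insert_state_subset[of x L] show ?case by auto
qed simp

lemma fold_insert_state_dominates:
  "s \<in> set xs \<union> set L \<Longrightarrow> \<exists>s' \<in> set (fold insert_state xs L). dominates s' s"
proof (induction xs arbitrary: s L)
  case (Cons x xs)
  have "\<exists>s' \<in> set xs \<union> set (insert_state x L). dominates s' s"
  proof (cases "s \<in> set xs")
    case False
    with Cons.prems insert_state_dominates[of s x L] show ?thesis by auto
  qed (blast intro: dominates_refl)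
  then obtain s' where s': "s' \<in> set xs \<union> set (insert_state x L)" "dominates s' s" by blast
  from Cons.IH[OF s'(1)] s'(2) show ?case
    unfolding fold_simps by (blast intro: dominates_trans)
qed (auto intro: dominates_refl)

lemma distinct_loads_fold_insert_state:
  "distinct (map (\<lambda>s. state_load s) L) \<Longrightarrow>
    distinct (map (\<lambda>s. state_load s) (fold insert_state xs L))"
proof (induction xs arbitrary: L)
  case (Cons x xs)
  have "distinct (map (\<lambda>s. state_load s) (insert_state x L))"
    using Cons.prems distinct_map_filter[OF Cons.prems] by (auto simp: insert_state_def)
  from Cons.IH[OF this] show ?case by simp
qed simp

definition add_move :: "'c state \<Rightarrow> 'c list state \<Rightarrow> 'c list state" where
  "add_move m s = (state_profit m + state_profit s, vadd (state_load m) (state_load s),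
     state_choice m # state_choice s)"

definition successors :: "int \<Rightarrow> 'c state list \<Rightarrow> 'c list state list \<Rightarrow> 'c list state list" where
  "successors N ms L =
     filter (\<lambda>s. \<forall>a \<in> set (state_load s). a \<le> N) (concat (map (\<lambda>m. map (add_move m) L) ms))"

definition dp_step :: "int \<Rightarrow> 'c state list \<Rightarrow> 'c list state list \<Rightarrow> 'c list state list" where
  "dp_step N ms L = fold insert_state (successors N ms L) []"

definition dp :: "int \<Rightarrow> int list \<Rightarrow> 'c state list list \<Rightarrow> 'c list state list" where
  "dp N z mss = fold (dp_step N) (rev mss) [(0, z, [])]"

definition total_state :: "int list \<Rightarrow> 'c state list \<Rightarrow> 'c list state" where
  "total_state z \<sigma> = foldr add_move \<sigma> (0, z, [])"

abbreviation selection :: "'c list \<Rightarrow> 'c list list \<Rightarrow> bool" where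
  "selection \<equiv> list_all2 (\<lambda>m ms. m \<in> set ms)"

lemma mem_successors_iff:
  "s \<in> set (successors N ms L) \<longleftrightarrow>
    (\<exists>m \<in> set ms. \<exists>s' \<in> set L. s = add_move m s') \<and> (\<forall>a \<in> set (state_load s). a \<le> N)"
  by (auto simp: successors_def)

lemma dp_Nil: "dp N z [] = [(0, z, [])]"
  and dp_Cons: "dp N z (ms # mss) = dp_step N ms (dp N z mss)"
  by (simp_all add: dp_def)

lemma state_profit_total_state: "state_profit (total_state z \<sigma>) = (\<Sum>m\<leftarrow>\<sigma>. state_profit m)"
  and state_choice_total_state: "state_choice (total_state z \<sigma>) = map (\<lambda>m. state_choice m) \<sigma>"
  by (induction \<sigma>) (simp_all add: total_state_def add_move_def)

lemma nonneg_vec_total_state: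
  assumes "\<forall>m \<in> set \<sigma>. nonneg_vec n (state_load m)" "nonneg_vec n z"
  shows "nonneg_vec n (state_load (total_state z \<sigma>))"
  using assms by (induction \<sigma>) (auto simp: total_state_def add_move_def nonneg_vec_vadd)

lemma nth_load_total_state:
  assumes "\<forall>m \<in> set \<sigma>. length (state_load m) = length z" "j < length z"
  shows "length (state_load (total_state z \<sigma>)) = length z \<and>
    state_load (total_state z \<sigma>) ! j = z ! j + (\<Sum>m\<leftarrow>\<sigma>. state_load m ! j)"
  using assms by (induction \<sigma>) (simp_all add: total_state_def add_move_def)

lemma selection_member: "selection \<sigma> mss \<Longrightarrow> m \<in> set \<sigma> \<Longrightarrow> \<exists>ms \<in> set mss. m \<in> set ms"
  by (induction rule: list_all2_induct) auto

lemma dp_sound: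
  assumes "s \<in> set (dp N z mss)" "\<forall>a \<in> set z. a \<le> N"
  shows "(\<exists>\<sigma>. selection \<sigma> mss \<and> s = total_state z \<sigma>) \<and> (\<forall>a \<in> set (state_load s). a \<le> N)"
  using assms(1)
proof (induction mss arbitrary: s)
  case Nil
  then show ?case using assms(2) by (simp add: dp_Nil total_state_def)
next
  case (Cons ms mss)
  have "s \<in> set (successors N ms (dp N z mss))"
    using Cons.prems set_fold_insert_state_subset unfolding dp_Cons dp_step_def by fastforce
  then obtain m s' where m: "m \<in> set ms" "s' \<in> set (dp N z mss)" "s = add_move m s'"
    and le: "\<forall>a \<in> set (state_load s). a \<le> N"
    unfolding mem_successors_iff by blast
  from Cons.IH[OF m(2)] obtain \<sigma> where "selection \<sigma> mss" "s' = total_state z \<sigma>" by blast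
  with m le show ?case
    by (intro conjI exI[of _ "m # \<sigma>"]) (simp_all add: total_state_def)
qed

lemma vadd_nonneg_le:
  assumes "\<forall>a \<in> set (vadd u v). a \<le> N" "nonneg_vec n u" "length v = n"
  shows "\<forall>a \<in> set v. a \<le> N"
proof
  fix a assume "a \<in> set v"
  then obtain j where j: "j < n" "a = v ! j" using assms(3) by (auto simp: in_set_conv_nth)
  then have "vadd u v ! j \<in> set (vadd u v)"
    using assms by (intro nth_mem) (simp add: nonneg_vec_def)
  then have "u ! j + v ! j \<le> N"
    using assms j by (simp add: nonneg_vec_def del: set_map)
  then show "a \<le> N"
    using nonneg_vec_nth[OF assms(2) j(1)] j(2) by simp
qed

lemma dp_complete:
  assumes "selection \<sigma> mss" "\<forall>a \<in> set (state_load (total_state z \<sigma>)). a \<le> N"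
    and "\<forall>m \<in> set \<sigma>. nonneg_vec n (state_load m)" and z: "nonneg_vec n z"
  shows "\<exists>s \<in> set (dp N z mss). dominates s (total_state z \<sigma>)"
  using assms(1-3)
proof (induction rule: list_all2_induct)
  case Nil
  then show ?case by (simp add: dp_Nil total_state_def dominates_refl)
next
  case (Cons m \<sigma> ms mss)
  have total: "total_state z (m # \<sigma>) = add_move m (total_state z \<sigma>)"
    by (simp add: total_state_def)
  have nonneg: "nonneg_vec n (state_load m)" "\<forall>m \<in> set \<sigma>. nonneg_vec n (state_load m)"
    using Cons.prems(2) by simp_all
  have "length (state_load (total_state z \<sigma>)) = n"
    using nonneg_vec_total_state[OF nonneg(2) z] by (simp add: nonneg_vec_def)
  then have "\<forall>a \<in> set (state_load (total_state z \<sigma>)). a \<le> N"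
    using Cons.prems(1) unfolding total add_move_def fst_conv snd_conv
    by (rule vadd_nonneg_le[OF _ nonneg(1), rotated])
  from Cons.IH[OF this nonneg(2)]
  obtain s where s: "s \<in> set (dp N z mss)" "dominates s (total_state z \<sigma>)" ..
  have dom: "dominates (add_move m s) (total_state z (m # \<sigma>))"
    using s(2) by (simp add: total dominates_def add_move_def)
  then have "\<forall>a \<in> set (state_load (add_move m s)). a \<le> N"
    using Cons.prems(1) by (simp add: dominates_def)
  then have "add_move m s \<in> set (successors N ms (dp N z mss))"
    unfolding mem_successors_iff using s(1) Cons.hyps(1) by blast
  then obtain s' where "s' \<in> set (dp N z (ms # mss))" "dominates s' (add_move m s)"
    unfolding dp_Cons dp_step_def using fold_insert_state_dominates[OF UnI1] by blast
  with dom show ?case by (blast intro: dominates_trans)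
qed

lemma distinct_loads_dp: "distinct (map (\<lambda>s. state_load s) (dp N z mss))"
  by (cases mss) (simp_all add: dp_Nil dp_Cons dp_step_def distinct_loads_fold_insert_state)

lemma length_dp_le:
  assumes moves: "\<forall>ms \<in> set mss. \<forall>m \<in> set ms. nonneg_vec n (state_load m)"
    and z: "nonneg_vec n z" "\<forall>a \<in> set z. a \<le> N"
  shows "length (dp N z mss) \<le> nat (N + 1) ^ n"
proof -
  let ?V = "{v. set v \<subseteq> {0..N} \<and> length v = n}"
  have "state_load s \<in> ?V" if s: "s \<in> set (dp N z mss)" for s
  proof -
    from dp_sound[OF s z(2)] obtain \<sigma> where \<sigma>: "selection \<sigma> mss" "s = total_state z \<sigma>"
      and le: "\<forall>a \<in> set (state_load s). a \<le> N"
      by blast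
    then have "nonneg_vec n (state_load s)"
      using moves selection_member[OF \<sigma>(1)] z(1) by (simp only:) (intro nonneg_vec_total_state, blast)
    with le show ?thesis by (auto simp: nonneg_vec_def)
  qed
  then have "set (map (\<lambda>s. state_load s) (dp N z mss)) \<subseteq> ?V"
    by (simp only: set_map image_subset_iff) blast
  then have "card (set (map (\<lambda>s. state_load s) (dp N z mss))) \<le> card ?V"
    by (intro card_mono finite_lists_length_eq) auto
  also have "card ?V = nat (N + 1) ^ n"
    by (simp add: card_lists_length_eq)
  finally show ?thesis
    using distinct_card[OF distinct_loads_dp[of N z mss]] by simp
qed


section \<open>Discarding items to make room\<close>

lemma ex_subset_sum_between:
  fixes s :: "'i \<Rightarrow> 'a :: linordered_idom"
  assumes "finite T" "\<And>i. i \<in> T \<Longrightarrow> s i \<le> u" "u \<le> sum s T" "0 \<le> u"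
  shows "\<exists>X \<subseteq> T. u \<le> sum s X \<and> sum s X \<le> 2 * u"
  using assms
proof (induction T rule: finite_induct)
  case (insert x T)
  show ?case
  proof (cases "u \<le> sum s T")
    case True
    with insert.IH insert.prems obtain X where "X \<subseteq> T" "u \<le> sum s X" "sum s X \<le> 2 * u" by auto
    then show ?thesis by (intro exI[of _ X]) auto
  next
    case False
    moreover have "s x \<le> u" by (rule insert.prems(1)) simp
    ultimately have "sum s (insert x T) \<le> 2 * u"
      using insert.hyps by simp
    with insert.prems show ?thesis by (intro exI[of _ "insert x T"]) simp
  qed
qed auto

text \<open>A total size of \<open>2 r u\<close> contains \<open>r\<close> disjoint groups of size at least \<open>u\<close>; take the cheapest.\<close>

lemma ex_cheap_heavy_subset:
  fixes s p :: "'i \<Rightarrow> 'a :: linordered_idom"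
  assumes "1 \<le> r" "finite T" "\<And>i. i \<in> T \<Longrightarrow> s i \<le> u" "2 * of_nat r * u \<le> sum s T" "0 \<le> u"
  shows "\<exists>X \<subseteq> T. u \<le> sum s X \<and> of_nat r * sum p X \<le> sum p T"
  using assms
proof (induction r arbitrary: T rule: nat_induct_at_least)
  case base
  then show ?case by (intro exI[of _ T]) auto
next
  case (Suc r)
  have "1 * u \<le> 2 * of_nat (Suc r) * u"
    by (rule mult_right_mono) (use Suc.prems in auto)
  with Suc.prems(3) have "u \<le> sum s T" by simp
  then obtain X where X: "X \<subseteq> T" "u \<le> sum s X" "sum s X \<le> 2 * u"
    using ex_subset_sum_between[of T s u] Suc.prems by blast
  have sum_rest: "sum f (T - X) = sum f T - sum f X" for f :: "'i \<Rightarrow> 'a"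
    using Suc.prems(1) X(1) by (simp add: sum_diff)
  have "2 * of_nat r * u \<le> sum s (T - X)"
    using X(3) Suc.prems(3) unfolding sum_rest by (simp add: algebra_simps)
  then obtain Y where Y: "Y \<subseteq> T - X" "u \<le> sum s Y" "of_nat r * sum p Y \<le> sum p (T - X)"
    using Suc.IH[of "T - X"] Suc.prems by auto
  show ?case
  proof (cases "sum p X \<le> sum p Y")
    case True
    then have "of_nat r * sum p X \<le> of_nat r * sum p Y" by (intro mult_left_mono) auto
    then have "of_nat (Suc r) * sum p X \<le> sum p T"
      using Y(3) unfolding sum_rest by (simp add: algebra_simps)
    with X show ?thesis by blast
  next
    case False
    then have "of_nat (Suc r) * sum p Y \<le> sum p T"
      using Y(3) unfolding sum_rest by (simp add: algebra_simps)
    with Y show ?thesis by blast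
  qed
qed

lemma ex_cheap_removal_leaving_slack:
  fixes s p :: "'i \<Rightarrow> 'a :: linordered_idom"
  assumes r: "1 \<le> r" and fin: "finite T" and s: "\<And>i. i \<in> T \<Longrightarrow> 0 \<le> s i"
    and R: "sum s T \<le> R" and light: "\<And>i. i \<in> T \<Longrightarrow> of_nat r * p i \<le> P" and P: "sum p T \<le> P" "0 \<le> P"
  shows "\<exists>X \<subseteq> T. (2 * of_nat r + 1) * sum s (T - X) \<le> 2 * of_nat r * R \<and> of_nat r * sum p X \<le> P"
proof -
  let ?q = "2 * of_nat r + 1 :: 'a"
  have "0 \<le> R" using R sum_nonneg[of T s] s by force
  have room: "?q * sum s (T - X) \<le> 2 * of_nat r * R" if "X \<subseteq> T" "R \<le> ?q * sum s X" for X
  proof -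
    have "?q * sum s T \<le> ?q * R" using R by (intro mult_left_mono) auto
    then show ?thesis using that fin by (simp add: sum_diff algebra_simps)
  qed
  consider (slack) "?q * sum s T \<le> 2 * of_nat r * R" | (big) i where "i \<in> T" "R \<le> ?q * s i"
    | (groups) "2 * of_nat r * R < ?q * sum s T" "\<And>i. i \<in> T \<Longrightarrow> ?q * s i \<le> R"
    by (meson not_le less_imp_le)
  then show ?thesis
  proof cases
    case slack
    then show ?thesis using P(2) by (intro exI[of _ "{}"]) auto
  next
    case (big i)
    then show ?thesis using room[of "{i}"] light by (intro exI[of _ "{i}"]) auto
  next
    case groups
    then obtain X where "X \<subseteq> T" "R \<le> (\<Sum>i \<in> X. ?q * s i)" "of_nat r * sum p X \<le> sum p T"
      using ex_cheap_heavy_subset[OF r fin, of "\<lambda>i. ?q * s i" R p] \<open>0 \<le> R\<close>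
      by (auto simp: sum_distrib_left[symmetric])
    then show ?thesis
      using room[of X] P by (intro exI[of _ X]) (auto simp: sum_distrib_left[symmetric])
  qed
qed

lemma ex_cheap_removal_leaving_slack_all:
  fixes s :: "nat \<Rightarrow> 'i \<Rightarrow> 'a :: linordered_idom" and p :: "'i \<Rightarrow> 'a"
  assumes r: "1 \<le> r" and fin: "finite T" and s: "\<And>i j. i \<in> T \<Longrightarrow> j < m \<Longrightarrow> 0 \<le> s j i"
    and R: "\<And>j. j < m \<Longrightarrow> sum (s j) T \<le> R j" and p: "\<And>i. i \<in> T \<Longrightarrow> 0 \<le> p i"
    and light: "\<And>i. i \<in> T \<Longrightarrow> of_nat r * p i \<le> P" and P: "sum p T \<le> P" "0 \<le> P"
  shows "\<exists>T' \<subseteq> T. (\<forall>j < m. (2 * of_nat r + 1) * sum (s j) T' \<le> 2 * of_nat r * R j) \<and>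
    of_nat r * sum p T \<le> of_nat r * sum p T' + of_nat m * P"
  using s R
proof (induction m)
  case 0
  show ?case by (intro exI[of _ T]) auto
next
  case (Suc m)
  then obtain U where U: "U \<subseteq> T" "\<forall>j < m. (2 * of_nat r + 1) * sum (s j) U \<le> 2 * of_nat r * R j"
    "of_nat r * sum p T \<le> of_nat r * sum p U + of_nat m * P"
    by auto
  have mono: "sum f A \<le> sum f B" if "A \<subseteq> B" "B \<subseteq> T" "\<And>i. i \<in> T \<Longrightarrow> 0 \<le> f i" for f :: "'i \<Rightarrow> 'a" and A B
    using that fin by (intro sum_mono2) (auto dest: finite_subset)
  have finU: "finite U" using U(1) fin finite_subset by blast
  have "\<exists>X \<subseteq> U. (2 * of_nat r + 1) * sum (s m) (U - X) \<le> 2 * of_nat r * R m \<and> of_nat r * sum p X \<le> P"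
  proof (rule ex_cheap_removal_leaving_slack[OF r finU])
    show "sum (s m) U \<le> R m"
      using mono[OF U(1) order_refl, of "s m"] Suc.prems by force
    show "sum p U \<le> P"
      using mono[OF U(1) order_refl, of p] p P by force
  qed (use Suc.prems U light P in auto)
  then obtain X where X: "X \<subseteq> U" "(2 * of_nat r + 1) * sum (s m) (U - X) \<le> 2 * of_nat r * R m"
    "of_nat r * sum p X \<le> P" by blast
  have "(2 * of_nat r + 1) * sum (s j) (U - X) \<le> 2 * of_nat r * R j" if j: "j < m" for j
  proof -
    have "sum (s j) (U - X) \<le> sum (s j) U"
      using U(1) Suc.prems j by (intro mono) auto
    then have "(2 * of_nat r + 1) * sum (s j) (U - X) \<le> (2 * of_nat r + 1) * sum (s j) U"
      by (intro mult_left_mono) auto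
    with U(2) j show ?thesis by force
  qed
  moreover have "of_nat r * sum p (U - X) = of_nat r * sum p U - of_nat r * sum p X"
    using sum_diff[OF finU X(1), of p] by (simp add: right_diff_distrib)
  then have "of_nat r * sum p T \<le> of_nat r * sum p (U - X) + of_nat (Suc m) * P"
    using U(3) X(3) by (simp add: algebra_simps)
  ultimately show ?case
    using U(1) X(2) by (intro exI[of _ "U - X"]) (auto simp: less_Suc_eq)
qed


lemma card_heavy_le:
  fixes p :: "'i \<Rightarrow> 'a :: linordered_idom"
  assumes "finite S" "\<And>i. i \<in> S \<Longrightarrow> 0 \<le> p i"
  shows "card {i \<in> S. sum p S < of_nat r * p i} \<le> r"
proof (cases "{i \<in> S. sum p S < of_nat r * p i} = {}")
  case False
  let ?G = "{i \<in> S. sum p S < of_nat r * p i}"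
  have "of_nat (card ?G) * sum p S = (\<Sum>i \<in> ?G. sum p S)" by simp
  also have "\<dots> < (\<Sum>i \<in> ?G. of_nat r * p i)"
    using False assms(1) by (intro sum_strict_mono) auto
  also have "\<dots> \<le> of_nat r * sum p S"
    unfolding sum_distrib_left[symmetric] using assms by (intro mult_left_mono sum_mono2) auto
  finally have "of_nat (card ?G) < (of_nat r :: 'a)"
    using sum_nonneg[of S p] assms(2) by (simp add: mult_less_cancel_right)
  then show ?thesis by simp
qed (simp only: card.empty)

text \<open>\<open>G\<close> consists of the items of profit above the \<open>r\<close>-th part of the total.\<close>

lemma ex_heavy_part_and_slack_part:
  fixes s :: "nat \<Rightarrow> 'i \<Rightarrow> 'a :: linordered_idom" and p :: "'i \<Rightarrow> 'a"
  assumes r: "1 \<le> r" and fin: "finite A" and p: "\<And>i. i \<in> A \<Longrightarrow> 0 \<le> p i"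
    and s: "\<And>i j. i \<in> A \<Longrightarrow> j < m \<Longrightarrow> 0 \<le> s j i" and R: "\<And>j. j < m \<Longrightarrow> sum (s j) A \<le> R j"
  obtains G T where "G \<subseteq> A" "T \<subseteq> A - G" "card G \<le> r"
    "\<And>j. j < m \<Longrightarrow> sum (s j) T \<le> R j - sum (s j) G"
    "\<And>j. j < m \<Longrightarrow> (2 * of_nat r + 1) * sum (s j) T \<le> 2 * of_nat r * (R j - sum (s j) G)"
    "(of_nat r - of_nat m) * sum p A \<le> of_nat r * sum p (G \<union> T)"
proof -
  define G where "G = {i \<in> A. sum p A < of_nat r * p i}"
  have G: "G \<subseteq> A" by (auto simp: G_def)
  have room: "sum (s j) (A - G) \<le> R j - sum (s j) G" if "j < m" for j
    using R[OF that] sum.subset_diff[OF G fin, of "s j"] by simp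
  have "\<exists>T \<subseteq> A - G. (\<forall>j < m. (2 * of_nat r + 1) * sum (s j) T \<le> 2 * of_nat r * (R j - sum (s j) G)) \<and>
    of_nat r * sum p (A - G) \<le> of_nat r * sum p T + of_nat m * sum p A"
  proof (rule ex_cheap_removal_leaving_slack_all[OF r])
    show "sum p (A - G) \<le> sum p A" using p fin by (intro sum_mono2) auto
    show "of_nat r * p i \<le> sum p A" if "i \<in> A - G" for i
      using that by (simp add: G_def not_less)
    show "0 \<le> sum p A" using p by (rule sum_nonneg)
  qed (use p s room fin in auto)
  then obtain T where T: "T \<subseteq> A - G"
    and slack: "\<And>j. j < m \<Longrightarrow> (2 * of_nat r + 1) * sum (s j) T \<le> 2 * of_nat r * (R j - sum (s j) G)"
    and cheap: "of_nat r * sum p (A - G) \<le> of_nat r * sum p T + of_nat m * sum p A"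
    by blast
  have "sum (s j) T \<le> R j - sum (s j) G" if "j < m" for j
    using sum_mono2[OF _ T, of "s j"] s room that fin by fastforce
  moreover have "sum p (G \<union> T) = sum p G + sum p T"
    using T G fin by (intro sum.union_disjoint) (auto intro: finite_subset)
  then have "(of_nat r - of_nat m) * sum p A \<le> of_nat r * sum p (G \<union> T)"
    using cheap sum.subset_diff[OF G fin, of p] by (simp add: algebra_simps)
  moreover have "card G \<le> r" unfolding G_def by (rule card_heavy_le[of A p r, OF fin p])
  ultimately show thesis using that[OF G T] slack by simp
qed


section \<open>Rounding sizes up to a grid\<close>

text \<open>Rounds \<open>s\<close> up to a multiple of \<open>R / N\<close>. For \<open>R = 0\<close> only \<open>s = 0\<close> fits, and the quotient is \<open>0\<close> as
  it should be. Sizes above \<open>R\<close> are mapped beyond the grid.\<close>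

definition scale :: "int \<Rightarrow> int \<Rightarrow> int \<Rightarrow> int" where
  "scale N R s = (if R < s then N + 1 else - (- (s * N) div R))"

lemma scale_nonneg:
  assumes "0 \<le> s" "0 \<le> N"
  shows "0 \<le> scale N R s"
proof (cases "R < s")
  case False
  with assms have "- (s * N) div R \<le> 0"
    by (cases "R = 0") (auto intro: div_nonpos_pos_le0)
  with False show ?thesis by (simp add: scale_def)
qed (use assms in \<open>simp add: scale_def\<close>)

lemma times_le_times_scale:
  assumes "0 \<le> s" "0 \<le> R" "scale N R s \<le> N"
  shows "N * s \<le> R * scale N R s"
proof (cases "R = 0")
  case True
  with assms show ?thesis by (auto simp: scale_def split: if_splits)
next
  case False
  have "- (s * N) = R * (- (s * N) div R) + - (s * N) mod R" by simp
  moreover have "0 \<le> - (s * N) mod R" using False assms(2) by simp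
  ultimately have "s * N \<le> R * - (- (s * N) div R)" by linarith
  then show ?thesis using assms(3) by (simp add: scale_def mult.commute split: if_splits)
qed

lemma times_scale_le:
  assumes "0 \<le> s" "s \<le> R"
  shows "R * scale N R s \<le> s * N + R"
proof (cases "R = 0")
  case False
  have "- (s * N) = R * (- (s * N) div R) + - (s * N) mod R" by simp
  moreover have "- (s * N) mod R < R" using False assms by simp
  ultimately have "R * - (- (s * N) div R) \<le> s * N + R" by linarith
  then show ?thesis using assms(2) by (simp add: scale_def)
qed (use assms in auto)

lemma sum_le_if_sum_scale_le:
  assumes "finite A" "\<And>i. i \<in> A \<Longrightarrow> 0 \<le> s i" "0 \<le> R" "A \<noteq> {} \<Longrightarrow> 0 < N"
    and le: "(\<Sum>i \<in> A. scale N R (s i)) \<le> N"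
  shows "sum s A \<le> R"
proof (cases "A = {}")
  case False
  then have N: "0 < N" by (rule assms(4))
  have "N * s i \<le> R * scale N R (s i)" if "i \<in> A" for i
  proof -
    have "scale N R (s i) \<le> (\<Sum>i \<in> A. scale N R (s i))"
      using that assms(1,2) N by (intro member_le_sum scale_nonneg) auto
    with le show ?thesis using that assms by (intro times_le_times_scale) auto
  qed
  then have "N * sum s A \<le> R * (\<Sum>i \<in> A. scale N R (s i))"
    unfolding sum_distrib_left by (rule sum_mono)
  also have "\<dots> \<le> N * R"
    using mult_left_mono[OF le \<open>0 \<le> R\<close>] by (simp add: mult.commute)
  finally show ?thesis using N by simp
qed (use assms in simp)

text \<open>Rounding up costs \<open>R / N\<close> per item, \<open>R / (2 r + 1)\<close> in total.\<close>

lemma sum_scale_le_if_slack: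
  assumes "finite A" "card A \<le> n" "\<And>i. i \<in> A \<Longrightarrow> 0 \<le> s i" "sum s A \<le> R"
    and slack: "(2 * int r + 1) * sum s A \<le> 2 * int r * R"
  defines "N \<equiv> int n * (2 * int r + 1)"
  shows "(\<Sum>i \<in> A. scale N R (s i)) \<le> N"
proof -
  have le: "s i \<le> R" if "i \<in> A" for i
    using member_le_sum[of i A s] that assms(1,3,4) by auto
  have R: "0 \<le> R" using sum_nonneg[of A s] assms(3,4) by force
  show ?thesis
  proof (cases "R = 0")
    case True
    then have "s i = 0" if "i \<in> A" for i
      using le[OF that] assms(3)[OF that] by simp
    then show ?thesis by (simp add: True scale_def N_def)
  next
    case False
    have "R * (\<Sum>i \<in> A. scale N R (s i)) \<le> (\<Sum>i \<in> A. s i * N + R)"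
      unfolding sum_distrib_left using assms(3) le by (intro sum_mono times_scale_le)
    also have "\<dots> = int n * ((2 * int r + 1) * sum s A) + int (card A) * R"
      by (simp add: sum.distrib sum_distrib_right[symmetric] N_def)
    also have "\<dots> \<le> int n * (2 * int r * R) + int n * R"
      using slack assms(2) R by (intro add_mono mult_left_mono mult_right_mono) auto
    also have "\<dots> = R * N" by (simp add: N_def algebra_simps)
    finally show ?thesis using R False by simp
  qed
qed


section \<open>The multiple-choice vector knapsack problem\<close>

text \<open>An alternative is a tag with a load vector, and an item is a profit with its alternatives, of which
  at most one may be chosen.\<close>

type_synonym 't alternative = "'t \<times> int list"
type_synonym 't kitem = "int \<times> 't alternative list"
type_synonym 't choice = "'t alternative option list"

definition chosen :: "'a option list \<Rightarrow> nat set" where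
  "chosen c = {i. i < length c \<and> c ! i \<noteq> None}"

definition load :: "'t choice \<Rightarrow> nat \<Rightarrow> int" where
  "load c j = (\<Sum>i \<in> chosen c. snd (the (c ! i)) ! j)"

definition gain :: "'t kitem list \<Rightarrow> 't choice \<Rightarrow> int" where
  "gain its c = (\<Sum>i \<in> chosen c. fst (its ! i))"

definition admissible :: "'t kitem list \<Rightarrow> 't choice \<Rightarrow> bool" where
  "admissible its c \<longleftrightarrow> length c = length its \<and> (\<forall>i \<in> chosen c. the (c ! i) \<in> set (snd (its ! i)))"

definition fitting :: "'t kitem list \<Rightarrow> int list \<Rightarrow> 't choice \<Rightarrow> bool" where
  "fitting its cap c \<longleftrightarrow> admissible its c \<and> (\<forall>j < length cap. load c j \<le> cap ! j)"

definition wf_items :: "nat \<Rightarrow> 't kitem list \<Rightarrow> bool" where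
  "wf_items n its \<longleftrightarrow> (\<forall>it \<in> set its. 0 \<le> fst it \<and> (\<forall>a \<in> set (snd it). nonneg_vec n (snd a)))"

definition extends :: "'t kitem list \<Rightarrow> 't choice \<Rightarrow> 't choice \<Rightarrow> bool" where
  "extends its g c \<longleftrightarrow> admissible its c \<and> (\<forall>i \<in> chosen g. c ! i = g ! i)"

definition restrict_choice :: "'a option list \<Rightarrow> nat set \<Rightarrow> 'a option list" where
  "restrict_choice c A = map (\<lambda>i. if i \<in> A then c ! i else None) [0..<length c]"

lemma finite_chosen [simp]: "finite (chosen c)"
  by (simp add: chosen_def)

lemma chosen_replicate_None [simp]: "chosen (map (\<lambda>_. None) xs) = {}"
  by (auto simp: chosen_def)

lemma sum_chosen: "(\<Sum>i \<in> chosen c. f i) = (\<Sum>i<length c. if c ! i = None then 0 else f i)"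
  by (rule sum.mono_neutral_cong_left) (auto simp: chosen_def)

lemma load_Nil: "load [] j = 0"
  by (simp add: load_def chosen_def)

lemma load_Cons: "load (x # c) j = (case x of None \<Rightarrow> 0 | Some a \<Rightarrow> snd a ! j) + load c j"
  by (simp add: load_def sum_chosen sum.lessThan_Suc_shift del: sum.lessThan_Suc split: option.split
      cong: if_cong)

lemma admissible_member:
  "admissible its c \<Longrightarrow> i \<in> chosen c \<Longrightarrow> i < length its \<and> the (c ! i) \<in> set (snd (its ! i))"
  by (auto simp: admissible_def chosen_def)

lemma length_restrict_choice [simp]: "length (restrict_choice c A) = length c"
  by (simp add: restrict_choice_def)

lemma nth_restrict_choice [simp]:
  "i < length c \<Longrightarrow> restrict_choice c A ! i = (if i \<in> A then c ! i else None)"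
  by (simp add: restrict_choice_def)

lemma chosen_restrict_choice: "chosen (restrict_choice c A) = chosen c \<inter> A"
  by (auto simp: chosen_def split: if_splits)

lemma nth_chosen_restrict_choice:
  "i \<in> chosen (restrict_choice c A) \<Longrightarrow> restrict_choice c A ! i = c ! i"
  by (auto simp: chosen_def split: if_splits)

lemma admissible_restrict_choice: "admissible its c \<Longrightarrow> admissible its (restrict_choice c A)"
  unfolding admissible_def by (auto simp: nth_chosen_restrict_choice chosen_restrict_choice)

lemma load_restrict_choice:
  "load (restrict_choice c A) j = (\<Sum>i \<in> chosen c \<inter> A. snd (the (c ! i)) ! j)"
  unfolding load_def
  by (rule sum.cong)
    (auto simp: nth_chosen_restrict_choice[unfolded chosen_restrict_choice] chosen_restrict_choice)

lemma extends_restrict_choice: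
  assumes "admissible its c" "A \<subseteq> B"
  shows "extends its (restrict_choice c A) (restrict_choice c B)"
  using assms admissible_restrict_choice[of its c B]
  by (auto simp: extends_def chosen_def split: if_splits)


section \<open>The approximation algorithm for the knapsack problem\<close>

definition zero_vec :: "int list \<Rightarrow> int list" where
  "zero_vec v = map (\<lambda>_. 0) v"

definition vscale :: "int \<Rightarrow> int list \<Rightarrow> int list \<Rightarrow> int list" where
  "vscale N R v = map2 (scale N) R v"

definition grid :: "'a list \<Rightarrow> nat \<Rightarrow> int" where
  "grid its r = int (length its) * (2 * int r + 1)"

definition residual :: "int list \<Rightarrow> 't choice \<Rightarrow> int list" where
  "residual cap c = fold (\<lambda>x R. case x of None \<Rightarrow> R | Some a \<Rightarrow> map2 (-) R (snd a)) c cap"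

primrec guesses :: "'t kitem list \<Rightarrow> nat \<Rightarrow> 't choice list" where
  "guesses its 0 = [map (\<lambda>_. None) its]"
| "guesses its (Suc r) = guesses its r @
     concat (map (\<lambda>g. concat (map (\<lambda>p. map (\<lambda>a. g[fst p := Some a]) (snd (snd p)))
       (List.enumerate 0 its))) (guesses its r))"

abbreviation rounded_load :: "int \<Rightarrow> int \<Rightarrow> 't choice \<Rightarrow> 't choice \<Rightarrow> nat \<Rightarrow> int" where
  "rounded_load N R g c j \<equiv> \<Sum>i \<in> chosen c - chosen g. scale N R (snd (the (c ! i)) ! j)"

definition leaves_slack :: "nat \<Rightarrow> int list \<Rightarrow> 't choice \<Rightarrow> 't choice \<Rightarrow> bool" where
  "leaves_slack r cap g t \<longleftrightarrow> (\<forall>j < length cap. load t j \<le> cap ! j - load g j \<and>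
     (2 * int r + 1) * load t j \<le> 2 * int r * (cap ! j - load g j))"

text \<open>The guess \<open>g\<close> has already been charged to the residual capacity \<open>R\<close>.\<close>

definition rounded_move :: "int \<Rightarrow> int list \<Rightarrow> 't kitem \<Rightarrow> 't alternative option \<Rightarrow> 't alternative option \<Rightarrow>
    't alternative option state" where
  "rounded_move N R it g x =
     (case x of None \<Rightarrow> 0 | Some _ \<Rightarrow> fst it,
      case g of None \<Rightarrow> (case x of None \<Rightarrow> zero_vec R | Some a \<Rightarrow> vscale N R (snd a))
      | Some _ \<Rightarrow> zero_vec R,
      x)"

abbreviation compatible :: "'t kitem \<Rightarrow> 't alternative option \<Rightarrow> 't alternative option \<Rightarrow> bool" where
  "compatible it g x \<equiv> (g = None \<longrightarrow> x \<noteq> None \<longrightarrow> the x \<in> set (snd it)) \<and> (g \<noteq> None \<longrightarrow> x = g)"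

definition moves :: "int \<Rightarrow> int list \<Rightarrow> 't kitem \<Rightarrow> 't alternative option \<Rightarrow>
    't alternative option state list" where
  "moves N R it g =
     map (rounded_move N R it g) (case g of None \<Rightarrow> None # map Some (snd it) | Some _ \<Rightarrow> [g])"

definition candidates :: "nat \<Rightarrow> 't kitem list \<Rightarrow> int list \<Rightarrow> 't choice \<Rightarrow> 't choice state list" where
  "candidates r its cap g = (let R = residual cap g; N = grid its r in
     if \<forall>b \<in> set R. 0 \<le> b then dp N (zero_vec R) (map2 (moves N R) its g) else [])"

definition better :: "'c state \<Rightarrow> 'c state \<Rightarrow> 'c state" where
  "better s t = (if state_profit t < state_profit s then s else t)"

definition solve :: "nat \<Rightarrow> 't kitem list \<Rightarrow> int list \<Rightarrow> 't choice" where
  "solve r its cap = state_choice (fold better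
     (concat (map (candidates r its cap) (guesses its r))) (0, zero_vec cap, map (\<lambda>_. None) its))"

lemma length_zero_vec [simp]: "length (zero_vec v) = length v"
  and nth_zero_vec [simp]: "j < length v \<Longrightarrow> zero_vec v ! j = 0"
  and nonneg_vec_zero_vec: "nonneg_vec n (zero_vec v) \<longleftrightarrow> length v = n"
  and zero_vec_le: "0 \<le> N \<Longrightarrow> \<forall>a \<in> set (zero_vec v). a \<le> N"
  by (auto simp: zero_vec_def nonneg_vec_def)

lemma grid_nonneg: "0 \<le> grid its r"
  by (simp add: grid_def)

lemma fold_better_in: "fold better xs b \<in> insert b (set xs)"
  by (induction xs arbitrary: b) (auto simp: better_def)

lemma fold_better_ge: "s \<in> insert b (set xs) \<Longrightarrow> state_profit s \<le> state_profit (fold better xs b)"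
proof (induction xs arbitrary: b s)
  case (Cons x xs)
  have "state_profit b \<le> state_profit (better x b)" "state_profit x \<le> state_profit (better x b)"
    by (simp_all add: better_def)
  moreover have "state_profit t \<le> state_profit (fold better (x # xs) b)"
    if "t \<in> insert (better x b) (set xs)" for t
    using Cons.IH[OF that] by simp
  ultimately show ?case
    using Cons.prems by (metis (no_types, lifting) insert_iff list.simps(15) order_trans)
qed simp

lemma set_guesses_Suc:
  "c \<in> set (guesses its (Suc r)) \<longleftrightarrow> c \<in> set (guesses its r) \<or>
    (\<exists>g \<in> set (guesses its r). \<exists>i < length its. \<exists>a \<in> set (snd (its ! i)). c = g[i := Some a])"
proof -
  have "set (List.enumerate 0 its) = (\<lambda>i. (i, its ! i)) ` {..<length its}"
    by (auto simp: in_set_enumerate_eq image_iff prod_eq_iff)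
  then show ?thesis
    by (auto simp: image_iff simp del: split_paired_Ex split_paired_All)
qed

lemma guesses_admissible: "g \<in> set (guesses its r) \<Longrightarrow> admissible its g"
proof (induction r arbitrary: g)
  case (Suc r)
  from Suc.prems consider (same) "g \<in> set (guesses its r)"
    | (update) g' i a where "g' \<in> set (guesses its r)" "i < length its"
        "a \<in> set (snd (its ! i))" "g = g'[i := Some a]"
    unfolding set_guesses_Suc by blast
  then show ?case
  proof cases
    case update
    then show ?thesis using Suc.IH[OF update(1)]
      by (auto simp: admissible_def chosen_def nth_list_update split: if_splits)
  qed (rule Suc.IH)
qed (simp add: admissible_def)

lemma guesses_complete:
  "admissible its g \<Longrightarrow> card (chosen g) \<le> r \<Longrightarrow> g \<in> set (guesses its r)"
proof (induction r arbitrary: g)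
  case 0
  then have "chosen g = {}" by simp
  then have "\<forall>i < length g. g ! i = None" by (simp only: chosen_def) blast
  then have "g = map (\<lambda>_. None) its"
    using 0(1) by (intro nth_equalityI) (auto simp: admissible_def)
  then show ?case by simp
next
  case (Suc r)
  show ?case
  proof (cases "chosen g = {}")
    case True
    then have "card (chosen g) \<le> r" by (simp only: card.empty)
    with Suc show ?thesis by simp
  next
    case False
    then obtain i where i: "i \<in> chosen g" by blast
    let ?g = "restrict_choice g (- {i})"
    have "card (chosen ?g) \<le> r"
      using Suc.prems(2) i by (simp add: chosen_restrict_choice Diff_eq[symmetric] card_Diff_singleton)
    then have "?g \<in> set (guesses its r)"
      using Suc.IH Suc.prems(1) admissible_restrict_choice by blast
    moreover have "g = ?g[i := Some (the (g ! i))]"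
      using i by (intro nth_equalityI) (auto simp: chosen_def nth_list_update)
    ultimately show ?thesis
      using admissible_member[OF Suc.prems(1) i] unfolding set_guesses_Suc by blast
  qed
qed

lemma residual_correct:
  assumes "\<forall>a. Some a \<in> set c \<longrightarrow> length (snd a) = length cap"
  shows "length (residual cap c) = length cap \<and>
    (\<forall>j < length cap. residual cap c ! j = cap ! j - load c j)"
  using assms
proof (induction c arbitrary: cap)
  case (Cons x c)
  let ?cap = "case x of None \<Rightarrow> cap | Some a \<Rightarrow> map2 (-) cap (snd a)"
  have "length ?cap = length cap" using Cons.prems by (auto split: option.split)
  moreover have "?cap ! j = cap ! j - (case x of None \<Rightarrow> 0 | Some a \<Rightarrow> snd a ! j)"
    if "j < length cap" for j
    using Cons.prems that by (auto split: option.split)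
  moreover have "residual cap (x # c) = residual ?cap c" by (simp add: residual_def)
  ultimately show ?case
    using Cons.IH[of ?cap] Cons.prems by (simp add: load_Cons)
qed (simp add: residual_def load_Nil)

lemma mem_moves_iff:
  "m \<in> set (moves N R it g) \<longleftrightarrow> (\<exists>x. m = rounded_move N R it g x \<and> compatible it g x)"
proof (cases g)
  case None
  have alternatives: "x \<in> insert None (Some ` set (snd it)) \<longleftrightarrow> (x \<noteq> None \<longrightarrow> the x \<in> set (snd it))"
    for x by (cases x) auto
  have "m \<in> set (moves N R it g) \<longleftrightarrow>
      m \<in> rounded_move N R it g ` insert None (Some ` set (snd it))"
    by (simp add: moves_def None image_image)
  also have "\<dots> \<longleftrightarrow> (\<exists>x. (x \<noteq> None \<longrightarrow> the x \<in> set (snd it)) \<and> m = rounded_move N R it g x)"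
    unfolding image_iff Bex_def alternatives ..
  finally show ?thesis using None by (simp only: simp_thms) (simp only: conj_commute)
qed (simp add: moves_def)

lemma state_choice_rounded_move [simp]: "state_choice (rounded_move N R it g x) = x"
  by (simp add: rounded_move_def)

definition rounded_moves :: "int \<Rightarrow> int list \<Rightarrow> 't kitem list \<Rightarrow> 't choice \<Rightarrow> 't choice \<Rightarrow>
    't alternative option state list" where
  "rounded_moves N R its g c = map (\<lambda>i. rounded_move N R (its ! i) (g ! i) (c ! i)) [0..<length its]"

lemma selection_rounded_moves:
  assumes "admissible its g" "extends its g c"
  shows "selection (rounded_moves N R its g c) (map2 (moves N R) its g)"
proof (rule list_all2_all_nthI)
  have len: "length g = length its" "length c = length its"
    using assms by (simp_all add: extends_def admissible_def)
  then show "length (rounded_moves N R its g c) = length (map2 (moves N R) its g)"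
    by (simp add: rounded_moves_def)
  fix i assume "i < length (rounded_moves N R its g c)"
  then have i: "i < length its" by (simp add: rounded_moves_def)
  have "c ! i \<noteq> None \<longrightarrow> the (c ! i) \<in> set (snd (its ! i))" "g ! i \<noteq> None \<longrightarrow> c ! i = g ! i"
    using assms(2) i len unfolding extends_def admissible_def chosen_def by simp_all
  then have "rounded_move N R (its ! i) (g ! i) (c ! i) \<in> set (moves N R (its ! i) (g ! i))"
    unfolding mem_moves_iff by blast
  with i len show "rounded_moves N R its g c ! i \<in> set (map2 (moves N R) its g ! i)"
    by (simp add: rounded_moves_def)
qed

lemma selection_movesE:
  assumes g: "admissible its g" and sel: "selection \<sigma> (map2 (moves N R) its g)"
  obtains c where "extends its g c" "\<sigma> = rounded_moves N R its g c"
proof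
  have len: "length g = length its" using g by (simp add: admissible_def)
  then have len_\<sigma>: "length \<sigma> = length its" using sel by (auto dest: list_all2_lengthD)
  define c where "c = map (\<lambda>m. state_choice m) \<sigma>"
  have move: "\<sigma> ! i = rounded_move N R (its ! i) (g ! i) (c ! i)" "compatible (its ! i) (g ! i) (c ! i)"
    if i: "i < length its" for i
  proof -
    have "\<sigma> ! i \<in> set (moves N R (its ! i) (g ! i))"
      using list_all2_nthD[OF sel, of i] i len len_\<sigma> by simp
    then obtain x where x: "\<sigma> ! i = rounded_move N R (its ! i) (g ! i) x"
      "compatible (its ! i) (g ! i) x"
      unfolding mem_moves_iff by blast
    moreover have "c ! i = x" using x(1) i len_\<sigma> by (simp add: c_def)
    ultimately show "\<sigma> ! i = rounded_move N R (its ! i) (g ! i) (c ! i)"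
      "compatible (its ! i) (g ! i) (c ! i)"
      by simp_all
  qed
  have "the (c ! i) \<in> set (snd (its ! i))" if i: "i < length its" "c ! i \<noteq> None" for i
  proof (cases "g ! i = None")
    case False
    then have "i \<in> chosen g" using i len by (simp add: chosen_def)
    moreover have "c ! i = g ! i" using move(2)[OF i(1)] False by blast
    ultimately show ?thesis using admissible_member[OF g] by simp
  qed (use move(2)[OF i(1)] i(2) in blast)
  moreover have "c ! i = g ! i" if "i \<in> chosen g" for i
    using move(2)[of i] that len by (simp add: chosen_def del: not_None_eq)
  moreover have "length c = length its" using len_\<sigma> by (simp add: c_def)
  ultimately show "extends its g c"
    unfolding extends_def admissible_def chosen_def[of c] by simp
  show "\<sigma> = rounded_moves N R its g c"
    using move(1) len_\<sigma> by (intro nth_equalityI) (auto simp: rounded_moves_def)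
qed

context
  fixes its :: "'t kitem list" and cap :: "int list"
  assumes wf: "wf_items (length cap) its"
begin

lemma fst_kitem_nonneg: "i < length its \<Longrightarrow> 0 \<le> fst (its ! i)"
  using wf by (simp add: wf_items_def)

lemma nonneg_vec_chosen:
  assumes "admissible its c" "i \<in> chosen c"
  shows "nonneg_vec (length cap) (snd (the (c ! i)))"
  using admissible_member[OF assms] wf nth_mem[of i its] unfolding wf_items_def by blast

lemma
  assumes "admissible its c"
  shows length_residual: "length (residual cap c) = length cap"
    and nth_residual: "j < length cap \<Longrightarrow> residual cap c ! j = cap ! j - load c j"
proof -
  have "length (snd a) = length cap" if "Some a \<in> set c" for a
  proof -
    from that obtain i where "i < length c" "c ! i = Some a" by (auto simp: in_set_conv_nth)
    then show ?thesis
      using nonneg_vec_chosen[OF assms, of i] by (simp add: chosen_def nonneg_vec_def)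
  qed
  with residual_correct[of c cap] show "length (residual cap c) = length cap"
    "j < length cap \<Longrightarrow> residual cap c ! j = cap ! j - load c j" by auto
qed

lemma nonneg_vec_moves:
  assumes len: "length R = length cap" and N: "0 \<le> N"
    and g: "admissible its g" and ms: "ms \<in> set (map2 (moves N R) its g)" and m: "m \<in> set ms"
  shows "nonneg_vec (length cap) (state_load m)"
proof -
  from ms obtain it x where it: "it \<in> set its" "ms = moves N R it x"
    by (auto elim!: in_set_zipE)
  from m it(2) obtain y where y: "m = rounded_move N R it x y"
    "x = None \<longrightarrow> y \<noteq> None \<longrightarrow> the y \<in> set (snd it)"
    by (auto simp: mem_moves_iff)
  have "nonneg_vec (length cap) (vscale N R (snd a))" if "a \<in> set (snd it)" for a
    using wf it(1) that len N unfolding wf_items_def nonneg_vec_def vscale_def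
    by (auto intro!: scale_nonneg elim!: in_set_zipE)
  with y len show ?thesis
    by (auto simp: rounded_move_def nonneg_vec_zero_vec split: option.split)
qed

context
  fixes g :: "'t choice"
  assumes g: "admissible its g"
begin

lemma nth_load_rounded_moves:
  assumes len: "length R = length cap" and c: "extends its g c" and j: "j < length cap"
  shows "state_load (total_state (zero_vec R) (rounded_moves N R its g c)) ! j =
    rounded_load N (R ! j) g c j"
proof -
  have c': "admissible its c" "length c = length its" "length g = length its"
    using c g by (simp_all add: extends_def admissible_def)
  have load: "length (state_load (rounded_move N R (its ! i) (g ! i) (c ! i))) = length R \<and>
      state_load (rounded_move N R (its ! i) (g ! i) (c ! i)) ! j =
        (if i \<in> chosen c - chosen g then scale N (R ! j) (snd (the (c ! i)) ! j) else 0)"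
    if i: "i < length its" for i
    using i j len c' nonneg_vec_chosen[OF c'(1), of i]
    by (auto simp: rounded_move_def vscale_def nonneg_vec_def chosen_def split: option.split)
  have "state_load (total_state (zero_vec R) (rounded_moves N R its g c)) ! j =
      (\<Sum>m\<leftarrow>rounded_moves N R its g c. state_load m ! j)"
    using nth_load_total_state[of "rounded_moves N R its g c" "zero_vec R" j] load j len
    by (auto simp: rounded_moves_def)
  also have "\<dots> =
      (\<Sum>i<length its. if i \<in> chosen c - chosen g then scale N (R ! j) (snd (the (c ! i)) ! j) else 0)"
    using load by (simp add: rounded_moves_def sum_list_sum_nth atLeast0LessThan)
  also have "\<dots> = rounded_load N (R ! j) g c j"
    by (rule sum.mono_neutral_cong_right) (auto simp: c' chosen_def)
  finally show ?thesis .
qed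

lemma profit_rounded_moves:
  assumes "extends its g c"
  shows "state_profit (total_state z (rounded_moves N R its g c)) = gain its c"
proof -
  have "length c = length its" using assms by (simp add: extends_def admissible_def)
  then have "gain its c = (\<Sum>i<length its. if c ! i = None then 0 else fst (its ! i))"
    by (simp add: gain_def sum_chosen)
  also have "\<dots> = (\<Sum>i<length its. state_profit (rounded_move N R (its ! i) (g ! i) (c ! i)))"
    by (rule sum.cong) (auto simp: rounded_move_def split: option.split)
  finally show ?thesis
    by (simp add: state_profit_total_state rounded_moves_def sum_list_sum_nth atLeast0LessThan)
qed

lemma choice_rounded_moves:
  assumes "extends its g c"
  shows "state_choice (total_state z (rounded_moves N R its g c)) = c"
  using assms unfolding state_choice_total_state
  by (intro nth_equalityI) (auto simp: rounded_moves_def extends_def admissible_def)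

lemma load_le_if_rounded_load_le:
  assumes c: "extends its g c" and j: "j < length cap" and g_le: "load g j \<le> cap ! j"
    and le: "rounded_load (grid its r) (cap ! j - load g j) g c j \<le> grid its r"
  shows "load c j \<le> cap ! j"
proof -
  let ?s = "\<lambda>i. snd (the (c ! i)) ! j"
  have adm: "admissible its c" and agree: "\<And>i. i \<in> chosen g \<Longrightarrow> c ! i = g ! i"
    using c by (auto simp: extends_def)
  have sub: "chosen g \<subseteq> chosen c"
    using agree g adm by (auto simp: chosen_def admissible_def)
  have "(\<Sum>i \<in> chosen c - chosen g. ?s i) \<le> cap ! j - load g j"
  proof (rule sum_le_if_sum_scale_le[OF _ _ _ _ le])
    show "0 \<le> ?s i" if "i \<in> chosen c - chosen g" for i
      using nonneg_vec_nth[OF nonneg_vec_chosen[OF adm] j] that by blast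
    show "0 < grid its r" if "chosen c - chosen g \<noteq> {}"
    proof -
      from that obtain i where "i \<in> chosen c" by blast
      then have "0 < length its" using admissible_member[OF adm] by fastforce
      then show ?thesis by (simp add: grid_def)
    qed
  qed (use g_le in simp_all)
  moreover have "load c j = (\<Sum>i \<in> chosen c - chosen g. ?s i) + load g j"
    using sum.subset_diff[OF sub finite_chosen, of ?s] agree by (simp add: load_def)
  ultimately show ?thesis by simp
qed

lemma nonneg_vec_load_rounded_moves:
  assumes "length R = length cap" "0 \<le> N" "extends its g c"
  shows "nonneg_vec (length cap) (state_load (total_state (zero_vec R) (rounded_moves N R its g c)))"
proof (rule nonneg_vec_total_state)
  show "\<forall>m \<in> set (rounded_moves N R its g c). nonneg_vec (length cap) (state_load m)"
    using selection_member[OF selection_rounded_moves[OF g assms(3)]] nonneg_vec_moves[OF assms(1,2) g]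
    by blast
qed (simp add: nonneg_vec_zero_vec assms)

lemma candidates_sound:
  assumes "s \<in> set (candidates r its cap g)"
  shows "fitting its cap (state_choice s) \<and> state_profit s = gain its (state_choice s)"
proof -
  define R where "R = residual cap g"
  let ?N = "grid its r"
  have len: "length R = length cap" unfolding R_def by (rule length_residual[OF g])
  from assms have R: "\<forall>b \<in> set R. 0 \<le> b" and s: "s \<in> set (dp ?N (zero_vec R) (map2 (moves ?N R) its g))"
    by (simp_all add: candidates_def Let_def R_def split: if_splits)
  obtain \<sigma> where \<sigma>: "selection \<sigma> (map2 (moves ?N R) its g)" "s = total_state (zero_vec R) \<sigma>"
    and le: "\<forall>a \<in> set (state_load s). a \<le> ?N"
    using dp_sound[OF s zero_vec_le[OF grid_nonneg]] by blast
  obtain c where c: "extends its g c"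
    and s_eq: "s = total_state (zero_vec R) (rounded_moves ?N R its g c)"
    using selection_movesE[OF g \<sigma>(1)] \<sigma>(2) by metis
  have "load c j \<le> cap ! j" if j: "j < length cap" for j
  proof (rule load_le_if_rounded_load_le[OF c j])
    have R_j: "R ! j = cap ! j - load g j" unfolding R_def by (rule nth_residual[OF g j])
    have "0 \<le> R ! j" using R j len by simp
    then show "load g j \<le> cap ! j" by (simp add: R_j)
    have "length (state_load s) = length cap"
      using nonneg_vec_load_rounded_moves[OF len grid_nonneg[of its r] c]
      by (simp add: s_eq nonneg_vec_def)
    then have "state_load s ! j \<le> ?N" using le j by simp
    then show "rounded_load ?N (cap ! j - load g j) g c j \<le> ?N"
      unfolding s_eq nth_load_rounded_moves[OF len c j] R_j .
  qed
  then have "fitting its cap c" using c by (simp add: fitting_def extends_def)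
  then show ?thesis by (simp add: s_eq choice_rounded_moves[OF c] profit_rounded_moves[OF c])
qed

lemma candidates_complete:
  assumes c: "extends its g c" and R: "\<And>j. j < length cap \<Longrightarrow> load g j \<le> cap ! j"
    and le: "\<And>j. j < length cap \<Longrightarrow> rounded_load (grid its r) (cap ! j - load g j) g c j \<le> grid its r"
  shows "\<exists>s \<in> set (candidates r its cap g). gain its c \<le> state_profit s"
proof -
  define R where "R = residual cap g"
  let ?N = "grid its r" and ?\<sigma> = "rounded_moves (grid its r) R its g c"
  have len: "length R = length cap" unfolding R_def by (rule length_residual[OF g])
  note sel = selection_rounded_moves[OF g c, of ?N R]
  have nonneg: "\<forall>m \<in> set ?\<sigma>. nonneg_vec (length cap) (state_load m)"
    using selection_member[OF sel] nonneg_vec_moves[OF len grid_nonneg g] by blast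
  have z: "nonneg_vec (length cap) (zero_vec R)" by (simp add: nonneg_vec_zero_vec len)
  have "\<forall>a \<in> set (state_load (total_state (zero_vec R) ?\<sigma>)). a \<le> ?N"
  proof
    fix a assume "a \<in> set (state_load (total_state (zero_vec R) ?\<sigma>))"
    then obtain j where j: "j < length cap" "a = state_load (total_state (zero_vec R) ?\<sigma>) ! j"
      using nonneg_vec_load_rounded_moves[OF len grid_nonneg[of its r] c]
      by (auto simp: nonneg_vec_def in_set_conv_nth)
    have "R ! j = cap ! j - load g j" unfolding R_def by (rule nth_residual[OF g j(1)])
    with le[OF j(1)] show "a \<le> ?N" unfolding j(2) nth_load_rounded_moves[OF len c j(1)] by simp
  qed
  from dp_complete[OF sel this nonneg z] obtain s
    where "s \<in> set (dp ?N (zero_vec R) (map2 (moves ?N R) its g))" "gain its c \<le> state_profit s"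
    by (auto simp: dominates_def profit_rounded_moves[OF c])
  moreover have "\<forall>b \<in> set R. 0 \<le> b"
    using R by (auto simp: in_set_conv_nth len R_def nth_residual[OF g] length_residual[OF g])
  ultimately show ?thesis by (auto simp: candidates_def Let_def R_def)
qed

end

lemma fitting_ex_subchoice_with_slack:
  assumes r: "1 \<le> r" and fit: "fitting its cap c"
  obtains G T where "G \<subseteq> chosen c" "T \<subseteq> chosen c - G" "card G \<le> r"
    "leaves_slack r cap (restrict_choice c G) (restrict_choice c T)"
    "(int r - int (length cap)) * gain its c \<le> int r * gain its (restrict_choice c (G \<union> T))"
proof -
  let ?p = "\<lambda>i. fst (its ! i)" and ?s = "\<lambda>j i. snd (the (c ! i)) ! j"
  have adm: "admissible its c" using fit by (simp add: fitting_def)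
  have profit: "0 \<le> ?p i" if "i \<in> chosen c" for i
    using fst_kitem_nonneg admissible_member[OF adm that] by blast
  have size: "0 \<le> ?s j i" if "i \<in> chosen c" "j < length cap" for i j
    using nonneg_vec_nth[OF nonneg_vec_chosen[OF adm]] that by blast
  have total: "sum (?s j) (chosen c) \<le> cap ! j" if "j < length cap" for j
    using fit that by (simp add: fitting_def load_def)
  obtain G T where GT: "G \<subseteq> chosen c" "T \<subseteq> chosen c - G" "card G \<le> r"
    and room: "\<And>j. j < length cap \<Longrightarrow> sum (?s j) T \<le> cap ! j - sum (?s j) G"
    and slack: "\<And>j. j < length cap \<Longrightarrow>
      (2 * int r + 1) * sum (?s j) T \<le> 2 * int r * (cap ! j - sum (?s j) G)"
    and gain: "(int r - int (length cap)) * sum ?p (chosen c) \<le> int r * sum ?p (G \<union> T)"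
    using ex_heavy_part_and_slack_part[of r "chosen c" ?p "length cap" ?s "(!) cap",
        OF r finite_chosen profit size total]
    by blast
  have sub: "G \<union> T \<subseteq> chosen c" "T \<subseteq> chosen c" using GT by blast+
  have "load (restrict_choice c A) j = sum (?s j) A" if "A \<subseteq> chosen c" for A j
    using that by (simp add: load_restrict_choice Int_absorb1)
  note load = this[OF GT(1)] this[OF sub(2)]
  show thesis
    using room slack gain sub(1)
    by (intro that[OF GT])
      (simp_all add: leaves_slack_def load gain_def chosen_restrict_choice Int_absorb1)
qed

lemma candidates_restrict_choice:
  assumes adm: "admissible its c" and G: "G \<subseteq> chosen c" and T: "T \<subseteq> chosen c - G"
    and slack: "leaves_slack r cap (restrict_choice c G) (restrict_choice c T)"
  shows "\<exists>t \<in> set (candidates r its cap (restrict_choice c G)).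
    gain its (restrict_choice c (G \<union> T)) \<le> state_profit t"
proof (rule candidates_complete)
  let ?g = "restrict_choice c G" and ?c = "restrict_choice c (G \<union> T)"
  show "admissible its ?g" by (rule admissible_restrict_choice[OF adm])
  show "extends its ?g ?c" by (rule extends_restrict_choice[OF adm]) simp
  have T': "T \<subseteq> chosen c" using T by blast
  have new: "chosen ?c - chosen ?g = T"
    using G T by (auto simp: chosen_restrict_choice)
  fix j assume j: "j < length cap"
  let ?s = "\<lambda>i. snd (the (c ! i)) ! j"
  have load_T: "load (restrict_choice c T) j = sum ?s T"
    using T' by (simp add: load_restrict_choice Int_absorb1)
  have room: "sum ?s T \<le> cap ! j - load ?g j"
    "(2 * int r + 1) * sum ?s T \<le> 2 * int r * (cap ! j - load ?g j)"
    using slack j unfolding leaves_slack_def load_T[symmetric] by blast+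
  have s: "0 \<le> ?s i" if "i \<in> T" for i
    using nonneg_vec_nth[OF nonneg_vec_chosen[OF adm] j] that T' by blast
  with room(1) show "load ?g j \<le> cap ! j"
    using sum_nonneg[of T ?s] by simp
  have sub: "T \<subseteq> {..<length its}" using T' adm by (auto simp: chosen_def admissible_def)
  have "snd (the (?c ! i)) ! j = ?s i" if "i \<in> T" for i
    using that sub adm by (auto simp: admissible_def)
  then have "(\<Sum>i \<in> T. scale (grid its r) (cap ! j - load ?g j) (snd (the (?c ! i)) ! j)) =
      (\<Sum>i \<in> T. scale (grid its r) (cap ! j - load ?g j) (?s i))"
    by simp
  also have "\<dots> \<le> grid its r"
    unfolding grid_def
  proof (rule sum_scale_le_if_slack)
    show "finite T" using T' finite_subset finite_chosen by blast
    show "card T \<le> length its" using card_mono[OF _ sub] by simp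
  qed (rule s room; assumption)+
  finally show "rounded_load (grid its r) (cap ! j - load ?g j) ?g ?c j \<le> grid its r"
    unfolding new .
qed

context
  assumes cap: "\<forall>b \<in> set cap. 0 \<le> b"
begin

lemma solve_best:
  "fitting its cap (solve r its cap) \<and> (\<forall>g \<in> set (guesses its r). \<forall>s \<in> set (candidates r its cap g).
    state_profit s \<le> gain its (solve r its cap))"
proof -
  let ?xs = "concat (map (candidates r its cap) (guesses its r))"
  let ?b = "(0, zero_vec cap, map (\<lambda>_. None) its) :: 't choice state"
  define s where "s = fold better ?xs ?b"
  have "s \<in> insert ?b (set ?xs)" unfolding s_def by (rule fold_better_in)
  then have "fitting its cap (state_choice s) \<and> state_profit s = gain its (state_choice s)"
  proof
    assume "s = ?b"
    then show ?thesis using cap by (simp add: fitting_def admissible_def load_def gain_def)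
  next
    assume "s \<in> set ?xs"
    then obtain g where "g \<in> set (guesses its r)" "s \<in> set (candidates r its cap g)"
      unfolding set_concat set_map by blast
    then show ?thesis by (intro candidates_sound[of g]) (rule guesses_admissible)
  qed
  moreover have "state_profit t \<le> state_profit s"
    if "g \<in> set (guesses its r)" "t \<in> set (candidates r its cap g)" for g t
    unfolding s_def by (rule fold_better_ge) (use that in \<open>unfold set_concat set_map, blast\<close>)
  moreover have "solve r its cap = state_choice s" by (simp add: solve_def s_def)
  ultimately show ?thesis by metis
qed

lemma solve_fitting: "fitting its cap (solve r its cap)"
  using solve_best by blast

theorem solve_approximates:
  assumes r: "1 \<le> r" and fit: "fitting its cap c"
  shows "(int r - int (length cap)) * gain its c \<le> int r * gain its (solve r its cap)"
proof -
  obtain G T where sub: "G \<subseteq> chosen c" "T \<subseteq> chosen c - G" and few: "card G \<le> r"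
    and slack: "leaves_slack r cap (restrict_choice c G) (restrict_choice c T)"
    and gain: "(int r - int (length cap)) * gain its c \<le> int r * gain its (restrict_choice c (G \<union> T))"
    by (rule fitting_ex_subchoice_with_slack[OF r fit]) blast
  have adm: "admissible its c" using fit by (simp add: fitting_def)
  obtain t where t: "t \<in> set (candidates r its cap (restrict_choice c G))"
    "gain its (restrict_choice c (G \<union> T)) \<le> state_profit t"
    using candidates_restrict_choice[OF adm sub slack] by blast
  have "restrict_choice c G \<in> set (guesses its r)"
    using few sub(1)
    by (intro guesses_complete admissible_restrict_choice[OF adm])
      (simp add: chosen_restrict_choice Int_absorb1)
  with solve_best t have "gain its (restrict_choice c (G \<union> T)) \<le> gain its (solve r its cap)"
    using order_trans by blast
  then have "int r * gain its (restrict_choice c (G \<union> T)) \<le> int r * gain its (solve r its cap)"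
    by (rule mult_left_mono) simp
  with gain show ?thesis by (rule order_trans)
qed

end

end


section \<open>Running time of the knapsack algorithm\<close>

lemma ptime_insert_state [ptime_intros]:
  "ptime D S \<Longrightarrow> ptime D L \<Longrightarrow> ptime D (\<lambda>x. insert_state (S x) (L x))"
  by (rule ptime_comp2[where f = insert_state])
    (unfold insert_state_def dominates_def, intro ptime_intros)

lemma length_fold_insert_state_le: "length (fold insert_state xs L) \<le> length xs + length L"
proof (induction xs arbitrary: L)
  case (Cons x xs)
  have "length (insert_state x L) \<le> Suc (length L)"
    by (simp add: insert_state_def le_SucI)
  with Cons.IH[of "insert_state x L"] show ?case by simp
qed simp

lemma ptime_fold_insert_state [ptime_intros]:
  assumes L: "ptime D L"
  shows "ptime D (\<lambda>x. fold insert_state (L x) [])"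
proof (rule ptime_fold[OF L ptime_const])
  show "poly_bounded D (\<lambda>x. 1 + esize (L x) * (1 + esize (L x)))"
    by (intro poly_bounded_intros ptime_poly_bounded L)
  fix x ys zs assume x: "L x = ys @ zs"
  show "esize (fold insert_state ys []) \<le> 1 + esize (L x) * (1 + esize (L x))"
  proof (rule esize_list_le)
    show "esize s \<le> esize (L x)" if "s \<in> set (fold insert_state ys [])" for s
      using that set_fold_insert_state_subset[of ys "[]"] x by (intro esize_member_le) auto
    show "length (fold insert_state ys []) \<le> esize (L x)"
      using length_fold_insert_state_le[of ys "[]"] length_le_esize[of "L x"] x by simp
  qed
qed (intro ptime_intros)

lemma ptime_dp_step [ptime_intros]:
  "ptime D N \<Longrightarrow> ptime D M \<Longrightarrow> ptime D L \<Longrightarrow> ptime D (\<lambda>x. dp_step (N x) (M x) (L x))"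
  by (rule ptime_comp3[where f = dp_step])
    (unfold dp_step_def successors_def add_move_def, intro ptime_intros)

lemma esize_selection_le: "selection \<sigma> mss \<Longrightarrow> esize \<sigma> \<le> esize mss"
proof (induction rule: list_all2_induct)
  case (Cons m \<sigma> ms mss)
  from esize_member_le[OF Cons.hyps(1)] Cons.IH show ?case by simp
qed simp

definition dp_size_bound :: "nat \<Rightarrow> nat \<Rightarrow> nat \<Rightarrow> nat" where
  "dp_size_bound n N m = 1 + (N + 1) ^ n * (1 + (3 + 2 * m + n * (2 + N)))"

lemma esize_dp_state_le:
  assumes moves: "\<forall>ms \<in> set mss. \<forall>m \<in> set ms. nonneg_vec l (state_load m)"
    and z: "nonneg_vec l z" "\<forall>a \<in> set z. a \<le> N" "l \<le> n" and s: "s \<in> set (dp N z mss)"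
  shows "esize s \<le> 3 + 2 * esize mss + n * (2 + nat N)"
proof -
  from dp_sound[OF s z(2)] obtain \<sigma> where \<sigma>: "selection \<sigma> mss" "s = total_state z \<sigma>"
    and le: "\<forall>a \<in> set (state_load s). a \<le> N"
    by blast
  have "\<forall>m \<in> set \<sigma>. nonneg_vec l (state_load m)"
    using moves selection_member[OF \<sigma>(1)] by blast
  then have load: "nonneg_vec l (state_load s)"
    unfolding \<sigma>(2) by (rule nonneg_vec_total_state[OF _ z(1)])
  have "esize (state_load s) \<le> 1 + n * (1 + (1 + nat N))"
    using load le z(3) by (intro esize_list_le) (auto simp: nonneg_vec_def intro!: bitlength_le_nat)
  moreover have "esize (state_profit s) \<le> esize mss"
  proof -
    have "esize (state_profit s) \<le> esize (map fst \<sigma>)"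
      unfolding \<sigma>(2) state_profit_total_state by (rule esize_sum_list_le)
    also have "\<dots> \<le> esize \<sigma>" by (rule esize_map_le) (simp add: esize_prod)
    also have "\<dots> \<le> esize mss" by (rule esize_selection_le[OF \<sigma>(1)])
    finally show ?thesis .
  qed
  moreover have "esize (state_choice s) \<le> esize mss"
  proof -
    have "esize (state_choice s) \<le> esize \<sigma>"
      unfolding \<sigma>(2) state_choice_total_state by (rule esize_map_le) (simp add: esize_prod)
    also have "\<dots> \<le> esize mss" by (rule esize_selection_le[OF \<sigma>(1)])
    finally show ?thesis .
  qed
  ultimately show ?thesis
    unfolding esize_prod[of s] esize_prod[of "snd s"] by simp
qed

lemma esize_dp_le:
  assumes moves: "\<forall>ms \<in> set mss. \<forall>m \<in> set ms. nonneg_vec l (state_load m)"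
    and z: "nonneg_vec l z" "\<forall>a \<in> set z. a \<le> N" "l \<le> n" and N: "0 \<le> N"
  shows "esize (dp N z mss) \<le> dp_size_bound n (nat N) (esize mss)"
  unfolding dp_size_bound_def
proof (rule esize_list_le[OF esize_dp_state_le[OF moves z]])
  have "length (dp N z mss) \<le> nat (N + 1) ^ l"
    by (rule length_dp_le[OF moves z(1,2)])
  also have "\<dots> \<le> (nat N + 1) ^ n"
    using z(3) N by (simp add: nat_add_distrib power_increasing)
  finally show "length (dp N z mss) \<le> (nat N + 1) ^ n" .
qed

lemma ptime_dp:
  assumes N: "ptime D N" and z: "ptime D z" and mss: "ptime D mss"
    and bounded: "poly_bounded D (\<lambda>x. nat (N x))" and N_nonneg: "\<And>x. x \<in> D \<Longrightarrow> 0 \<le> N x"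
    and moves: "\<And>x ms m. x \<in> D \<Longrightarrow> ms \<in> set (mss x) \<Longrightarrow> m \<in> set ms \<Longrightarrow> nonneg_vec (l x) (state_load m)"
    and z_vec: "\<And>x. x \<in> D \<Longrightarrow> nonneg_vec (l x) (z x) \<and> (\<forall>a \<in> set (z x). a \<le> N x)"
    and dim: "\<And>x. x \<in> D \<Longrightarrow> l x \<le> n"
  shows "ptime D (\<lambda>x. dp (N x) (z x) (mss x))"
  unfolding dp_def
proof (rule ptime_fold)
  show "poly_bounded D (\<lambda>x. dp_size_bound n (nat (N x)) (esize (mss x)))"
    unfolding dp_size_bound_def by (intro poly_bounded_intros ptime_poly_bounded[OF mss] bounded)
  fix x ys zs assume x: "x \<in> D" and ys: "rev (mss x) = ys @ zs"
  then have mss_x: "mss x = rev zs @ rev ys" by (simp add: rev_swap)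
  have "esize (dp (N x) (z x) (rev ys)) \<le> dp_size_bound n (nat (N x)) (esize (rev ys))"
    using moves[OF x] z_vec[OF x] dim[OF x] N_nonneg[OF x]
    by (intro esize_dp_le[where l = "l x"]) (auto simp: mss_x)
  also have "\<dots> \<le> dp_size_bound n (nat (N x)) (esize (mss x))"
    using esize_suffix_le[of "rev ys" "rev zs"] by (simp add: dp_size_bound_def mss_x)
  finally show "esize (fold (dp_step (N x)) ys [(0, z x, [])]) \<le>
      dp_size_bound n (nat (N x)) (esize (mss x))"
    by (simp add: dp_def)
qed (intro ptime_intros N[THEN ptime_comp_fst] z mss)+

lemma esize_map2_le:
  fixes u v :: "int list"
  assumes "\<And>a b. esize (f a b :: int) \<le> esize a + esize b"
  shows "esize (map2 f u v) \<le> esize u + esize v"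
proof (induction u arbitrary: v)
  case (Cons a u)
  show ?case
  proof (cases v)
    case Nil
    then show ?thesis by simp
  next
    case [simp]: (Cons b w)
    show ?thesis using Cons.IH[of w] assms[of a b] by simp
  qed
qed simp

lemma ptime_residual [ptime_intros]:
  "ptime D F \<Longrightarrow> ptime D G \<Longrightarrow> ptime D (\<lambda>x. residual (F x) (G x))"
proof (rule ptime_comp2[where f = residual])
  let ?f = "\<lambda>(g :: 'b alternative option) R. case g of None \<Rightarrow> R | Some a \<Rightarrow> map2 (-) R (snd a)"
  have step: "esize (?f g R) \<le> esize R + esize g" for g R
  proof (cases g)
    case (Some a)
    have "esize (x - y) \<le> esize x + esize y" for x y :: int
      using bitlength_arith_op[of Sub x y] by simp
    then have "esize (map2 (-) R (snd a)) \<le> esize R + esize (snd a)"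
      by (rule esize_map2_le)
    then show ?thesis by (simp add: Some esize_prod[of a])
  qed simp
  have size: "esize (fold ?f ys R) \<le> esize R + esize ys" for ys R
  proof (induction ys arbitrary: R)
    case (Cons g ys)
    from Cons.IH[of "?f g R"] step[where g = g and R = R] show ?case by simp
  qed simp
  show "ptime UNIV (\<lambda>p. residual (fst p) (snd p :: 'b choice))"
    unfolding residual_def
  proof (rule ptime_fold)
    show "poly_bounded UNIV (\<lambda>p :: int list \<times> 'b choice. esize (fst p) + esize (snd p))"
      by (intro poly_bounded_intros ptime_poly_bounded ptime_intros)
    show "esize (fold ?f ys (fst p)) \<le> esize (fst p) + esize (snd p)" if "snd p = ys @ zs" for p ys zs
      using size[of ys "fst p"] esize_prefix_le[of ys zs] that by simp
  qed (intro ptime_intros)+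
qed

lemma ptime_zero_vec [ptime_intros]: "ptime D F \<Longrightarrow> ptime D (\<lambda>x. zero_vec (F x))"
  unfolding zero_vec_def by (intro ptime_intros)

lemma ptime_scale [ptime_intros]:
  "ptime D F \<Longrightarrow> ptime D G \<Longrightarrow> ptime D H \<Longrightarrow> ptime D (\<lambda>x. scale (F x) (G x) (H x))"
proof (rule ptime_comp3[where f = scale])
  have "scale N R s = (if R < s then N + 1 else 0 - ((0 - s * N) div R))" for N R s
    by (simp add: scale_def)
  then show "ptime UNIV (\<lambda>p. scale (fst p) (fst (snd p)) (snd (snd p)))"
    by (simp only:) (intro ptime_intros)
qed

lemma ptime_vscale [ptime_intros]:
  "ptime D F \<Longrightarrow> ptime D G \<Longrightarrow> ptime D H \<Longrightarrow> ptime D (\<lambda>x. vscale (F x) (G x) (H x))"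
  by (rule ptime_comp3[where f = vscale]) (unfold vscale_def, intro ptime_intros)

lemma ptime_moves [ptime_intros]:
  "ptime D F \<Longrightarrow> ptime D G \<Longrightarrow> ptime D H \<Longrightarrow> ptime D K \<Longrightarrow> ptime D (\<lambda>x. moves (F x) (G x) (H x) (K x))"
  by (rule ptime_comp4[where f = moves]) (unfold moves_def rounded_move_def, intro ptime_intros)

lemma ptime_guesses [ptime_intros]:
  assumes F: "ptime D F"
  shows "ptime D (\<lambda>x. guesses (F x) r)"
proof (induction r)
  case (Suc r)
  show ?case unfolding guesses.simps by (intro ptime_intros F[THEN ptime_comp_fst] Suc)
qed (unfold guesses.simps, intro ptime_intros F)

lemma ptime_grid [ptime_intros]: "ptime D F \<Longrightarrow> ptime D (\<lambda>x. grid (F x) r)"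
  unfolding grid_def by (intro ptime_intros)

lemma poly_bounded_grid:
  assumes "ptime D F"
  shows "poly_bounded D (\<lambda>x. nat (grid (F x) r))"
proof (rule poly_bounded_mono)
  show "poly_bounded D (\<lambda>x. esize (F x) * (2 * r + 1))"
    by (intro poly_bounded_intros ptime_poly_bounded assms)
  show "nat (grid (F x) r) \<le> esize (F x) * (2 * r + 1)" for x
    using mult_right_mono[OF length_le_esize[of "F x"], of "2 * r + 1"]
    by (simp add: grid_def nat_mult_distrib nat_add_distrib)
qed

lemma ptime_candidates:
  fixes its :: "'a :: codable \<Rightarrow> 't :: codable kitem list"
  assumes its: "ptime D its" and cap: "ptime D cap" and g: "ptime D g"
    and wf: "\<And>x. x \<in> D \<Longrightarrow> wf_items (length (cap x)) (its x)"
    and dim: "\<And>x. x \<in> D \<Longrightarrow> length (cap x) \<le> n" and adm: "\<And>x. x \<in> D \<Longrightarrow> admissible (its x) (g x)"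
  shows "ptime D (\<lambda>x. candidates r (its x) (cap x) (g x))"
proof -
  let ?R = "\<lambda>x. residual (cap x) (g x)" and ?N = "\<lambda>x. grid (its x) r"
  have len: "length (?R x) = length (cap x)" if "x \<in> D" for x
    by (rule length_residual[OF wf[OF that] adm[OF that]])
  have "ptime D (\<lambda>x. dp (?N x) (zero_vec (?R x)) (map2 (moves (?N x) (?R x)) (its x) (g x)))"
  proof (rule ptime_dp[where l = "\<lambda>x. length (cap x)" and n = n])
    show "ptime D (\<lambda>x. map2 (moves (?N x) (?R x)) (its x) (g x))"
      by (intro ptime_intros its g its[THEN ptime_comp_fst] cap[THEN ptime_comp_fst]
        g[THEN ptime_comp_fst])
    show "nonneg_vec (length (cap x)) (state_load m)"
      if "x \<in> D" "ms \<in> set (map2 (moves (?N x) (?R x)) (its x) (g x))" "m \<in> set ms" for x ms m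
      using that by (intro nonneg_vec_moves[OF wf len grid_nonneg adm])
    show "nonneg_vec (length (cap x)) (zero_vec (?R x)) \<and> (\<forall>a \<in> set (zero_vec (?R x)). a \<le> ?N x)"
      if "x \<in> D" for x
      using len[OF that] zero_vec_le[OF grid_nonneg] by (simp add: nonneg_vec_zero_vec)
  qed (intro ptime_intros poly_bounded_grid grid_nonneg dim its cap g)+
  then show ?thesis
    unfolding candidates_def Let_def by (intro ptime_intros cap g)
qed

lemma ptime_fold_better:
  assumes L: "ptime D L" and I: "ptime D I"
  shows "ptime D (\<lambda>x. fold better (L x) (I x))"
proof (rule ptime_fold[OF L I])
  show "poly_bounded D (\<lambda>x. esize (L x) + esize (I x))"
    by (intro poly_bounded_intros ptime_poly_bounded L I)
  show "esize (fold better ys (I x)) \<le> esize (L x) + esize (I x)" if "L x = ys @ zs" for x ys zs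
  proof -
    have "fold better ys (I x) \<in> insert (I x) (set (L x))"
      using fold_better_in[of ys "I x"] that by auto
    then show ?thesis using esize_member_le[of "fold better ys (I x)" "L x"] by auto
  qed
qed (unfold better_def, intro ptime_intros)

theorem ptime_solve:
  fixes its :: "'a :: codable \<Rightarrow> 't :: codable kitem list"
  assumes its: "ptime D its" and cap: "ptime D cap"
    and wf: "\<And>x. x \<in> D \<Longrightarrow> wf_items (length (cap x)) (its x)"
    and dim: "\<And>x. x \<in> D \<Longrightarrow> length (cap x) \<le> n"
  shows "ptime D (\<lambda>x. solve r (its x) (cap x))"
proof -
  have candidates: "ptime D (\<lambda>x. map (candidates r (its x) (cap x)) (guesses (its x) r))"
    by (intro ptime_map ptime_intros ptime_candidates[where n = n] its cap its[THEN ptime_comp_fst]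
        cap[THEN ptime_comp_fst]) (auto intro: wf dim guesses_admissible)
  show ?thesis
    unfolding solve_def
    by (intro ptime_snd ptime_fold_better ptime_concat candidates ptime_intros cap its)
qed


section \<open>Shelf packing\<close>

text \<open>A key with width and height; for placed boxes, the lower left corner comes before the dimensions.\<close>

type_synonym 'k box = "'k \<times> int \<times> int"
type_synonym 'k placed_box = "'k \<times> int \<times> int \<times> int \<times> int"

definition box_of :: "'k placed_box \<Rightarrow> 'k box" where
  "box_of q = (fst q, snd (snd (snd q)))"

definition positive_boxes :: "'k box list \<Rightarrow> bool" where
  "positive_boxes ls \<longleftrightarrow> (\<forall>(k, w, h) \<in> set ls. 0 < w \<and> 0 < h)"

abbreviation descending :: "'k box list \<Rightarrow> bool" where
  "descending \<equiv> sorted_wrt (\<lambda>a b. snd (snd b) \<le> snd (snd a))"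

abbreviation total_area :: "'k box list \<Rightarrow> int" where
  "total_area ls \<equiv> (\<Sum>(k, w, h)\<leftarrow>ls. w * h)"

text \<open>Next fit decreasing height: \<open>x\<close> is the used width, \<open>y\<close> the bottom and \<open>s\<close> the height of the
  current shelf.\<close>

fun nfdh :: "int \<Rightarrow> int \<Rightarrow> int \<Rightarrow> int \<Rightarrow> 'k box list \<Rightarrow> 'k placed_box list" where
  "nfdh W x y s [] = []"
| "nfdh W x y s ((k, w, h) # ls) =
     (if x + w \<le> W then (k, x, y, w, h) # nfdh W (x + w) y s ls
      else (k, 0, y + s, w, h) # nfdh W w (y + s) h ls)"

abbreviation by_height :: "'k box list \<Rightarrow> 'k box list" where
  "by_height L \<equiv> sort_key (\<lambda>b. - snd (snd b)) L"

text \<open>Starting with a full shelf of height \<open>0\<close> makes the first box open the first shelf.\<close>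

definition shelf_pack :: "int \<Rightarrow> 'k box list \<Rightarrow> 'k placed_box list" where
  "shelf_pack W L = nfdh W W 0 0 (by_height L)"

definition separated :: "'k placed_box \<Rightarrow> 'k placed_box \<Rightarrow> bool" where
  "separated p q \<longleftrightarrow> (case p of (_, x, y, w, h) \<Rightarrow> case q of (_, x', y', w', h') \<Rightarrow>
     x + w \<le> x' \<and> y = y' \<or> y + h \<le> y')"

lemma box_of_simp [simp]: "box_of (k, x, y, w, h) = (k, w, h)"
  by (simp add: box_of_def)

lemma positive_boxes_simps [simp]:
  "positive_boxes []"
  "positive_boxes ((k, w, h) # ls) \<longleftrightarrow> 0 < w \<and> 0 < h \<and> positive_boxes ls"
  by (auto simp: positive_boxes_def)

lemma positive_boxes_sum_nonneg:
  assumes "positive_boxes ls"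
  shows "0 \<le> (\<Sum>(k, w, h)\<leftarrow>ls. w)" "0 \<le> (\<Sum>(k, w, h)\<leftarrow>ls. h)" "0 \<le> total_area ls"
  using assms by (induction ls) (auto intro!: add_nonneg_nonneg)

lemma map_box_of_nfdh: "map box_of (nfdh W x y s ls) = ls"
  by (induction W x y s ls rule: nfdh.induct) simp_all

lemma nfdh_not_before:
  assumes "positive_boxes ls" "0 \<le> s" "(k, x', y', w, h) \<in> set (nfdh W x y s ls)"
  shows "x \<le> x' \<and> y' = y \<or> y + s \<le> y'"
  using assms
proof (induction W x y s ls rule: nfdh.induct[case_names Nil Cons])
  case (Cons W x y s k' w' h' ls)
  then show ?case by (cases "x + w' \<le> W") fastforce+
qed simp

lemma nfdh_separated:
  assumes "positive_boxes ls" "descending ls" "\<forall>(k, w, h) \<in> set ls. h \<le> s" "0 \<le> s"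
  shows "sorted_wrt separated (nfdh W x y s ls)"
  using assms
proof (induction W x y s ls rule: nfdh.induct[case_names Nil Cons])
  case (Cons W x y s k w h ls)
  have pos: "positive_boxes ls" "0 < w" "0 < h" using Cons.prems(1) by auto
  show ?case
  proof (cases "x + w \<le> W")
    case True
    have "separated (k, x, y, w, h) q" if "q \<in> set (nfdh W (x + w) y s ls)" for q
      using nfdh_not_before[OF pos(1), of s] that Cons.prems(3,4)
      by (cases q) (fastforce simp: separated_def)
    with True Cons pos show ?thesis by simp
  next
    case False
    have "separated (k, 0, y + s, w, h) q" if "q \<in> set (nfdh W w (y + s) h ls)" for q
      using nfdh_not_before[OF pos(1), of h] that pos by (cases q) (fastforce simp: separated_def)
    moreover have "\<forall>(k, w, h') \<in> set ls. h' \<le> h" using Cons.prems(2) by auto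
    ultimately show ?thesis using False Cons.IH(2)[OF False] Cons.prems(2) pos by simp
  qed
qed simp

lemma nfdh_within_width:
  assumes "positive_boxes ls" "0 \<le> x" "(k, x', y', w, h) \<in> set (nfdh W x y s ls)"
  shows "0 \<le> x' \<and> (x' + w \<le> W \<or> x' = 0)"
  using assms
proof (induction W x y s ls rule: nfdh.induct[case_names Nil Cons])
  case (Cons W x y s k' w' h' ls)
  then show ?case by (cases "x + w' \<le> W") auto
qed simp

lemma nfdh_width_0:
  assumes "positive_boxes ls" "0 \<le> x" "(k, x', y', w, h) \<in> set (nfdh 0 x y s ls)"
  shows "x' = 0 \<and> y + s \<le> y' \<and> y' + h \<le> y + s + (\<Sum>(k, w, h)\<leftarrow>ls. h)"
  using assms
proof (induction "0 :: int" x y s ls rule: nfdh.induct[case_names Nil Cons])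
  case (Cons x y s k' w' h' ls)
  have pos: "positive_boxes ls" "0 < w'" "0 < h'" using Cons.prems(1) by auto
  have new: "\<not> x + w' \<le> 0" using pos Cons.prems(2) by simp
  from Cons.prems(3) new consider (first) "x' = 0" "y' = y + s" "h = h'"
    | (later) "(k, x', y', w, h) \<in> set (nfdh 0 w' (y + s) h' ls)"
    by auto
  then show ?case
  proof cases
    case first
    then show ?thesis using positive_boxes_sum_nonneg(2)[OF pos(1)] by simp
  next
    case later
    from Cons.hyps(2)[OF new pos(1) _ this] pos show ?thesis by simp
  qed
qed simp

lemma nfdh_single_shelf:
  assumes "positive_boxes ls" "x + (\<Sum>(k, w, h)\<leftarrow>ls. w) \<le> W" "(k, x', y', w, h) \<in> set (nfdh W x y s ls)"
  shows "y' = y"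
  using assms
proof (induction W x y s ls rule: nfdh.induct[case_names Nil Cons])
  case (Cons W x y s k' w' h' ls)
  then have "x + w' \<le> W" using positive_boxes_sum_nonneg(1)[of ls] by simp
  with Cons show ?case by (auto simp: algebra_simps)
qed simp

text \<open>When a shelf is closed, its used width \<open>x\<close> exceeds \<open>(1 - e / f) W\<close>.\<close>

lemma closed_shelf_area:
  fixes e f W x w h \<beta> :: int
  assumes "W < x + w" "f * w \<le> e * W" "0 \<le> h" "h \<le> \<beta>" "0 \<le> x" "0 \<le> f"
  shows "h * ((f - e) * W) \<le> f * (x * \<beta>)"
proof -
  have "(f - e) * W \<le> f * (W - w)" using assms(2) by (simp add: algebra_simps)
  also have "\<dots> \<le> f * x" using assms(1,6) by (intro mult_left_mono) auto
  finally have "h * ((f - e) * W) \<le> h * (f * x)" using assms(3) by (rule mult_left_mono)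
  also have "\<dots> \<le> \<beta> * (f * x)" using assms(4-6) by (intro mult_right_mono) auto
  finally show ?thesis by (simp add: ac_simps)
qed

lemma widen_shelf_area:
  fixes f x h \<beta> :: int
  assumes "h \<le> \<beta>" "0 \<le> x" "0 \<le> f"
  shows "f * (T + (x + w) * h) \<le> f * (w * h + T + x * \<beta>)"
  using assms mult_left_mono[of h \<beta> x] by (intro mult_left_mono) (auto simp: algebra_simps)

text \<open>Everything up to the height of the next shelf is covered in a closed shelf, so the closed shelves
  are charged to the area of the boxes. The current shelf is covered up to height \<open>\<beta>\<close> on the width \<open>x\<close>.\<close>

lemma nfdh_area:
  assumes "positive_boxes ls" "descending ls" "\<forall>(k, w, h) \<in> set ls. h \<le> \<beta> \<and> h \<le> s \<and> f * w \<le> e * W"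
    and "0 \<le> x" "0 \<le> f" "0 \<le> (f - e) * W" and "(k, x', y', w, h) \<in> set (nfdh W x y s ls)"
  shows "(y' + h) * ((f - e) * W) \<le> (y + s) * ((f - e) * W) + f * (total_area ls + x * \<beta>)"
  using assms
proof (induction W x y s ls arbitrary: \<beta> rule: nfdh.induct[case_names Nil Cons])
  case (Cons W x y s k' w' h' ls)
  let ?A = "(f - e) * W"
  have ls: "positive_boxes ls" "descending ls"
    and head: "0 < w'" "0 < h'" "h' \<le> \<beta>" "h' \<le> s" "f * w' \<le> e * W"
    and bounds: "\<forall>(k, w, h) \<in> set ls. h \<le> h' \<and> h \<le> s \<and> f * w \<le> e * W"
    using Cons.prems(1-3) by auto
  then have nonneg: "0 \<le> total_area ls" "0 \<le> w' * h'" "0 \<le> x * \<beta>"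
    using positive_boxes_sum_nonneg(3) Cons.prems(4) by auto
  show ?case
  proof (cases "x + w' \<le> W")
    case True
    with Cons.prems(7) consider (first) "y' = y" "h = h'"
      | (later) "(k, x', y', w, h) \<in> set (nfdh W (x + w') y s ls)"
      by auto
    then show ?thesis
    proof cases
      case first
      have "(y + h') * ?A \<le> (y + s) * ?A"
        using head Cons.prems(6) by (intro mult_right_mono) auto
      moreover have "0 \<le> f * (total_area ((k', w', h') # ls) + x * \<beta>)"
        using Cons.prems(5) nonneg by simp
      ultimately show ?thesis unfolding first by linarith
    next
      case later
      have "(y' + h) * ?A \<le> (y + s) * ?A + f * (total_area ls + (x + w') * h')"
        using Cons.prems head by (intro Cons.IH(1)[OF True ls bounds _ _ _ later]) auto
      then show ?thesis
        using widen_shelf_area[of h' \<beta> x f "total_area ls" w'] head Cons.prems(4,5) by simp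
    qed
  next
    case False
    have shelf: "h' * ?A \<le> f * (x * \<beta>)"
      using False head Cons.prems(4,5) by (intro closed_shelf_area) auto
    from False Cons.prems(7) consider (first) "y' = y + s" "h = h'"
      | (later) "(k, x', y', w, h) \<in> set (nfdh W w' (y + s) h' ls)"
      by auto
    then have "(y' + h) * ?A \<le> (y + s + h') * ?A + f * (total_area ls + w' * h')"
    proof cases
      case later
      then show ?thesis
        using Cons.prems head bounds by (intro Cons.IH(2)[OF False ls]) auto
    qed (use Cons.prems(5) nonneg in simp)
    with shelf show ?thesis by (simp add: algebra_simps)
  qed
qed simp

lemma positive_boxes_sort_key: "positive_boxes (sort_key f L) = positive_boxes L"
  by (simp add: positive_boxes_def)

lemma sum_list_sort_key: "(\<Sum>b\<leftarrow>sort_key f L. g b) = (\<Sum>b\<leftarrow>L. g b :: int)"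
  by (metis mset_map mset_sort sum_mset_sum_list)

lemma set_box_of_shelf_pack: "box_of ` set (shelf_pack W L) = set L"
  unfolding shelf_pack_def by (metis list.set_map map_box_of_nfdh set_sort)

lemma shelf_packE:
  assumes "positive_boxes L" "q \<in> set (shelf_pack W L)"
  obtains k w h ls where "by_height L = (k, w, h) # ls"
    "shelf_pack W L = (k, 0, 0, w, h) # nfdh W w 0 h ls"
    "positive_boxes ((k, w, h) # ls)" "descending ((k, w, h) # ls)" "set L = insert (k, w, h) (set ls)"
proof (cases "by_height L")
  case Nil
  with assms(2) show ?thesis by (simp add: shelf_pack_def)
next
  case (Cons b ls)
  obtain k w h where b: "b = (k, w, h)" by (cases b)
  have pos: "positive_boxes ((k, w, h) # ls)"
    using assms(1) positive_boxes_sort_key[of "\<lambda>b. - snd (snd b)" L] by (simp only: Cons b)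
  moreover have "descending ((k, w, h) # ls)"
    using sorted_sort_key[of "\<lambda>b. - snd (snd b)" L] unfolding Cons b sorted_map by simp
  moreover have "set L = insert (k, w, h) (set ls)"
    using set_sort[of "\<lambda>b. - snd (snd b)" L] by (simp only: Cons b list.set)
  ultimately show ?thesis
    using that[of k w h ls] Cons b by (simp add: shelf_pack_def)
qed

lemma shelf_pack_separated:
  assumes "positive_boxes L"
  shows "sorted_wrt separated (shelf_pack W L)"
proof (cases "shelf_pack W L = []")
  case False
  then have "hd (shelf_pack W L) \<in> set (shelf_pack W L)" by simp
  with assms obtain k w h ls where pack: "shelf_pack W L = (k, 0, 0, w, h) # nfdh W w 0 h ls"
    and pos: "positive_boxes ((k, w, h) # ls)" and desc: "descending ((k, w, h) # ls)"
    by (rule shelf_packE) blast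
  have "separated (k, 0, 0, w, h) q" if "q \<in> set (nfdh W w 0 h ls)" for q
    using nfdh_not_before[of ls h] that pos by (cases q) (fastforce simp: separated_def)
  moreover have "sorted_wrt separated (nfdh W w 0 h ls)"
    using pos desc by (intro nfdh_separated) auto
  ultimately show ?thesis by (simp add: pack)
qed simp

lemma shelf_pack_width_0:
  assumes "positive_boxes L" "(k, x, y, w, h) \<in> set (shelf_pack 0 L)"
  shows "x = 0 \<and> 0 \<le> y \<and> y + h \<le> (\<Sum>(k, w, h)\<leftarrow>L. h)"
  using nfdh_width_0[of "sort_key _ L" 0 k x y w h 0 0] assms
  by (simp add: shelf_pack_def positive_boxes_sort_key sum_list_sort_key)

lemma shelf_pack_within_width:
  assumes "positive_boxes L" "0 \<le> W" "(k, x, y, w, h) \<in> set (shelf_pack W L)"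
  shows "0 \<le> x \<and> 0 \<le> y \<and> (x + w \<le> W \<or> x = 0)"
  using assms nfdh_within_width[of "sort_key _ L" W k x y w h W 0 0]
    nfdh_not_before[of "sort_key _ L" 0 k x y w h W W 0]
  by (auto simp: shelf_pack_def positive_boxes_sort_key)

lemma shelf_pack_single_shelf:
  assumes "positive_boxes L" "(\<Sum>(k, w, h)\<leftarrow>L. w) \<le> W" "(k, x, y, w, h) \<in> set (shelf_pack W L)"
  shows "y = 0"
  using assms(1,3)
proof (rule shelf_packE)
  fix k' w' h' ls
  assume sort: "by_height L = (k', w', h') # ls"
    and pack: "shelf_pack W L = (k', 0, 0, w', h') # nfdh W w' 0 h' ls"
    and pos: "positive_boxes ((k', w', h') # ls)"
  have "w' + (\<Sum>(k, w, h)\<leftarrow>ls. w) \<le> W"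
    using assms(2) sum_list_sort_key[of "\<lambda>(k, w, h). w" "\<lambda>b. - snd (snd b)" L] by (simp add: sort)
  then show ?thesis
    using nfdh_single_shelf[of ls w' W k x y w h 0 h'] assms(3) pos by (auto simp: pack)
qed

text \<open>Here \<open>\<epsilon>' = e / f\<close>, and all bounds are multiplied by powers of \<open>f\<close>.\<close>

lemma shelf_pack_area:
  assumes L: "positive_boxes L" "\<forall>(k, w, h) \<in> set L. f * w \<le> e * W \<and> f * h \<le> e * H"
    and ef: "0 < f" "e < f" and W: "0 < W"
    and area: "f * f * total_area L \<le> (f - e) * (f - e) * W * H"
    and q: "(k, x, y, w, h) \<in> set (shelf_pack W L)"
  shows "y + h \<le> H"
  using L(1) q
proof (rule shelf_packE)
  fix k' w' h' ls
  assume sort: "by_height L = (k', w', h') # ls"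
    and pack: "shelf_pack W L = (k', 0, 0, w', h') # nfdh W w' 0 h' ls"
    and pos: "positive_boxes ((k', w', h') # ls)" and desc: "descending ((k', w', h') # ls)"
    and set_L: "set L = insert (k', w', h') (set ls)"
  let ?A = "(f - e) * W"
  have A: "0 < ?A" using ef W by simp
  have total: "total_area L = w' * h' + total_area ls"
    using sum_list_sort_key[of "\<lambda>(k, w, h). w * h" "\<lambda>b. - snd (snd b)" L] by (simp add: sort)
  have "(y + h) * ?A \<le> h' * ?A + f * total_area L"
  proof (cases "(k, x, y, w, h) \<in> set (nfdh W w' 0 h' ls)")
    case True
    have "(y + h) * ?A \<le> (0 + h') * ?A + f * (total_area ls + w' * h')"
    proof (rule nfdh_area[OF _ _ _ _ _ _ True])
      show "\<forall>(k, w, h) \<in> set ls. h \<le> h' \<and> h \<le> h' \<and> f * w \<le> e * W"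
        using desc L(2) unfolding set_L by auto
    qed (use pos desc ef A in auto)
    then show ?thesis by (simp add: total add.commute)
  next
    case False
    then have "y + h = h'" using q by (simp add: pack)
    then show ?thesis using positive_boxes_sum_nonneg(3)[OF L(1)] ef(1) by simp
  qed
  then have "f * ((y + h) * ?A) \<le> f * (h' * ?A + f * total_area L)"
    using ef(1) by (intro mult_left_mono) auto
  also have "\<dots> \<le> f * (h' * ?A) + (f - e) * H * ?A"
    using area by (simp add: algebra_simps)
  finally have "f * (y + h) * ?A \<le> (f * h' + (f - e) * H) * ?A"
    by (simp only: distrib_right[of "f * h'"] mult.assoc)
  then have "f * (y + h) \<le> f * h' + (f - e) * H" using A by (simp only: mult_le_cancel_right_pos)
  also have "\<dots> \<le> f * H" using L(2) unfolding set_L by (simp add: left_diff_distrib)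
  finally show ?thesis using ef(1) by simp
qed


section \<open>Running time of shelf packing\<close>

lemma insort_key_eq_filter:
  assumes "sorted (map f xs)"
  shows "insort_key f x xs = filter (\<lambda>y. f y < f x) xs @ x # filter (\<lambda>y. \<not> f y < f x) xs"
  using assms
proof (induction xs)
  case (Cons y xs)
  show ?case
  proof (cases "f x \<le> f y")
    case True
    then have "\<forall>z \<in> set (y # xs). \<not> f z < f x" using Cons.prems by auto
    with True show ?thesis by (simp add: filter_False filter_True)
  qed (use Cons in auto)
qed simp

lemma ptime_sort_key:
  fixes f :: "'b :: codable \<Rightarrow> int"
  assumes L: "ptime D L" and f: "ptime UNIV f"
  shows "ptime D (\<lambda>x. sort_key f (L x))"
proof -
  have sort: "sort_key f xs = fold (insort_key f) (rev xs) []" for xs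
    by (simp add: sort_key_def foldr_conv_fold)
  have sort_rev: "fold (insort_key f) ys [] = sort_key f (rev ys)" for ys
    by (simp add: sort)
  have "ptime D (\<lambda>x. fold (insort_key f) (rev (L x)) [])"
  proof (rule ptime_fold[OF ptime_rev[OF L] ptime_const ptime_cong])
    let ?S = "SIGMA x:D. {p. \<exists>ys zs. rev (L x) = ys @ fst p # zs \<and> snd p = fold (insort_key f) ys []}"
    have f': "ptime E (\<lambda>x. f (F x))" if "ptime E F" for E :: "'c :: codable set" and F
      using ptime_comp[OF f that] by simp
    show "ptime ?S (\<lambda>p. filter (\<lambda>y. f y < f (fst (snd p))) (snd (snd p)) @ fst (snd p) #
        filter (\<lambda>y. \<not> f y < f (fst (snd p))) (snd (snd p)))"
      by (intro ptime_append ptime_filter ptime_Cons ptime_not ptime_less f' ptime_fst ptime_snd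
        ptime_ident)
    show "insort_key f (fst (snd p)) (snd (snd p)) = filter (\<lambda>y. f y < f (fst (snd p))) (snd (snd p)) @
        fst (snd p) # filter (\<lambda>y. \<not> f y < f (fst (snd p))) (snd (snd p))" if "p \<in> ?S" for p
      using that sorted_sort_key[of f] by (intro insort_key_eq_filter) (auto simp: sort_rev)
    show "poly_bounded D (\<lambda>x. esize (L x))" by (rule ptime_poly_bounded[OF L])
    show "esize (fold (insort_key f) ys []) \<le> esize (L x)" if "rev (L x) = ys @ zs" for x ys zs
    proof -
      have "esize (fold (insort_key f) ys []) = esize ys"
        unfolding sort_rev by (rule esize_mset_eq) simp
      also have "\<dots> \<le> esize (rev (L x))" unfolding that by (rule esize_prefix_le)
      finally show ?thesis by (simp only: esize_rev)
    qed
  qed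
  then show ?thesis by (simp only: sort)
qed

definition nfdh_step :: "int \<Rightarrow> 'k box \<Rightarrow> int \<times> int \<times> int \<times> 'k placed_box list \<Rightarrow>
    int \<times> int \<times> int \<times> 'k placed_box list" where
  "nfdh_step W b st = (case b of (k, w, h) \<Rightarrow> case st of (x, y, s, acc) \<Rightarrow>
     if x + w \<le> W then (x + w, y, s, (k, x, y, w, h) # acc)
     else (w, y + s, h, (k, 0, y + s, w, h) # acc))"

abbreviation extent :: "'k box list \<Rightarrow> int" where
  "extent ls \<equiv> (\<Sum>(k, w, h)\<leftarrow>ls. \<bar>w\<bar> + \<bar>h\<bar>)"

lemma fold_nfdh_step:
  "snd (snd (snd (fold (nfdh_step W) ls (x, y, s, acc)))) = rev (nfdh W x y s ls) @ acc"
  by (induction W x y s ls arbitrary: acc rule: nfdh.induct) (simp_all add: nfdh_step_def)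

lemma extent_nonneg: "0 \<le> extent ls"
  by (rule sum_list_nonneg) auto

lemma fold_nfdh_step_bound:
  assumes "fold (nfdh_step W) ls (x, y, s, acc) = (x', y', s', acc')"
  shows "\<bar>x'\<bar> + \<bar>y'\<bar> + \<bar>s'\<bar> \<le> \<bar>x\<bar> + \<bar>y\<bar> + \<bar>s\<bar> + extent ls"
  using assms
proof (induction ls arbitrary: x y s acc)
  case (Cons b ls)
  obtain k w h where b: "b = (k, w, h)" by (cases b)
  obtain x1 y1 s1 acc1 where step: "nfdh_step W b (x, y, s, acc) = (x1, y1, s1, acc1)"
    by (metis surj_pair)
  have "\<bar>x1\<bar> + \<bar>y1\<bar> + \<bar>s1\<bar> \<le> \<bar>x\<bar> + \<bar>y\<bar> + \<bar>s\<bar> + (\<bar>w\<bar> + \<bar>h\<bar>)"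
    using step by (auto simp: nfdh_step_def b split: if_splits)
  with Cons.IH[of x1 y1 s1 acc1] Cons.prems step show ?case by (simp add: b)
qed simp

lemma nfdh_bound:
  assumes "(k, x', y', w, h) \<in> set (nfdh W x y s ls)"
  shows "\<bar>x'\<bar> + \<bar>y'\<bar> \<le> \<bar>x\<bar> + \<bar>y\<bar> + \<bar>s\<bar> + extent ls"
  using assms
proof (induction W x y s ls rule: nfdh.induct[case_names Nil Cons])
  case (Cons W x y s k' w' h' ls)
  have extent: "extent ((k', w', h') # ls) = \<bar>w'\<bar> + \<bar>h'\<bar> + extent ls" by simp
  show ?case
  proof (cases "x + w' \<le> W")
    case True
    with Cons.prems consider "x' = x" "y' = y"
      | "(k, x', y', w, h) \<in> set (nfdh W (x + w') y s ls)"
      by auto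
    then show ?thesis
      using Cons.IH(1)[OF True] extent_nonneg[of ls] unfolding extent by cases linarith+
  next
    case False
    with Cons.prems consider "x' = 0" "y' = y + s"
      | "(k, x', y', w, h) \<in> set (nfdh W w' (y + s) h' ls)"
      by auto
    then show ?thesis
      using Cons.IH(2)[OF False] extent_nonneg[of ls] unfolding extent by cases linarith+
  qed
qed simp

lemma bitlength_extent_le:
  "bitlength (\<bar>W\<bar> + extent ls) \<le> bitlength W + esize (ls :: 'k :: codable box list)"
proof (induction ls)
  case (Cons b ls)
  obtain k w h where b: "b = (k, w, h)" by (cases b)
  have "\<bar>W\<bar> + extent (b # ls) = \<bar>w\<bar> + (\<bar>h\<bar> + (\<bar>W\<bar> + extent ls))" by (simp add: b)
  also have "bitlength \<dots> \<le> bitlength w + (bitlength h + bitlength (\<bar>W\<bar> + extent ls)) + 2"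
    using bitlength_arith_op[of Add "\<bar>w\<bar>" "\<bar>h\<bar> + (\<bar>W\<bar> + extent ls)"]
      bitlength_arith_op[of Add "\<bar>h\<bar>" "\<bar>W\<bar> + extent ls"]
    by simp
  also have "\<dots> \<le> bitlength W + esize (b # ls)"
    using Cons.IH by (simp add: b)
  finally show ?case .
qed simp

definition nfdh_size_bound :: "nat \<Rightarrow> nat" where
  "nfdh_size_bound m = 3 + 3 * (1 + m) + (1 + m * (1 + (4 + m + 2 * (1 + m))))"

lemma esize_fold_nfdh_step_le:
  fixes ls :: "'k :: codable box list"
  shows "esize (fold (nfdh_step W) ls (W, 0, 0, [])) \<le> nfdh_size_bound (esize W + esize ls)"
proof -
  let ?m = "esize W + esize ls"
  have coord: "esize a \<le> 1 + ?m" if "\<bar>a\<bar> \<le> \<bar>W\<bar> + extent ls" for a :: int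
    using bitlength_mono[of a "\<bar>W\<bar> + extent ls"] bitlength_extent_le[of W ls] that by simp
  obtain x y s acc where st: "fold (nfdh_step W) ls (W, 0, 0, []) = (x, y, s, acc)"
    by (metis surj_pair)
  have "esize x \<le> 1 + ?m" "esize y \<le> 1 + ?m" "esize s \<le> 1 + ?m"
    using fold_nfdh_step_bound[OF st] by (intro coord, simp)+
  moreover have "esize acc \<le> 1 + ?m * (1 + (4 + ?m + 2 * (1 + ?m)))"
  proof (rule esize_list_le)
    have acc: "acc = rev (nfdh W W 0 0 ls)"
      using fold_nfdh_step[of W ls W 0 0 "[]"] by (simp add: st)
    have "length acc = length ls"
      using arg_cong[OF map_box_of_nfdh[of W W 0 0 ls], of length] by (simp add: acc)
    then show "length acc \<le> ?m" using length_le_esize[of ls] by simp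
    fix q assume "q \<in> set acc"
    then obtain k u v w h where q: "q = (k, u, v, w, h)" "(k, u, v, w, h) \<in> set (nfdh W W 0 0 ls)"
      unfolding acc by (metis set_rev surj_pair)
    have "\<bar>u\<bar> + \<bar>v\<bar> \<le> \<bar>W\<bar> + extent ls" using nfdh_bound[OF q(2)] by simp
    then have "esize u \<le> 1 + ?m" "esize v \<le> 1 + ?m" by (intro coord, simp)+
    moreover have "(k, w, h) \<in> set ls"
      using arg_cong[OF map_box_of_nfdh[of W W 0 0 ls], of set] q(2) by force
    then have "esize (k, w, h) \<le> ?m" using esize_member_le[of "(k, w, h)" ls] by simp
    ultimately show "esize q \<le> 4 + ?m + 2 * (1 + ?m)" by (simp add: q(1))
  qed
  ultimately show ?thesis unfolding st nfdh_size_bound_def by simp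
qed

lemma ptime_nfdh_step [ptime_intros]:
  "ptime D F \<Longrightarrow> ptime D G \<Longrightarrow> ptime D H \<Longrightarrow> ptime D (\<lambda>x. nfdh_step (F x) (G x) (H x))"
  by (rule ptime_comp3[where f = nfdh_step]) (unfold nfdh_step_def, intro ptime_intros)

lemma ptime_shelf_pack [ptime_intros]:
  fixes L :: "'a :: codable \<Rightarrow> 'k :: codable box list"
  assumes W: "ptime D W" and L: "ptime D L"
  shows "ptime D (\<lambda>x. shelf_pack (W x) (L x))"
proof -
  let ?L = "\<lambda>x. by_height (L x)"
  have "ptime UNIV (\<lambda>b :: 'k box. 0 - snd (snd b))" by (intro ptime_intros)
  then have sorted: "ptime D ?L" by (intro ptime_sort_key L) simp
  have "ptime D (\<lambda>x. fold (nfdh_step (W x)) (?L x) (W x, 0, 0, []))"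
  proof (rule ptime_fold[OF sorted])
    show "poly_bounded D (\<lambda>x. nfdh_size_bound (esize (W x) + esize (L x)))"
      unfolding nfdh_size_bound_def by (intro poly_bounded_intros ptime_poly_bounded W L)
    fix x ys zs assume ys: "?L x = ys @ zs"
    have "esize (fold (nfdh_step (W x)) ys (W x, 0, 0, [])) \<le> nfdh_size_bound (esize (W x) + esize ys)"
      by (rule esize_fold_nfdh_step_le)
    also have "esize ys \<le> esize (L x)"
      using esize_prefix_le[of ys zs] esize_mset_eq[of "?L x" "L x"] by (simp add: ys[symmetric])
    then have "nfdh_size_bound (esize (W x) + esize ys) \<le> nfdh_size_bound (esize (W x) + esize (L x))"
      unfolding nfdh_size_bound_def by (intro add_mono mult_le_mono) auto
    finally show "esize (fold (nfdh_step (W x)) ys (W x, 0, 0, [])) \<le>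
        nfdh_size_bound (esize (W x) + esize (L x))" .
  qed (intro ptime_intros W[THEN ptime_comp_fst] W)+
  then have "ptime D (\<lambda>x. rev (snd (snd (snd (fold (nfdh_step (W x)) (?L x) (W x, 0, 0, []))))))"
    by (intro ptime_rev ptime_snd)
  then show ?thesis by (simp add: fold_nfdh_step shelf_pack_def)
qed


section \<open>Container packing as a knapsack problem\<close>

text \<open>All lengths, profits and weights are measured in units of \<open>1 / den I\<close>.\<close>

definition rationals :: "cp_instance \<Rightarrow> rat list" where
  "rationals I = concat (map (\<lambda>a. width a # height a # profit a # weights a) (items I)) @
     concat (map (\<lambda>C. [cwidth C, cheight C]) (containers I))"

definition den :: "cp_instance \<Rightarrow> int" where
  "den I = prod_list (map (\<lambda>r. snd (quotient_of r)) (rationals I))"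

definition scaled :: "cp_instance \<Rightarrow> rat \<Rightarrow> int" where
  "scaled I r = fst (quotient_of r) * (den I div snd (quotient_of r))"

abbreviation eps_num :: "cp_instance \<Rightarrow> int" where "eps_num I \<equiv> fst (quotient_of (eps' I))"
abbreviation eps_den :: "cp_instance \<Rightarrow> int" where "eps_den I \<equiv> snd (quotient_of (eps' I))"

definition oriented :: "cp_instance \<Rightarrow> bool \<Rightarrow> item \<Rightarrow> int \<times> int" where
  "oriented I rot a =
     (if rot then (scaled I (height a), scaled I (width a))
      else (scaled I (width a), scaled I (height a)))"

definition fits :: "cp_instance \<Rightarrow> container \<Rightarrow> int \<times> int \<Rightarrow> bool" where
  "fits I C b \<longleftrightarrow> fst b \<le> scaled I (cwidth C) \<and> snd b \<le> scaled I (cheight C) \<and>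
     (case clabel C of
        Area \<Rightarrow> eps_den I * fst b \<le> eps_num I * scaled I (cwidth C) \<and>
          eps_den I * snd b \<le> eps_num I * scaled I (cheight C)
      | _ \<Rightarrow> True)"

definition usage :: "cp_instance \<Rightarrow> container \<Rightarrow> int \<times> int \<Rightarrow> int" where
  "usage I C b = (case clabel C of
     Large \<Rightarrow> 1 | Wide \<Rightarrow> snd b | Tall \<Rightarrow> fst b | Area \<Rightarrow> eps_den I * eps_den I * (fst b * snd b))"

definition capacity :: "cp_instance \<Rightarrow> container \<Rightarrow> int" where
  "capacity I C = (case clabel C of
     Large \<Rightarrow> 1 | Wide \<Rightarrow> scaled I (cheight C) | Tall \<Rightarrow> scaled I (cwidth C)
   | Area \<Rightarrow> (eps_den I - eps_num I) * (eps_den I - eps_num I) *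
       scaled I (cwidth C) * scaled I (cheight C))"

definition usage_vec :: "cp_instance \<Rightarrow> item \<Rightarrow> nat \<Rightarrow> bool \<Rightarrow> int list" where
  "usage_vec I a j rot =
     map (\<lambda>(j', C). if j' = j then usage I C (oriented I rot a) else 0)
       (List.enumerate 0 (containers I)) @
     map (scaled I) (weights a)"

text \<open>The tag of an alternative consists of the container and the orientation.\<close>

definition placements :: "bool \<Rightarrow> cp_instance \<Rightarrow> item \<Rightarrow> (nat \<times> bool) alternative list" where
  "placements rotation I a = concat (map (\<lambda>(j, C). concat (map (\<lambda>rot.
     if fits I C (oriented I rot a) then [((j, rot), usage_vec I a j rot)] else [])
     (if rotation then [False, True] else [False]))) (List.enumerate 0 (containers I)))"

definition knapsack_items :: "bool \<Rightarrow> cp_instance \<Rightarrow> (nat \<times> bool) kitem list" where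
  "knapsack_items rotation I = map (\<lambda>a. (scaled I (profit a), placements rotation I a)) (items I)"

definition capacities :: "nat \<Rightarrow> cp_instance \<Rightarrow> int list" where
  "capacities d I = map (capacity I) (containers I) @ map (\<lambda>_. den I) [0..<d]"

definition assigned :: "(nat \<times> bool) choice \<Rightarrow> nat \<Rightarrow> nat set" where
  "assigned c j = {i \<in> chosen c. fst (fst (the (c ! i))) = j}"

abbreviation chosen_box :: "cp_instance \<Rightarrow> (nat \<times> bool) choice \<Rightarrow> nat \<Rightarrow> int \<times> int" where
  "chosen_box I c i \<equiv> oriented I (snd (fst (the (c ! i)))) (items I ! i)"

lemma den_pos: "0 < den I"
proof -
  have "0 < prod_list (map (\<lambda>r. snd (quotient_of r)) rs)" for rs
    by (induction rs) (simp_all add: quotient_of_denom_pos')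
  then show ?thesis by (simp add: den_def)
qed

lemma scaled_correct:
  assumes "r \<in> set (rationals I)"
  shows "real_of_int (scaled I r) = of_rat r * real_of_int (den I)"
proof -
  obtain a b where ab: "quotient_of r = (a, b)" by fastforce
  have b: "b > 0" by (rule quotient_of_denom_pos[OF ab])
  have r: "real_of_rat r = real_of_int a / real_of_int b"
    using quotient_of_div[OF ab] by (simp add: of_rat_divide)
  have "snd (quotient_of r) dvd den I"
    unfolding den_def using assms by (intro prod_list_dvd) simp
  then obtain q where "den I = b * q" by (auto simp: ab)
  then show ?thesis using b by (simp add: scaled_def ab r)
qed

lemma
  assumes "r \<in> set (rationals I)"
  shows scaled_pos_iff: "0 < scaled I r \<longleftrightarrow> 0 < r"
    and scaled_nonneg_iff: "0 \<le> scaled I r \<longleftrightarrow> 0 \<le> r"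
proof -
  have "0 < real_of_int (scaled I r) \<longleftrightarrow> 0 < r" "0 \<le> real_of_int (scaled I r) \<longleftrightarrow> 0 \<le> r"
    unfolding scaled_correct[OF assms] using den_pos[of I]
    by (simp_all add: zero_less_mult_iff zero_le_mult_iff)
  then show "0 < scaled I r \<longleftrightarrow> 0 < r" "0 \<le> scaled I r \<longleftrightarrow> 0 \<le> r" by simp_all
qed

lemma rationals_item:
  "a \<in> set (items I) \<Longrightarrow> r \<in> {width a, height a, profit a} \<union> set (weights a) \<Longrightarrow> r \<in> set (rationals I)"
  by (auto simp: rationals_def)

lemma rationals_container:
  "C \<in> set (containers I) \<Longrightarrow> r \<in> {cwidth C, cheight C} \<Longrightarrow> r \<in> set (rationals I)"
  by (auto simp: rationals_def)

lemma oriented_correct: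
  assumes "a \<in> set (items I)"
  shows "real_of_int (fst (oriented I rot a)) =
      of_rat (if rot then height a else width a) * real_of_int (den I)"
    "real_of_int (snd (oriented I rot a)) =
      of_rat (if rot then width a else height a) * real_of_int (den I)"
  using scaled_correct[OF rationals_item[OF assms]] by (simp_all add: oriented_def)

lemma le_iff_of_int_eq_mult:
  fixes x y q :: "'a :: linordered_idom"
  assumes "of_int a = x * q" "of_int b = y * q" "0 < q"
  shows "a \<le> b \<longleftrightarrow> x \<le> y"
  using assms by (metis mult_le_cancel_right_pos of_int_le_iff)

lemma all_less_add_iff: "(\<forall>j < m + n. P j) \<longleftrightarrow> (\<forall>j < m. P j) \<and> (\<forall>t < n. P (m + t :: nat))"
proof (intro iffI conjI allI impI)
  fix j assume all: "(\<forall>j < m. P j) \<and> (\<forall>t < n. P (m + t))" and "j < m + n"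
  then consider "j < m" | t where "t < n" "j = m + t"
    by (metis le_Suc_ex nat_add_left_cancel_less not_less)
  then show "P j" using all by cases auto
qed auto

lemma enumerate_0_eq_map: "List.enumerate 0 xs = map (\<lambda>i. (i, xs ! i)) [0..<length xs]"
  by (rule nth_equalityI) (simp_all add: nth_enumerate_eq)

lemma mem_placements_iff:
  "y \<in> set (placements rotation I a) \<longleftrightarrow> (\<exists>j rot. j < length (containers I) \<and> (rot \<longrightarrow> rotation) \<and>
     fits I (containers I ! j) (oriented I rot a) \<and> y = ((j, rot), usage_vec I a j rot))"
proof -
  have "set (if rotation then [False, True] else [False]) = {rot. rot \<longrightarrow> rotation}" by auto
  then show ?thesis
    unfolding placements_def enumerate_0_eq_map
    by (auto simp: Bex_def simp del: split_paired_Ex split: if_splits)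
qed

lemma nth_usage_vec_container:
  "j' < length (containers I) \<Longrightarrow>
    usage_vec I a j rot ! j' = (if j' = j then usage I (containers I ! j') (oriented I rot a) else 0)"
  by (simp add: usage_vec_def nth_append nth_enumerate_eq)

lemma nth_usage_vec_weight:
  "t < length (weights a) \<Longrightarrow>
    usage_vec I a j rot ! (length (containers I) + t) = scaled I (weights a ! t)"
  by (simp add: usage_vec_def nth_append)

lemma length_knapsack_items [simp]: "length (knapsack_items rotation I) = length (items I)"
  by (simp add: knapsack_items_def)

lemma nth_knapsack_items:
  "i < length (items I) \<Longrightarrow>
    knapsack_items rotation I ! i =
      (scaled I (profit (items I ! i)), placements rotation I (items I ! i))"
  by (simp add: knapsack_items_def)

lemma length_capacities [simp]: "length (capacities d I) = length (containers I) + d"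
  by (simp add: capacities_def)

lemma nth_capacities_container:
  "j < length (containers I) \<Longrightarrow> capacities d I ! j = capacity I (containers I ! j)"
  by (simp add: capacities_def nth_append)

lemma nth_capacities_weight: "t < d \<Longrightarrow> capacities d I ! (length (containers I) + t) = den I"
  by (simp add: capacities_def nth_append)

lemma admissible_knapsack_items_iff:
  "admissible (knapsack_items rotation I) c \<longleftrightarrow> length c = length (items I) \<and>
    (\<forall>i \<in> chosen c. \<exists>j rot. j < length (containers I) \<and> (rot \<longrightarrow> rotation) \<and>
      fits I (containers I ! j) (oriented I rot (items I ! i)) \<and>
      c ! i = Some ((j, rot), usage_vec I (items I ! i) j rot))"
proof -
  have "the (c ! i) \<in> set (snd (knapsack_items rotation I ! i)) \<longleftrightarrow>
      (\<exists>j rot. j < length (containers I) \<and> (rot \<longrightarrow> rotation) \<and>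
        fits I (containers I ! j) (oriented I rot (items I ! i)) \<and>
        c ! i = Some ((j, rot), usage_vec I (items I ! i) j rot))"
    if "length c = length (items I)" "i \<in> chosen c" for i
  proof -
    from that obtain y where "c ! i = Some y" "i < length (items I)" by (auto simp: chosen_def)
    then show ?thesis
      by (simp only: option.sel option.inject nth_knapsack_items snd_conv mem_placements_iff)
  qed
  then show ?thesis unfolding admissible_def length_knapsack_items by blast
qed

context
  fixes I :: cp_instance and c :: "(nat \<times> bool) choice" and rotation :: bool
  assumes adm: "admissible (knapsack_items rotation I) c"
begin

lemma length_admissible: "length c = length (items I)"
  using adm by (simp add: admissible_def)

lemma chosen_less: "i \<in> chosen c \<Longrightarrow> i < length (items I)"
  using adm by (simp add: admissible_def chosen_def)

lemma assignedD:
  assumes "i \<in> assigned c j"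
  obtains rot where "i \<in> chosen c" "i < length (items I)" "j < length (containers I)" "rot \<longrightarrow> rotation"
    "c ! i = Some ((j, rot), usage_vec I (items I ! i) j rot)"
    "fits I (containers I ! j) (chosen_box I c i)"
proof -
  have i: "i \<in> chosen c" and j: "fst (fst (the (c ! i))) = j"
    using assms by (simp_all add: assigned_def)
  obtain j' rot where "j' < length (containers I)" "rot \<longrightarrow> rotation"
    "fits I (containers I ! j') (oriented I rot (items I ! i))"
    "c ! i = Some ((j', rot), usage_vec I (items I ! i) j' rot)"
    using adm i unfolding admissible_knapsack_items_iff by blast
  with that[of rot] i j chosen_less[OF i] show ?thesis by simp
qed

lemma load_container:
  assumes j: "j < length (containers I)"
  shows "load c j = (\<Sum>i \<in> assigned c j. usage I (containers I ! j) (chosen_box I c i))"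
proof -
  have "snd (the (c ! i)) ! j =
      (if i \<in> assigned c j then usage I (containers I ! j) (chosen_box I c i) else 0)"
    if i: "i \<in> chosen c" for i
    using adm i j unfolding admissible_knapsack_items_iff
    by (auto simp: assigned_def nth_usage_vec_container)
  then have "load c j =
      (\<Sum>i \<in> chosen c. if i \<in> assigned c j then usage I (containers I ! j) (chosen_box I c i) else 0)"
    by (simp add: load_def)
  also have "\<dots> = (\<Sum>i \<in> assigned c j. usage I (containers I ! j) (chosen_box I c i))"
    by (rule sum.mono_neutral_cong_right) (auto simp: assigned_def)
  finally show ?thesis .
qed

lemma load_weight:
  assumes "\<And>a. a \<in> set (items I) \<Longrightarrow> length (weights a) = d" "t < d"
  shows "load c (length (containers I) + t) = (\<Sum>i \<in> chosen c. scaled I (weights (items I ! i) ! t))"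
  unfolding load_def
proof (rule sum.cong)
  fix i assume i: "i \<in> chosen c"
  then have "length (weights (items I ! i)) = d" using chosen_less assms(1) by simp
  with adm i assms(2) show "snd (the (c ! i)) ! (length (containers I) + t) =
      scaled I (weights (items I ! i) ! t)"
    unfolding admissible_knapsack_items_iff by (auto simp: nth_usage_vec_weight)
qed simp

lemma gain_knapsack_items:
  "gain (knapsack_items rotation I) c = (\<Sum>i \<in> chosen c. scaled I (profit (items I ! i)))"
  unfolding gain_def using chosen_less by (intro sum.cong) (simp_all add: nth_knapsack_items)

end

context
  fixes I :: cp_instance and d k :: nat
  assumes valid: "valid_instance d k I"
begin

lemma eps'_eq: "real_of_rat (eps' I) = real_of_int (eps_num I) / real_of_int (eps_den I)"
  and eps_num_pos: "0 < eps_num I" and eps_num_less: "eps_num I < eps_den I"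
    and eps_den_pos: "0 < eps_den I"
proof -
  obtain a b where ab: "quotient_of (eps' I) = (a, b)" by fastforce
  have b: "0 < b" by (rule quotient_of_denom_pos[OF ab])
  have e: "eps' I = of_int a / of_int b" by (rule quotient_of_div[OF ab])
  have "0 < eps' I" "eps' I < 1" using valid by (auto simp: valid_instance_def)
  then have "0 < a" "a < b"
    using b by (simp_all add: e zero_less_divide_iff divide_less_eq)
  with b show "0 < eps_num I" "eps_num I < eps_den I" "0 < eps_den I" by (simp_all add: ab)
  have "real_of_rat (eps' I) = real_of_int a / real_of_int b" by (simp add: e of_rat_divide)
  then show "real_of_rat (eps' I) = real_of_int (eps_num I) / real_of_int (eps_den I)"
    by (simp only: ab fst_conv snd_conv)
qed

lemma valid_item:
  assumes "a \<in> set (items I)"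
  shows "0 < width a" "0 < height a" "0 \<le> profit a"
    "length (weights a) = d" "w \<in> set (weights a) \<Longrightarrow> 0 \<le> w"
  using valid assms by (auto simp: valid_instance_def)

lemma valid_container:
  assumes "C \<in> set (containers I)"
  shows "0 < cwidth C" "0 < cheight C"
  using valid assms by (auto simp: valid_instance_def)

lemma oriented_pos:
  assumes "a \<in> set (items I)"
  shows "0 < fst (oriented I rot a)" "0 < snd (oriented I rot a)"
  using scaled_pos_iff[OF rationals_item[OF assms]] valid_item[OF assms] by (simp_all add: oriented_def)

lemma scaled_container_pos:
  assumes "C \<in> set (containers I)"
  shows "0 < scaled I (cwidth C)" "0 < scaled I (cheight C)"
  using scaled_pos_iff[OF rationals_container[OF assms]] valid_container[OF assms] by simp_all

lemma usage_nonneg: "a \<in> set (items I) \<Longrightarrow> 0 \<le> usage I C (oriented I rot a)"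
  using oriented_pos[of a rot] by (auto simp: usage_def split: label.split)

lemma capacities_nonneg: "\<forall>b \<in> set (capacities d I). 0 \<le> b"
proof -
  have "0 \<le> capacity I C" if "C \<in> set (containers I)" for C
    using scaled_container_pos[OF that] eps_num_less
    by (auto simp: capacity_def split: label.split)
  then show ?thesis using den_pos[of I] by (auto simp: capacities_def less_imp_le)
qed

lemma nonneg_vec_usage_vec:
  assumes "a \<in> set (items I)"
  shows "nonneg_vec (length (capacities d I)) (usage_vec I a j rot)"
proof -
  have "0 \<le> scaled I w" if "w \<in> set (weights a)" for w
    using scaled_nonneg_iff[OF rationals_item[OF assms]] valid_item(5)[OF assms that] that by blast
  then show ?thesis
    using usage_nonneg[OF assms] valid_item(4)[OF assms]
    by (auto simp: nonneg_vec_def usage_vec_def)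
qed

lemma wf_knapsack_items: "wf_items (length (capacities d I)) (knapsack_items rotation I)"
proof -
  have "0 \<le> scaled I (profit a)" if "a \<in> set (items I)" for a
    using scaled_nonneg_iff[OF rationals_item[OF that]] valid_item(3)[OF that] by blast
  then show ?thesis
    using nonneg_vec_usage_vec by (auto simp: wf_items_def knapsack_items_def mem_placements_iff)
qed

end


section \<open>Packings and choices with the same assignment\<close>

definition agrees :: "cp_instance \<Rightarrow> solution \<Rightarrow> (nat \<times> bool) choice \<Rightarrow> bool" where
  "agrees I S c \<longleftrightarrow> length S = length (items I) \<and>
     map (map_option (\<lambda>p. (cont p, rotated p))) S = map (map_option fst) c"

abbreviation container_width :: "cp_instance \<Rightarrow> nat \<Rightarrow> real" where
  "container_width I j \<equiv> of_rat (cwidth (containers I ! j))"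

abbreviation container_height :: "cp_instance \<Rightarrow> nat \<Rightarrow> real" where
  "container_height I j \<equiv> of_rat (cheight (containers I ! j))"

definition small_enough :: "cp_instance \<Rightarrow> solution \<Rightarrow> nat \<Rightarrow> nat \<Rightarrow> bool" where
  "small_enough I S j i \<longleftrightarrow> pwidth I S i \<le> container_width I j \<and> pheight I S i \<le> container_height I j \<and>
     (clabel (containers I ! j) = Area \<longrightarrow>
       pwidth I S i \<le> of_rat (eps' I) * container_width I j \<and>
       pheight I S i \<le> of_rat (eps' I) * container_height I j)"

definition within_capacity :: "cp_instance \<Rightarrow> solution \<Rightarrow> nat \<Rightarrow> bool" where
  "within_capacity I S j \<longleftrightarrow> (case clabel (containers I ! j) of
     Large \<Rightarrow> card (packed_in S j) \<le> 1
   | Wide \<Rightarrow> sum (pheight I S) (packed_in S j) \<le> container_height I j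
   | Tall \<Rightarrow> sum (pwidth I S) (packed_in S j) \<le> container_width I j
   | Area \<Rightarrow> (\<Sum>i \<in> packed_in S j. pwidth I S i * pheight I S i)
       \<le> (1 - of_rat (eps' I))\<^sup>2 * container_width I j * container_height I j)"

lemma finite_packed_in [simp]: "finite (packed_in S j)"
  by (simp add: packed_in_def packed_def)

context
  fixes I :: cp_instance and d k :: nat and S :: solution and c :: "(nat \<times> bool) choice"
  assumes valid: "valid_instance d k I" and agrees: "agrees I S c"
begin

lemma agrees_length: "length c = length (items I)" "length S = length (items I)"
  using agrees map_eq_imp_length_eq by (fastforce simp: agrees_def)+

lemma agrees_nth:
  assumes "i < length (items I)"
  shows "map_option (\<lambda>p. (cont p, rotated p)) (S ! i) = map_option fst (c ! i)"
proof -
  have "map (map_option (\<lambda>p. (cont p, rotated p))) S ! i = map (map_option fst) c ! i"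
    using agrees by (simp add: agrees_def)
  then show ?thesis using assms agrees_length by simp
qed

lemma agrees_packed: "packed S = chosen c"
proof -
  have "S ! i = None \<longleftrightarrow> c ! i = None" if "i < length (items I)" for i
    using agrees_nth[OF that] by (metis map_option_is_None)
  then show ?thesis
    by (simp add: packed_def chosen_def agrees_length cong: conj_cong del: not_None_eq)
qed

lemma agrees_chosen:
  assumes "i \<in> chosen c"
  shows "i < length (items I)" "cont (the (S ! i)) = fst (fst (the (c ! i)))"
    "rotated (the (S ! i)) = snd (fst (the (c ! i)))"
proof -
  show i: "i < length (items I)" using assms by (simp add: chosen_def agrees_length)
  show "cont (the (S ! i)) = fst (fst (the (c ! i)))" "rotated (the (S ! i)) = snd (fst (the (c ! i)))"
    using agrees_nth[OF i] assms by (auto simp: chosen_def map_option_case split: option.splits)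
qed

lemma agrees_packed_in: "packed_in S j = assigned c j"
  using agrees_chosen(2) by (auto simp: packed_in_def assigned_def agrees_packed)

lemma chosen_box_correct:
  assumes "i \<in> chosen c"
  shows "real_of_int (fst (chosen_box I c i)) = pwidth I S i * real_of_int (den I)"
    "real_of_int (snd (chosen_box I c i)) = pheight I S i * real_of_int (den I)"
  using agrees_chosen[OF assms] oriented_correct[where a = "items I ! i"]
  by (simp_all add: pwidth_def pheight_def)

lemma fits_iff_small_enough:
  assumes j: "j < length (containers I)" and i: "i \<in> chosen c"
  shows "fits I (containers I ! j) (chosen_box I c i) \<longleftrightarrow> small_enough I S j i"
proof -
  let ?C = "containers I ! j" and ?Q = "real_of_int (den I)" and ?f = "real_of_int (eps_den I)"
  have Q: "0 < ?Q" using den_pos[of I] by simp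
  have f: "0 < ?f" using eps_den_pos[OF valid] by simp
  note box = chosen_box_correct[OF i]
  note C = scaled_correct[OF rationals_container[of ?C I]]
  have "fst (chosen_box I c i) \<le> scaled I (cwidth ?C) \<longleftrightarrow> pwidth I S i \<le> container_width I j"
    "snd (chosen_box I c i) \<le> scaled I (cheight ?C) \<longleftrightarrow> pheight I S i \<le> container_height I j"
    using j by (intro le_iff_of_int_eq_mult[OF box(1) C Q] le_iff_of_int_eq_mult[OF box(2) C Q]; simp)+
  moreover have "eps_den I * fst (chosen_box I c i) \<le> eps_num I * scaled I (cwidth ?C) \<longleftrightarrow>
      pwidth I S i \<le> of_rat (eps' I) * container_width I j"
    using f Q j box(1) C[of "cwidth ?C"]
    by (intro le_iff_of_int_eq_mult[where q = "?f * ?Q"]) (simp_all add: eps'_eq[OF valid])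
  moreover have "eps_den I * snd (chosen_box I c i) \<le> eps_num I * scaled I (cheight ?C) \<longleftrightarrow>
      pheight I S i \<le> of_rat (eps' I) * container_height I j"
    using f Q j box(2) C[of "cheight ?C"]
    by (intro le_iff_of_int_eq_mult[where q = "?f * ?Q"]) (simp_all add: eps'_eq[OF valid])
  ultimately show ?thesis
    by (simp add: fits_def small_enough_def split: label.split)
qed

context
  fixes j :: nat
  assumes j: "j < length (containers I)"
begin

lemma container_dimensions_scaled:
  "real_of_int (scaled I (cwidth (containers I ! j))) = container_width I j * real_of_int (den I)"
  "real_of_int (scaled I (cheight (containers I ! j))) = container_height I j * real_of_int (den I)"
  using j by (intro scaled_correct rationals_container[of "containers I ! j"]; simp)+

lemma assigned_box_scaled:
  assumes "i \<in> assigned c j"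
  shows "real_of_int (fst (chosen_box I c i)) = pwidth I S i * real_of_int (den I)"
    "real_of_int (snd (chosen_box I c i)) = pheight I S i * real_of_int (den I)"
  using assms chosen_box_correct by (simp_all add: assigned_def)

lemma area_usage_le_capacity_iff:
  assumes Area: "clabel (containers I ! j) = Area"
  shows "(\<Sum>i \<in> assigned c j. usage I (containers I ! j) (chosen_box I c i)) \<le>
      capacity I (containers I ! j)
    \<longleftrightarrow> (\<Sum>i \<in> assigned c j. pwidth I S i * pheight I S i) \<le>
      (1 - of_rat (eps' I))\<^sup>2 * container_width I j * container_height I j"
proof (rule le_iff_of_int_eq_mult)
  let ?C = "containers I ! j" and ?Q = "real_of_int (den I)"
  let ?e = "real_of_int (eps_num I)" and ?f = "real_of_int (eps_den I)"
  let ?q = "?f * ?f * ?Q * ?Q"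
  have f: "0 < ?f" using eps_den_pos[OF valid] by simp
  then show "0 < ?q" using den_pos[of I] by simp
  have "real_of_int (usage I ?C (chosen_box I c i)) = pwidth I S i * pheight I S i * ?q"
    if "i \<in> assigned c j" for i
    using assigned_box_scaled[OF that] by (simp add: usage_def Area)
  then show "real_of_int (\<Sum>i \<in> assigned c j. usage I ?C (chosen_box I c i)) =
      (\<Sum>i \<in> assigned c j. pwidth I S i * pheight I S i) * ?q"
    by (simp add: sum_distrib_right)
  have "?f - ?e = ?f * (1 - of_rat (eps' I))"
    using f by (simp add: eps'_eq[OF valid] right_diff_distrib)
  then have "real_of_int (capacity I ?C) =
      (?f * (1 - of_rat (eps' I))) * (?f * (1 - of_rat (eps' I))) *
        (container_width I j * ?Q) * (container_height I j * ?Q)"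
    by (simp add: capacity_def Area container_dimensions_scaled)
  then show "real_of_int (capacity I ?C) =
      (1 - of_rat (eps' I))\<^sup>2 * container_width I j * container_height I j * ?q"
    by (simp add: power2_eq_square ac_simps)
qed

lemma usage_le_capacity_iff_within_capacity:
  "(\<Sum>i \<in> assigned c j. usage I (containers I ! j) (chosen_box I c i)) \<le> capacity I (containers I ! j)
    \<longleftrightarrow> within_capacity I S j"
proof -
  let ?C = "containers I ! j" and ?Q = "real_of_int (den I)"
  have Q: "0 < ?Q" using den_pos[of I] by simp
  note box = assigned_box_scaled and C = container_dimensions_scaled
  show ?thesis
  proof (cases "clabel ?C")
    case Large
    then show ?thesis by (simp add: usage_def capacity_def within_capacity_def agrees_packed_in)
  next
    case Wide
    have "(\<Sum>i \<in> assigned c j. snd (chosen_box I c i)) \<le> scaled I (cheight ?C) \<longleftrightarrow>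
        sum (pheight I S) (assigned c j) \<le> container_height I j"
      using box by (intro le_iff_of_int_eq_mult[OF _ C(2) Q]) (simp add: sum_distrib_right)
    with Wide show ?thesis by (simp add: usage_def capacity_def within_capacity_def agrees_packed_in)
  next
    case Tall
    have "(\<Sum>i \<in> assigned c j. fst (chosen_box I c i)) \<le> scaled I (cwidth ?C) \<longleftrightarrow>
        sum (pwidth I S) (assigned c j) \<le> container_width I j"
      using box by (intro le_iff_of_int_eq_mult[OF _ C(1) Q]) (simp add: sum_distrib_right)
    with Tall show ?thesis by (simp add: usage_def capacity_def within_capacity_def agrees_packed_in)
  next
    case Area
    then show ?thesis
      by (simp add: area_usage_le_capacity_iff within_capacity_def agrees_packed_in)
  qed
qed

end

lemma weight_le_den_iff:
  assumes "t < d"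
  shows "(\<Sum>i \<in> chosen c. scaled I (weights (items I ! i) ! t)) \<le> den I \<longleftrightarrow>
    (\<Sum>i \<in> packed S. weights (items I ! i) ! t) \<le> 1"
proof -
  have "real_of_int (scaled I (weights (items I ! i) ! t)) =
      of_rat (weights (items I ! i) ! t) * real_of_int (den I)"
    if "i \<in> chosen c" for i
    using agrees_chosen(1)[OF that] valid_item(4)[OF valid, of "items I ! i"] assms
    by (intro scaled_correct rationals_item[of "items I ! i"]) simp_all
  then have "(\<Sum>i \<in> chosen c. scaled I (weights (items I ! i) ! t)) \<le> den I \<longleftrightarrow>
      (\<Sum>i \<in> chosen c. real_of_rat (weights (items I ! i) ! t)) \<le> 1"
    using den_pos[of I]
    by (intro le_iff_of_int_eq_mult[where q = "real_of_int (den I)"]) (simp_all add: sum_distrib_right)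
  also have "\<dots> \<longleftrightarrow> real_of_rat (\<Sum>i \<in> packed S. weights (items I ! i) ! t) \<le> of_rat 1"
    by (simp add: of_rat_sum agrees_packed)
  finally show ?thesis by (simp only: of_rat_less_eq)
qed

lemma gain_eq_total_profit:
  assumes "admissible (knapsack_items rotation I) c"
  shows "real_of_int (gain (knapsack_items rotation I) c) = total_profit I S * real_of_int (den I)"
proof -
  have "real_of_int (scaled I (profit (items I ! i))) =
      of_rat (profit (items I ! i)) * real_of_int (den I)"
    if "i \<in> chosen c" for i
    using agrees_chosen(1)[OF that] by (intro scaled_correct rationals_item[of "items I ! i"]) simp_all
  then show ?thesis
    by (simp add: gain_knapsack_items[OF assms] total_profit_def agrees_packed sum_distrib_right)
qed

lemma fitting_iff:
  assumes adm: "admissible (knapsack_items rotation I) c"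
  shows "fitting (knapsack_items rotation I) (capacities d I) c \<longleftrightarrow>
    (\<forall>j < length (containers I). within_capacity I S j) \<and>
    (\<forall>t < d. (\<Sum>i \<in> packed S. weights (items I ! i) ! t) \<le> 1)"
proof -
  let ?m = "length (containers I)"
  have "(\<forall>j < ?m + d. load c j \<le> capacities d I ! j) \<longleftrightarrow>
      (\<forall>j < ?m. load c j \<le> capacities d I ! j) \<and> (\<forall>t < d. load c (?m + t) \<le> capacities d I ! (?m + t))"
    by (rule all_less_add_iff)
  moreover have "load c j \<le> capacities d I ! j \<longleftrightarrow> within_capacity I S j" if "j < ?m" for j
    using usage_le_capacity_iff_within_capacity[OF that]
    by (simp add: load_container[OF adm that] nth_capacities_container[OF that])
  moreover have "load c (?m + t) \<le> capacities d I ! (?m + t) \<longleftrightarrow>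
      (\<Sum>i \<in> packed S. weights (items I ! i) ! t) \<le> 1" if "t < d" for t
    using weight_le_den_iff[OF that] load_weight[OF adm valid_item(4)[OF valid] that]
    by (simp add: nth_capacities_weight[OF that])
  ultimately show ?thesis using adm by (simp add: fitting_def)
qed

end


section \<open>Every feasible packing yields a fitting choice\<close>

definition inside :: "cp_instance \<Rightarrow> solution \<Rightarrow> nat \<Rightarrow> nat \<Rightarrow> bool" where
  "inside I S j i \<longleftrightarrow> 0 \<le> left_edge S i \<and> right_edge I S i \<le> container_width I j \<and>
     0 \<le> bottom_edge S i \<and> top_edge I S i \<le> container_height I j"

definition beside :: "cp_instance \<Rightarrow> solution \<Rightarrow> nat \<Rightarrow> nat \<Rightarrow> bool" where
  "beside I S i i' \<longleftrightarrow> right_edge I S i \<le> left_edge S i' \<or> right_edge I S i' \<le> left_edge S i"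

definition stacked :: "cp_instance \<Rightarrow> solution \<Rightarrow> nat \<Rightarrow> nat \<Rightarrow> bool" where
  "stacked I S i i' \<longleftrightarrow> top_edge I S i \<le> bottom_edge S i' \<or> top_edge I S i' \<le> bottom_edge S i"

lemma rect_subset_iff_inside:
  assumes "0 < pwidth I S i" "0 < pheight I S i"
  shows "rect I S i \<subseteq> {0..container_width I j} \<times> {0..container_height I j} \<longleftrightarrow> inside I S j i"
proof
  assume sub: "rect I S i \<subseteq> {0..container_width I j} \<times> {0..container_height I j}"
  have "(left_edge S i, bottom_edge S i) \<in> rect I S i" "(right_edge I S i, top_edge I S i) \<in> rect I S i"
    using assms by (simp_all add: rect_def right_edge_def top_edge_def)
  with sub show "inside I S j i" by (auto simp: inside_def)
qed (auto simp: rect_def inside_def)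

lemma sum_lengths_disjoint_intervals_le:
  fixes lo len :: "'i \<Rightarrow> 'a :: linordered_idom"
  assumes "finite A" "\<And>i. i \<in> A \<Longrightarrow> 0 \<le> lo i \<and> lo i + len i \<le> b \<and> 0 < len i"
    "\<And>i i'. i \<in> A \<Longrightarrow> i' \<in> A \<Longrightarrow> i \<noteq> i' \<Longrightarrow> lo i + len i \<le> lo i' \<or> lo i' + len i' \<le> lo i" "0 \<le> b"
  shows "sum len A \<le> b"
  using assms
proof (induction arbitrary: b rule: finite_ranking_induct[where f = lo])
  case (insert m A)
  show ?case
  proof (cases "m \<in> A")
    case True
    with insert show ?thesis by (simp add: insert_absorb)
  next
    case False
    have m: "0 \<le> lo m" "lo m + len m \<le> b" "0 < len m" using insert.prems(1)[of m] by simp_all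
    have "lo i + len i \<le> lo m" if "i \<in> A" for i
    proof -
      have "lo i + len i \<le> lo m \<or> lo m + len m \<le> lo i"
        using that False by (intro insert.prems(2)) auto
      moreover have "lo i \<le> lo m" by (rule insert.hyps(2)[OF that])
      ultimately show ?thesis using m(3) by linarith
    qed
    then have "sum len A \<le> lo m"
      using insert.prems m(1) by (intro insert.IH) auto
    then show ?thesis using False insert.hyps(1) m(2) by simp
  qed
qed simp

lemma container_ok_inside:
  assumes ok: "container_ok I S j" and i: "i \<in> packed_in S j"
    and pos: "0 < pwidth I S i" "0 < pheight I S i"
  shows "inside I S j i"
  using ok i unfolding rect_subset_iff_inside[OF pos, symmetric] container_ok_def Let_def by blast

lemma container_ok_small_enough:
  assumes ok: "container_ok I S j" and i: "i \<in> packed_in S j"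
    and pos: "0 < pwidth I S i" "0 < pheight I S i"
  shows "small_enough I S j i"
proof -
  have "pwidth I S i \<le> container_width I j \<and> pheight I S i \<le> container_height I j"
    using container_ok_inside[OF assms] by (auto simp: inside_def right_edge_def top_edge_def)
  moreover have "pwidth I S i \<le> of_rat (eps' I) * container_width I j \<and>
      pheight I S i \<le> of_rat (eps' I) * container_height I j" if "clabel (containers I ! j) = Area"
    using ok i that by (simp add: container_ok_def Let_def)
  ultimately show ?thesis by (simp add: small_enough_def)
qed

lemma container_ok_within_capacity:
  assumes ok: "container_ok I S j"
    and pos: "\<And>i. i \<in> packed_in S j \<Longrightarrow> 0 < pwidth I S i \<and> 0 < pheight I S i"
    and C: "0 \<le> container_width I j" "0 \<le> container_height I j"
  shows "within_capacity I S j"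
proof -
  note inside = container_ok_inside[OF ok]
  show ?thesis
  proof (cases "clabel (containers I ! j)")
    case Wide
    have "sum (pheight I S) (packed_in S j) \<le> container_height I j"
    proof (rule sum_lengths_disjoint_intervals_le[where lo = "bottom_edge S"])
      show "0 \<le> bottom_edge S i \<and> bottom_edge S i + pheight I S i \<le> container_height I j \<and>
          0 < pheight I S i"
        if "i \<in> packed_in S j" for i
        using inside[OF that] pos[OF that] by (simp add: inside_def top_edge_def)
      show "bottom_edge S i + pheight I S i \<le> bottom_edge S i' \<or>
          bottom_edge S i' + pheight I S i' \<le> bottom_edge S i"
        if "i \<in> packed_in S j" "i' \<in> packed_in S j" "i \<noteq> i'" for i i'
        using ok that Wide by (simp add: container_ok_def Let_def top_edge_def)
    qed (use C in simp_all)
    with Wide show ?thesis by (simp add: within_capacity_def)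
  next
    case Tall
    have "sum (pwidth I S) (packed_in S j) \<le> container_width I j"
    proof (rule sum_lengths_disjoint_intervals_le[where lo = "left_edge S"])
      show "0 \<le> left_edge S i \<and> left_edge S i + pwidth I S i \<le> container_width I j \<and> 0 < pwidth I S i"
        if "i \<in> packed_in S j" for i
        using inside[OF that] pos[OF that] by (simp add: inside_def right_edge_def)
      show "left_edge S i + pwidth I S i \<le> left_edge S i' \<or>
          left_edge S i' + pwidth I S i' \<le> left_edge S i"
        if "i \<in> packed_in S j" "i' \<in> packed_in S j" "i \<noteq> i'" for i i'
        using ok that Tall by (simp add: container_ok_def Let_def right_edge_def)
    qed (use C in simp_all)
    with Tall show ?thesis by (simp add: within_capacity_def)
  qed (use ok in \<open>simp_all add: within_capacity_def container_ok_def Let_def\<close>)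
qed

lemma pdimensions_pos:
  assumes "valid_instance d k I" "i < length (items I)"
  shows "0 < pwidth I S i" "0 < pheight I S i"
  using valid_item[OF assms(1), of "items I ! i"] assms(2) by (simp_all add: pwidth_def pheight_def)

definition choice_of :: "cp_instance \<Rightarrow> solution \<Rightarrow> (nat \<times> bool) choice" where
  "choice_of I S = map2 (\<lambda>a. map_option (\<lambda>p.
     ((cont p, rotated p), usage_vec I a (cont p) (rotated p)))) (items I) S"

theorem feasible_packing_choice_of:
  assumes valid: "valid_instance d k I" and S: "feasible_packing rotation d I S"
  shows "agrees I S (choice_of I S)"
    and "fitting (knapsack_items rotation I) (capacities d I) (choice_of I S)"
proof -
  have len: "length S = length (items I)" using S by (simp add: feasible_packing_def)
  show agrees: "agrees I S (choice_of I S)"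
    unfolding agrees_def using len
    by (auto intro!: nth_equalityI simp: choice_of_def option.map_comp comp_def)
  note packed_in = agrees_packed[OF valid agrees]
  have pos: "0 < pwidth I S i \<and> 0 < pheight I S i" if "i \<in> packed S" for i
    using pdimensions_pos[OF valid, of i] that len by (simp add: packed_def)
  have ok: "container_ok I S j" if "j < length (containers I)" for j
    using S that by (simp add: feasible_packing_def)
  have "admissible (knapsack_items rotation I) (choice_of I S)"
    unfolding admissible_knapsack_items_iff
  proof (intro conjI ballI)
    show "length (choice_of I S) = length (items I)" using len by (simp add: choice_of_def)
    fix i assume i: "i \<in> chosen (choice_of I S)"
    then have iS: "i \<in> packed S" by (simp add: packed_in)
    then obtain p where p: "S ! i = Some p" "i < length (items I)" using len by (auto simp: packed_def)
    have j: "cont p < length (containers I)" and rot: "rotated p \<longrightarrow> rotation"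
      using S iS p(1) unfolding feasible_packing_def by (metis option.sel)+
    have choice: "choice_of I S ! i =
        Some ((cont p, rotated p), usage_vec I (items I ! i) (cont p) (rotated p))"
      using p len by (simp add: choice_of_def)
    have "small_enough I S (cont p) i"
      using container_ok_small_enough[OF ok[OF j]] pos[OF iS] iS p(1) by (simp add: packed_in_def)
    then have "fits I (containers I ! cont p) (oriented I (rotated p) (items I ! i))"
      using fits_iff_small_enough[OF valid agrees j i] by (simp add: choice)
    with j rot choice show "\<exists>j rot. j < length (containers I) \<and> (rot \<longrightarrow> rotation) \<and>
        fits I (containers I ! j) (oriented I rot (items I ! i)) \<and>
        choice_of I S ! i = Some ((j, rot), usage_vec I (items I ! i) j rot)" by blast
  qed
  moreover have "within_capacity I S j" if j: "j < length (containers I)" for j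
    using valid_container[OF valid, of "containers I ! j"] j
    by (intro container_ok_within_capacity ok pos) (simp_all add: packed_in_def less_imp_le)
  ultimately show "fitting (knapsack_items rotation I) (capacities d I) (choice_of I S)"
    using S by (simp add: fitting_iff[OF valid agrees] feasible_packing_def)
qed


section \<open>Every fitting choice yields a feasible packing\<close>

definition boxes :: "cp_instance \<Rightarrow> (nat \<times> bool) choice \<Rightarrow> nat \<Rightarrow> nat box list" where
  "boxes I c j = concat (map (\<lambda>(i, a, x). case x of None \<Rightarrow> []
     | Some y \<Rightarrow> if fst (fst y) = j then [(i, oriented I (snd (fst y)) a)] else [])
     (List.enumerate 0 (zip (items I) c)))"

text \<open>Shelves of width \<open>0\<close> hold one box each, so that wide containers are stacked; in tall and large
  containers everything goes to the first shelf.\<close>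

definition container_positions :: "cp_instance \<Rightarrow> (nat \<times> bool) choice \<Rightarrow> nat \<Rightarrow> container \<Rightarrow>
    nat placed_box list" where
  "container_positions I c j C =
     shelf_pack (case clabel C of Wide \<Rightarrow> 0 | _ \<Rightarrow> scaled I (cwidth C)) (boxes I c j)"

definition positions :: "cp_instance \<Rightarrow> (nat \<times> bool) choice \<Rightarrow> nat placed_box list" where
  "positions I c =
     concat (map (\<lambda>(j, C). container_positions I c j C) (List.enumerate 0 (containers I)))"

definition placed :: "cp_instance \<Rightarrow> (nat \<times> bool) choice \<Rightarrow> ((nat \<times> bool) \<times> int \<times> int) option list" where
  "placed I c = map (\<lambda>(i, x). case x of None \<Rightarrow> None | Some y \<Rightarrow>
     (case map_of (positions I c) i of None \<Rightarrow> None | Some q \<Rightarrow> Some (fst y, fst q, fst (snd q))))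
     (List.enumerate 0 c)"

definition placement_of :: "cp_instance \<Rightarrow> (nat \<times> bool) \<times> int \<times> int \<Rightarrow> placement" where
  "placement_of I p = (case p of ((j, rot), x, y) \<Rightarrow> \<lparr>cont = j, rotated = rot,
     xpos = real_of_int x / real_of_int (den I), ypos = real_of_int y / real_of_int (den I)\<rparr>)"

definition solution_of :: "cp_instance \<Rightarrow> (nat \<times> bool) choice \<Rightarrow> solution" where
  "solution_of I c = map (map_option (placement_of I)) (placed I c)"

definition occupies :: "cp_instance \<Rightarrow> solution \<Rightarrow> nat placed_box \<Rightarrow> bool" where
  "occupies I S q \<longleftrightarrow> (case q of (i, x, y, w, h) \<Rightarrow>
     left_edge S i = real_of_int x / real_of_int (den I) \<and>
     right_edge I S i = real_of_int (x + w) / real_of_int (den I) \<and>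
     bottom_edge S i = real_of_int y / real_of_int (den I) \<and>
     top_edge I S i = real_of_int (y + h) / real_of_int (den I))"

definition well_placed :: "cp_instance \<Rightarrow> container \<Rightarrow> 'k placed_box \<Rightarrow> bool" where
  "well_placed I C q \<longleftrightarrow> (case q of (i, x, y, w, h) \<Rightarrow>
     0 \<le> x \<and> x + w \<le> scaled I (cwidth C) \<and> 0 \<le> y \<and> y + h \<le> scaled I (cheight C) \<and>
     (clabel C = Tall \<longrightarrow> y = 0) \<and> (clabel C = Wide \<longrightarrow> x = 0))"

lemma concat_map_if: "concat (map (\<lambda>i. if P i then [g i] else []) xs) = map g (filter P xs)"
  by (induction xs) auto

lemma boxes_eq:
  assumes "length c = length (items I)"
  shows "boxes I c j = map (\<lambda>i. (i, chosen_box I c i)) (filter (\<lambda>i. i \<in> assigned c j) [0..<length c])"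
proof -
  have "boxes I c j =
      concat (map (\<lambda>i. if i \<in> assigned c j then [(i, chosen_box I c i)] else []) [0..<length c])"
    using assms by (auto simp: boxes_def enumerate_0_eq_map assigned_def chosen_def
        intro!: arg_cong[where f = concat] map_cong split: option.split)
  then show ?thesis by (simp only: concat_map_if)
qed

lemma set_boxes:
  assumes "length c = length (items I)"
  shows "set (boxes I c j) = (\<lambda>i. (i, chosen_box I c i)) ` assigned c j"
  unfolding boxes_eq[OF assms] by (auto simp: assigned_def chosen_def)

lemma sum_list_boxes:
  assumes "length c = length (items I)"
  shows "(\<Sum>(i, b)\<leftarrow>boxes I c j. g b) = (\<Sum>i \<in> assigned c j. g (chosen_box I c i))"
proof -
  have "{i \<in> set [0..<length c]. i \<in> assigned c j} = assigned c j"
    by (auto simp: assigned_def chosen_def)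
  then show ?thesis
    unfolding boxes_eq[OF assms] by (simp add: comp_def sum_list_distinct_conv_sum_set)
qed

lemma mem_positions_iff:
  "q \<in> set (positions I c) \<longleftrightarrow>
    (\<exists>j < length (containers I). q \<in> set (container_positions I c j (containers I ! j)))"
  by (auto simp: positions_def enumerate_0_eq_map)

lemma box_of_container_positions:
  assumes "length c = length (items I)"
  shows "box_of ` set (container_positions I c j C) = (\<lambda>i. (i, chosen_box I c i)) ` assigned c j"
  unfolding container_positions_def set_box_of_shelf_pack set_boxes[OF assms] ..

lemma sorted_wrt_total:
  "sorted_wrt R xs \<Longrightarrow> p \<in> set xs \<Longrightarrow> q \<in> set xs \<Longrightarrow> p \<noteq> q \<Longrightarrow> R p q \<or> R q p"
  by (induction xs) auto

lemma total_width_le_if_Large_or_Tall: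
  assumes "clabel C \<in> {Large, Tall}" "\<forall>(k, b) \<in> set L. fits I C b"
    and "(\<Sum>(k, b)\<leftarrow>L. usage I C b) \<le> capacity I C" "0 < scaled I (cwidth C)"
  shows "(\<Sum>(k, w, h)\<leftarrow>L. w) \<le> scaled I (cwidth C)"
proof (cases "clabel C = Tall")
  case True
  then show ?thesis using assms(3) by (simp add: usage_def capacity_def case_prod_unfold)
next
  case False
  then have "length L \<le> 1"
    using assms(1,3) by (simp add: usage_def capacity_def case_prod_unfold sum_list_triv)
  then consider "L = []" | k b where "L = [(k, b)]" by (cases L) auto
  then show ?thesis by cases (use assms(2,4) in \<open>auto simp: fits_def\<close>)
qed

lemma shelf_pack_area_container:
  assumes Area: "clabel C = Area" and L: "positive_boxes L" "\<forall>(k, b) \<in> set L. fits I C b"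
    and cap: "(\<Sum>(k, b)\<leftarrow>L. usage I C b) \<le> capacity I C"
    and eps: "0 < eps_den I" "eps_num I < eps_den I" and C: "0 < scaled I (cwidth C)"
    and q: "(k, x, y, w, h) \<in> set (shelf_pack (scaled I (cwidth C)) L)"
  shows "y + h \<le> scaled I (cheight C)"
proof (rule shelf_pack_area[OF L(1) _ eps C _ q])
  show "\<forall>(k, w, h) \<in> set L. eps_den I * w \<le> eps_num I * scaled I (cwidth C) \<and>
      eps_den I * h \<le> eps_num I * scaled I (cheight C)"
    using L(2) Area by (auto simp: fits_def)
  show "eps_den I * eps_den I * total_area L \<le>
      (eps_den I - eps_num I) * (eps_den I - eps_num I) * scaled I (cwidth C) * scaled I (cheight C)"
    using cap Area by (simp add: usage_def capacity_def case_prod_unfold sum_list_const_mult)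
qed

lemma shelf_pack_in_container:
  fixes L :: "'k box list"
  assumes L: "positive_boxes L" "\<forall>(k, b) \<in> set L. fits I C b"
    and cap: "(\<Sum>(k, b)\<leftarrow>L. usage I C b) \<le> capacity I C"
    and eps: "0 < eps_den I" "eps_num I < eps_den I" and C: "0 < scaled I (cwidth C)"
    and q: "(k, x, y, w, h) \<in> set (shelf_pack (case clabel C of Wide \<Rightarrow> 0 | _ \<Rightarrow> scaled I (cwidth C)) L)"
  shows "well_placed I C (k, x, y, w, h)"
proof -
  have "box_of (k, x, y, w, h) \<in> set L"
    using imageI[OF q, of box_of] by (simp only: set_box_of_shelf_pack)
  then have wh: "0 < w" "0 < h" "w \<le> scaled I (cwidth C)" "h \<le> scaled I (cheight C)"
    using L by (auto simp: positive_boxes_def fits_def)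
  show ?thesis
  proof (cases "clabel C = Wide")
    case True
    have "(\<Sum>(k, w, h)\<leftarrow>L. h) = (\<Sum>(k, b)\<leftarrow>L. snd b)" by (simp add: case_prod_unfold)
    with True have "(\<Sum>(k, w, h)\<leftarrow>L. h) \<le> scaled I (cheight C)"
      using cap by (simp add: usage_def capacity_def)
    with True shelf_pack_width_0[OF L(1), of k x y w h] q wh show ?thesis by (simp add: well_placed_def)
  next
    case False
    then have q: "(k, x, y, w, h) \<in> set (shelf_pack (scaled I (cwidth C)) L)"
      using q by (simp split: label.splits)
    have horizontal: "0 \<le> x" "0 \<le> y" "x + w \<le> scaled I (cwidth C)"
      using shelf_pack_within_width[OF L(1) _ q] C wh by auto
    show ?thesis
    proof (cases "clabel C = Area")
      case False
      with \<open>clabel C \<noteq> Wide\<close> have "clabel C \<in> {Large, Tall}" by (cases "clabel C") simp_all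
      then have "(\<Sum>(k, w, h)\<leftarrow>L. w) \<le> scaled I (cwidth C)"
        using L(2) cap C by (rule total_width_le_if_Large_or_Tall)
      then have "y = 0" using L(1) q by (intro shelf_pack_single_shelf)
      then show ?thesis using \<open>clabel C \<noteq> Wide\<close> horizontal wh by (simp add: well_placed_def)
    next
      case Area: True
      have "y + h \<le> scaled I (cheight C)"
        by (rule shelf_pack_area_container[OF Area L cap eps C q])
      then show ?thesis using horizontal Area by (simp add: well_placed_def)
    qed
  qed
qed

lemma container_okI:
  assumes inside: "\<And>i. i \<in> packed_in S j \<Longrightarrow> inside I S j i"
    and pos: "\<And>i. i \<in> packed_in S j \<Longrightarrow> 0 < pwidth I S i \<and> 0 < pheight I S i"
    and apart: "\<And>i i'. i \<in> packed_in S j \<Longrightarrow> i' \<in> packed_in S j \<Longrightarrow> i \<noteq> i' \<Longrightarrow>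
      clabel (containers I ! j) \<noteq> Wide \<and> beside I S i i' \<or>
        clabel (containers I ! j) \<noteq> Tall \<and> stacked I S i i'"
    and small: "\<And>i. i \<in> packed_in S j \<Longrightarrow> small_enough I S j i"
    and capacity: "within_capacity I S j"
  shows "container_ok I S j"
proof -
  have "rect I S i \<subseteq> {0..container_width I j} \<times> {0..container_height I j}" if "i \<in> packed_in S j" for i
    using inside[OF that] pos[OF that] by (simp add: rect_subset_iff_inside)
  moreover have "open_rect I S i \<inter> open_rect I S i' = {}"
    if "i \<in> packed_in S j" "i' \<in> packed_in S j" "i \<noteq> i'" for i i'
    using apart[OF that] by (auto simp: open_rect_def beside_def stacked_def)
  ultimately show ?thesis
    using apart small capacity
    unfolding container_ok_def Let_def within_capacity_def small_enough_def beside_def stacked_def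
    by (cases "clabel (containers I ! j)") auto
qed

context
  fixes I :: cp_instance and d k :: nat and c :: "(nat \<times> bool) choice" and rotation :: bool
  assumes valid: "valid_instance d k I"
    and fit: "fitting (knapsack_items rotation I) (capacities d I) c"
begin

lemma admissible_choice: "admissible (knapsack_items rotation I) c"
  using fit by (simp add: fitting_def)

lemma length_choice: "length c = length (items I)"
  by (rule length_admissible[OF admissible_choice])

lemma map_of_positions:
  assumes i: "i \<in> assigned c j"
  shows "\<exists>x y. map_of (positions I c) i = Some (x, y, chosen_box I c i) \<and>
    (i, x, y, chosen_box I c i) \<in> set (container_positions I c j (containers I ! j))"
proof -
  have j: "j < length (containers I)" using assignedD[OF admissible_choice i] .
  note boxes = box_of_container_positions[OF length_choice]
  have "(i, chosen_box I c i) \<in> box_of ` set (container_positions I c j (containers I ! j))"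
    using i by (simp add: boxes)
  then obtain q where "q \<in> set (container_positions I c j (containers I ! j))" "fst q = i"
    by (auto simp: box_of_def)
  then have "i \<in> fst ` set (positions I c)"
    using j mem_positions_iff by (metis imageI)
  then obtain q where q: "map_of (positions I c) i = Some q"
    by (metis map_of_eq_None_iff option.exhaust)
  obtain x y b where xyb: "q = (x, y, b)" by (cases q)
  from map_of_SomeD[OF q]
  obtain j' where j': "(i, q) \<in> set (container_positions I c j' (containers I ! j'))"
    by (auto simp: mem_positions_iff)
  have "box_of (i, q) \<in> (\<lambda>i. (i, chosen_box I c i)) ` assigned c j'"
    using imageI[OF j', of box_of] by (simp only: boxes)
  then have "i \<in> assigned c j'" "b = chosen_box I c i" by (auto simp: box_of_def xyb)
  moreover from this i have "j' = j" by (simp add: assigned_def)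
  ultimately show ?thesis using q j' xyb by blast
qed

lemma nth_solution_of:
  assumes i: "i \<in> assigned c j"
  obtains x y rot where "c ! i = Some ((j, rot), usage_vec I (items I ! i) j rot)"
    "(i, x, y, chosen_box I c i) \<in> set (container_positions I c j (containers I ! j))"
    "solution_of I c ! i = Some (placement_of I ((j, rot), x, y))"
proof -
  obtain rot where rot: "i < length (items I)"
    "c ! i = Some ((j, rot), usage_vec I (items I ! i) j rot)"
    using assignedD[OF admissible_choice i] .
  obtain x y where xy: "map_of (positions I c) i = Some (x, y, chosen_box I c i)"
    "(i, x, y, chosen_box I c i) \<in> set (container_positions I c j (containers I ! j))"
    using map_of_positions[OF i] by blast
  have "solution_of I c ! i = Some (placement_of I ((j, rot), x, y))"
    using rot xy(1) length_choice by (simp add: solution_of_def placed_def nth_enumerate_eq)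
  with rot xy(2) show thesis by (intro that)
qed

lemma agrees_solution_of: "agrees I (solution_of I c) c"
  unfolding agrees_def
proof (intro conjI nth_equalityI)
  show len: "length (solution_of I c) = length (items I)"
    by (simp add: solution_of_def placed_def length_choice)
  show "length (map (map_option (\<lambda>p. (cont p, rotated p))) (solution_of I c)) =
      length (map (map_option fst) c)"
    by (simp add: len length_choice)
  fix i assume "i < length (map (map_option (\<lambda>p. (cont p, rotated p))) (solution_of I c))"
  then have i: "i < length c" by (simp add: len length_choice)
  show "map (map_option (\<lambda>p. (cont p, rotated p))) (solution_of I c) ! i = map (map_option fst) c ! i"
  proof (cases "c ! i")
    case None
    with i show ?thesis by (simp add: solution_of_def placed_def nth_enumerate_eq)
  next
    case (Some a)
    obtain j rot v where a: "a = ((j, rot), v)" by (metis surj_pair)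
    then have "i \<in> assigned c j" using i Some by (simp add: assigned_def chosen_def)
    then obtain x y rot' where "c ! i = Some ((j, rot'), usage_vec I (items I ! i) j rot')"
      "solution_of I c ! i = Some (placement_of I ((j, rot'), x, y))"
      by (rule nth_solution_of)
    then show ?thesis using i len length_choice Some a by (simp add: placement_of_def)
  qed
qed

lemma solution_of_occupies:
  assumes i: "i \<in> assigned c j"
  obtains x y w h where "(i, x, y, w, h) \<in> set (container_positions I c j (containers I ! j))"
    "chosen_box I c i = (w, h)" "occupies I (solution_of I c) (i, x, y, w, h)"
proof -
  obtain w h where box: "chosen_box I c i = (w, h)" by fastforce
  obtain x y rot where
    xy: "(i, x, y, chosen_box I c i) \<in> set (container_positions I c j (containers I ! j))"
    "solution_of I c ! i = Some (placement_of I ((j, rot), x, y))"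
    by (rule nth_solution_of[OF i])
  have "i \<in> chosen c" using i by (simp add: assigned_def)
  from chosen_box_correct[OF valid agrees_solution_of this]
  have "pwidth I (solution_of I c) i = real_of_int w / real_of_int (den I)"
    "pheight I (solution_of I c) i = real_of_int h / real_of_int (den I)"
    using den_pos[of I] by (simp_all add: box)
  then have "occupies I (solution_of I c) (i, x, y, w, h)"
    using xy(2) by (simp add: occupies_def placement_of_def left_edge_def right_edge_def bottom_edge_def
        top_edge_def add_divide_distrib)
  with xy(1) box show thesis by (intro that) simp_all
qed

lemma container_positions_separated_well_placed:
  assumes j: "j < length (containers I)"
  shows "sorted_wrt separated (container_positions I c j (containers I ! j))"
    and "q \<in> set (container_positions I c j (containers I ! j)) \<Longrightarrow> well_placed I (containers I ! j) q"
proof -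
  let ?C = "containers I ! j"
  have "0 < fst (chosen_box I c i) \<and> 0 < snd (chosen_box I c i) \<and> fits I ?C (chosen_box I c i)"
    if "i \<in> assigned c j" for i
    using assignedD[OF admissible_choice that] oriented_pos[OF valid, of "items I ! i"]
    by (metis nth_mem)
  then have boxes: "positive_boxes (boxes I c j)" "\<forall>(i, b) \<in> set (boxes I c j). fits I ?C b"
    by (auto simp: positive_boxes_def set_boxes[OF length_choice] case_prod_beta)
  show "sorted_wrt separated (container_positions I c j ?C)"
    unfolding container_positions_def by (rule shelf_pack_separated[OF boxes(1)])
  have "load c j \<le> capacities d I ! j" using fit j by (simp add: fitting_def)
  then have capacity: "(\<Sum>(i, b)\<leftarrow>boxes I c j. usage I ?C b) \<le> capacity I ?C"
    by (simp only: sum_list_boxes[OF length_choice] load_container[OF admissible_choice j]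
        nth_capacities_container[OF j])
  obtain i x y w h where q: "q = (i, x, y, w, h)" by (metis surj_pair)
  show "q \<in> set (container_positions I c j ?C) \<Longrightarrow> well_placed I ?C q"
    unfolding container_positions_def q
    using eps_den_pos[OF valid] eps_num_less[OF valid] scaled_container_pos[OF valid, of ?C] j
    by (intro shelf_pack_in_container[OF boxes capacity]) simp_all
qed

lemma of_int_div_den_le_iff:
  "real_of_int a / real_of_int (den I) \<le> real_of_int b / real_of_int (den I) \<longleftrightarrow> a \<le> b"
  using den_pos[of I] by (simp add: divide_le_cancel)

lemma solution_of_inside:
  assumes j: "j < length (containers I)" and i: "i \<in> assigned c j"
  shows "inside I (solution_of I c) j i"
proof -
  let ?C = "containers I ! j"
  have C: "container_width I j = real_of_int (scaled I (cwidth ?C)) / real_of_int (den I)"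
    "container_height I j = real_of_int (scaled I (cheight ?C)) / real_of_int (den I)"
    using den_pos[of I] j scaled_correct[OF rationals_container[of ?C I]] by simp_all
  obtain x y w h where q: "(i, x, y, w, h) \<in> set (container_positions I c j ?C)"
    and occupies: "occupies I (solution_of I c) (i, x, y, w, h)"
    by (rule solution_of_occupies[OF i])
  have "well_placed I ?C (i, x, y, w, h)"
    by (rule container_positions_separated_well_placed(2)[OF j q])
  then show ?thesis
    using occupies of_int_div_den_le_iff[of 0] unfolding inside_def C
    by (simp add: occupies_def well_placed_def of_int_div_den_le_iff del: of_int_add)
qed

lemma solution_of_apart:
  assumes j: "j < length (containers I)" and i: "i \<in> assigned c j" "i' \<in> assigned c j" "i \<noteq> i'"
  shows "clabel (containers I ! j) \<noteq> Wide \<and> beside I (solution_of I c) i i' \<or>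
    clabel (containers I ! j) \<noteq> Tall \<and> stacked I (solution_of I c) i i'"
proof -
  let ?S = "solution_of I c" and ?C = "containers I ! j"
  note positions = container_positions_separated_well_placed[OF j]
  have pos: "0 < fst (chosen_box I c i) \<and> 0 < snd (chosen_box I c i)" if "i \<in> assigned c j" for i
    using assignedD[OF admissible_choice that] oriented_pos[OF valid nth_mem] by blast
  obtain x y w h where q: "(i, x, y, w, h) \<in> set (container_positions I c j ?C)"
    and box: "chosen_box I c i = (w, h)" and occupies: "occupies I ?S (i, x, y, w, h)"
    by (rule solution_of_occupies[OF i(1)])
  obtain x' y' w' h' where q': "(i', x', y', w', h') \<in> set (container_positions I c j ?C)"
    and box': "chosen_box I c i' = (w', h')" and occupies': "occupies I ?S (i', x', y', w', h')"
    by (rule solution_of_occupies[OF i(2)])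
  have "separated (i, x, y, w, h) (i', x', y', w', h') \<or> separated (i', x', y', w', h') (i, x, y, w, h)"
    using sorted_wrt_total[OF positions(1) q q'] i(3) by simp
  moreover have "0 < w" "0 < h" "0 < w'" "0 < h'"
    using pos[OF i(1)] pos[OF i(2)] by (simp_all add: box box')
  moreover have "beside I ?S i i' \<longleftrightarrow> x + w \<le> x' \<or> x' + w' \<le> x"
    "stacked I ?S i i' \<longleftrightarrow> y + h \<le> y' \<or> y' + h' \<le> y"
    using occupies occupies'
    by (simp_all add: beside_def stacked_def occupies_def of_int_div_den_le_iff del: of_int_add)
  ultimately show ?thesis
    using positions(2)[OF q] positions(2)[OF q'] by (auto simp: separated_def well_placed_def)
qed

lemma container_ok_solution_of:
  assumes j: "j < length (containers I)"
  shows "container_ok I (solution_of I c) j"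
proof (rule container_okI)
  note agrees = agrees_solution_of
  note packed_in = agrees_packed_in[OF valid agrees]
  show "within_capacity I (solution_of I c) j"
    using fit j by (simp add: fitting_iff[OF valid agrees admissible_choice])
  fix i assume "i \<in> packed_in (solution_of I c) j"
  then have i: "i \<in> assigned c j" by (simp add: packed_in)
  then have item: "i < length (items I)" "fits I (containers I ! j) (chosen_box I c i)" "i \<in> chosen c"
    using assignedD[OF admissible_choice] by blast+
  show "inside I (solution_of I c) j i" by (rule solution_of_inside[OF j i])
  show "0 < pwidth I (solution_of I c) i \<and> 0 < pheight I (solution_of I c) i"
    using pdimensions_pos[OF valid item(1)] by blast
  show "small_enough I (solution_of I c) j i"
    using fits_iff_small_enough[OF valid agrees j item(3)] item(2) by blast
  fix i' assume "i' \<in> packed_in (solution_of I c) j" "i \<noteq> i'"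
  then show "clabel (containers I ! j) \<noteq> Wide \<and> beside I (solution_of I c) i i' \<or>
      clabel (containers I ! j) \<noteq> Tall \<and> stacked I (solution_of I c) i i'"
    by (intro solution_of_apart[OF j i]) (simp_all add: packed_in)
qed

theorem feasible_packing_solution_of: "feasible_packing rotation d I (solution_of I c)"
proof -
  let ?S = "solution_of I c"
  note agrees = agrees_solution_of
  have "cont (the (?S ! i)) < length (containers I) \<and> (rotated (the (?S ! i)) \<longrightarrow> rotation)"
    if "i \<in> packed ?S" for i
  proof -
    from that have i: "i \<in> chosen c" by (simp add: agrees_packed[OF valid agrees])
    then have "i \<in> assigned c (fst (fst (the (c ! i))))" by (simp add: assigned_def)
    from assignedD[OF admissible_choice this] obtain rot
      where "fst (fst (the (c ! i))) < length (containers I)" "rot \<longrightarrow> rotation"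
        "snd (fst (the (c ! i))) = rot"
      by (metis fst_conv option.sel snd_conv)
    then show ?thesis by (simp add: agrees_chosen[OF valid agrees i])
  qed
  moreover have "\<forall>t < d. (\<Sum>i \<in> packed ?S. weights (items I ! i) ! t) \<le> 1"
    using fit by (simp add: fitting_iff[OF valid agrees admissible_choice])
  ultimately show ?thesis
    using agrees_length(2)[OF valid agrees] container_ok_solution_of by (simp add: feasible_packing_def)
qed

end


section \<open>Running time of the reduction to the knapsack problem\<close>

instantiation label :: codable begin
definition enc_label_inst: "enc (l :: label) = enc_label l"
instance ..
end

instantiation item_ext :: (type) codable begin
definition enc_item_inst: "enc (a :: 'a item_scheme) =
    enc (width a, height a, profit a, weights a, 0 :: int)"
instance ..
end

instantiation container_ext :: (type) codable begin
definition enc_container_inst: "enc (C :: 'a container_scheme) =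
    enc (cwidth C, cheight C, clabel C, 0 :: int)"
instance ..
end

instantiation cp_instance_ext :: (type) codable begin
definition enc_instance_inst: "enc (I :: 'a cp_instance_scheme) =
    enc (items I, containers I, eps' I, 0 :: int)"
instance ..
end

lemma enc_eq_enc_instance: "enc = enc_instance"
proof
  have rat: "enc = enc_rat" by (simp add: fun_eq_iff enc_rat_inst)
  have "enc = enc_item" "enc = enc_container"
    by (simp_all add: rat fun_eq_iff enc_item_inst enc_item_def enc_container_inst enc_container_def
        enc_label_inst enc_list_inst)
  then show "enc I = enc_instance I" for I :: cp_instance
    by (simp add: enc_instance_inst enc_instance_def rat enc_list_inst)
qed

lemma ptime_case_label [ptime_intros]:
  assumes L: "ptime D L" and F: "ptime D F\<^sub>L" "ptime D F\<^sub>W" "ptime D F\<^sub>T" "ptime D F\<^sub>A"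
  shows "ptime D (\<lambda>x. case L x of Large \<Rightarrow> F\<^sub>L x | Wide \<Rightarrow> F\<^sub>W x | Tall \<Rightarrow> F\<^sub>T x | Area \<Rightarrow> F\<^sub>A x)"
proof -
  define code :: "label \<Rightarrow> int"
    where "code l = (case l of Large \<Rightarrow> 0 | Wide \<Rightarrow> 1 | Tall \<Rightarrow> 2 | Area \<Rightarrow> 3)" for l
  have "ptime D (\<lambda>x. code (L x))"
    by (rule ptime_enc_cong[OF L]) (simp add: code_def enc_label_inst split: label.split)
  then have "ptime D (\<lambda>x. if code (L x) = 0 then F\<^sub>L x else if code (L x) = 1 then F\<^sub>W x
      else if code (L x) = 2 then F\<^sub>T x else F\<^sub>A x)"
    by (intro ptime_intros F)
  then show ?thesis by (rule ptime_cong) (simp add: code_def split: label.split)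
qed

lemma
  assumes F: "ptime D F"
  shows ptime_width [ptime_intros]: "ptime D (\<lambda>x. width (F x))"
    and ptime_height [ptime_intros]: "ptime D (\<lambda>x. height (F x))"
    and ptime_profit [ptime_intros]: "ptime D (\<lambda>x. profit (F x))"
    and ptime_weights [ptime_intros]: "ptime D (\<lambda>x. weights (F x))"
proof -
  have "ptime D (\<lambda>x. (width (F x), height (F x), profit (F x), weights (F x), 0 :: int))"
    by (rule ptime_enc_cong[OF F]) (simp only: enc_item_inst)
  note fields = ptime_fst[OF this] ptime_fst[OF ptime_snd[OF this]]
    ptime_fst[OF ptime_snd[OF ptime_snd[OF this]]]
      ptime_fst[OF ptime_snd[OF ptime_snd[OF ptime_snd[OF this]]]]
  from fields show "ptime D (\<lambda>x. width (F x))" "ptime D (\<lambda>x. height (F x))" "ptime D (\<lambda>x. profit (F x))"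
    "ptime D (\<lambda>x. weights (F x))" by simp_all
qed

lemma
  assumes F: "ptime D F"
  shows ptime_cwidth [ptime_intros]: "ptime D (\<lambda>x. cwidth (F x))"
    and ptime_cheight [ptime_intros]: "ptime D (\<lambda>x. cheight (F x))"
    and ptime_clabel [ptime_intros]: "ptime D (\<lambda>x. clabel (F x))"
proof -
  have "ptime D (\<lambda>x. (cwidth (F x), cheight (F x), clabel (F x), 0 :: int))"
    by (rule ptime_enc_cong[OF F]) (simp only: enc_container_inst)
  note fields = ptime_fst[OF this] ptime_fst[OF ptime_snd[OF this]]
    ptime_fst[OF ptime_snd[OF ptime_snd[OF this]]]
  from fields show "ptime D (\<lambda>x. cwidth (F x))" "ptime D (\<lambda>x. cheight (F x))"
    "ptime D (\<lambda>x. clabel (F x))"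
    by simp_all
qed

lemma
  assumes F: "ptime D F"
  shows ptime_items [ptime_intros]: "ptime D (\<lambda>x. items (F x))"
    and ptime_containers [ptime_intros]: "ptime D (\<lambda>x. containers (F x))"
    and ptime_eps' [ptime_intros]: "ptime D (\<lambda>x. eps' (F x))"
proof -
  have "ptime D (\<lambda>x. (items (F x), containers (F x), eps' (F x), 0 :: int))"
    by (rule ptime_enc_cong[OF F]) (simp only: enc_instance_inst)
  note fields = ptime_fst[OF this] ptime_fst[OF ptime_snd[OF this]]
    ptime_fst[OF ptime_snd[OF ptime_snd[OF this]]]
  from fields show "ptime D (\<lambda>x. items (F x))" "ptime D (\<lambda>x. containers (F x))"
    "ptime D (\<lambda>x. eps' (F x))"
    by simp_all
qed

lemma ptime_comp_UNIV: "ptime UNIV f \<Longrightarrow> ptime D F \<Longrightarrow> ptime D (\<lambda>x. f (F x))"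
  by (rule ptime_comp[of UNIV f]) simp_all

lemma ptime_den [ptime_intros]: "ptime D F \<Longrightarrow> ptime D (\<lambda>x. den (F x))"
  by (rule ptime_comp_UNIV[where f = den]) (unfold den_def rationals_def, intro ptime_intros)

lemma ptime_scaled [ptime_intros]: "ptime D F \<Longrightarrow> ptime D G \<Longrightarrow> ptime D (\<lambda>x. scaled (F x) (G x))"
  unfolding scaled_def by (intro ptime_intros)

lemma ptime_oriented [ptime_intros]:
  "ptime D F \<Longrightarrow> ptime D G \<Longrightarrow> ptime D H \<Longrightarrow> ptime D (\<lambda>x. oriented (F x) (G x) (H x))"
  unfolding oriented_def by (intro ptime_intros)

lemma ptime_fits [ptime_intros]:
  "ptime D F \<Longrightarrow> ptime D G \<Longrightarrow> ptime D H \<Longrightarrow> ptime D (\<lambda>x. fits (F x) (G x) (H x))"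
  unfolding fits_def by (intro ptime_intros)

lemma ptime_usage [ptime_intros]:
  "ptime D F \<Longrightarrow> ptime D G \<Longrightarrow> ptime D H \<Longrightarrow> ptime D (\<lambda>x. usage (F x) (G x) (H x))"
  unfolding usage_def by (intro ptime_intros)

lemma ptime_capacity [ptime_intros]: "ptime D F \<Longrightarrow> ptime D G \<Longrightarrow> ptime D (\<lambda>x. capacity (F x) (G x))"
  unfolding capacity_def by (intro ptime_intros)

lemma ptime_usage_vec [ptime_intros]:
  "ptime D F \<Longrightarrow> ptime D G \<Longrightarrow> ptime D H \<Longrightarrow> ptime D K \<Longrightarrow>
    ptime D (\<lambda>x. usage_vec (F x) (G x) (H x) (K x))"
  by (rule ptime_comp4[where f = usage_vec]) (unfold usage_vec_def, intro ptime_intros)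

lemma ptime_placements [ptime_intros]:
  "ptime D F \<Longrightarrow> ptime D G \<Longrightarrow> ptime D (\<lambda>x. placements rotation (F x) (G x))"
  by (rule ptime_comp2[where f = "placements rotation"]) (unfold placements_def, intro ptime_intros)

lemma ptime_knapsack_items [ptime_intros]: "ptime D F \<Longrightarrow> ptime D (\<lambda>x. knapsack_items rotation (F x))"
  by (rule ptime_comp_UNIV[where f = "knapsack_items rotation"])
    (unfold knapsack_items_def, intro ptime_intros)

lemma ptime_capacities [ptime_intros]: "ptime D F \<Longrightarrow> ptime D (\<lambda>x. capacities d (F x))"
  by (rule ptime_comp_UNIV[where f = "capacities d"]) (unfold capacities_def, intro ptime_intros)

lemma ptime_boxes [ptime_intros]:
  "ptime D F \<Longrightarrow> ptime D G \<Longrightarrow> ptime D H \<Longrightarrow> ptime D (\<lambda>x. boxes (F x) (G x) (H x))"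
  by (rule ptime_comp3[where f = boxes]) (unfold boxes_def, intro ptime_intros)

lemma ptime_container_positions [ptime_intros]:
  "ptime D F \<Longrightarrow> ptime D G \<Longrightarrow> ptime D H \<Longrightarrow> ptime D K \<Longrightarrow>
    ptime D (\<lambda>x. container_positions (F x) (G x) (H x) (K x))"
  unfolding container_positions_def by (intro ptime_intros)

lemma ptime_positions [ptime_intros]:
  "ptime D F \<Longrightarrow> ptime D G \<Longrightarrow> ptime D (\<lambda>x. positions (F x) (G x))"
  by (rule ptime_comp2[where f = positions]) (unfold positions_def, intro ptime_intros)

lemma ptime_placed [ptime_intros]:
  "ptime D F \<Longrightarrow> ptime D G \<Longrightarrow> ptime D (\<lambda>x. placed (F x) (G x))"
  by (rule ptime_comp2[where f = placed]) (unfold placed_def, intro ptime_intros)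


section \<open>The approximation scheme\<close>

definition encode_placed :: "int \<Rightarrow> ((nat \<times> bool) \<times> int \<times> int) option \<Rightarrow> val" where
  "encode_placed Q p = (case p of None \<Rightarrow> IntV 0
     | Some q \<Rightarrow> enc (fst (fst q), snd (fst q), (fst (snd q), Q), (snd (snd q), Q), 0 :: int))"

definition pack_containers :: "nat \<Rightarrow> nat \<Rightarrow> bool \<Rightarrow> cp_instance \<Rightarrow> val list" where
  "pack_containers r d rotation I =
     map (encode_placed (den I)) (placed I (solve r (knapsack_items rotation I) (capacities d I)))"

lemma ptime_pack_containers: "ptime {I. valid_instance d k I} (pack_containers r d rotation)"
proof -
  have "ptime {I. valid_instance d k I} (\<lambda>I. solve r (knapsack_items rotation I) (capacities d I))"
  proof (rule ptime_solve[where n = "k + d"])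
    show "wf_items (length (capacities d I)) (knapsack_items rotation I)"
      "length (capacities d I) \<le> k + d"
      if "I \<in> {I. valid_instance d k I}" for I
      using that wf_knapsack_items[of d k I rotation] by (simp_all add: valid_instance_def)
  qed (intro ptime_intros)+
  then show ?thesis
    unfolding pack_containers_def encode_placed_def by (intro ptime_intros)
qed

lemma repr_coord_fraction:
  "b \<noteq> 0 \<Longrightarrow> repr_coord (PairV (IntV a) (IntV b)) (real_of_int a / real_of_int b)"
  by (auto simp: repr_coord_def)

lemma repr_solution_of:
  "repr_solution (enc (map (encode_placed (den I)) (placed I c))) (solution_of I c)"
proof -
  have "repr_entry (encode_placed (den I) p) (map_option (placement_of I) p)" for p
    using den_pos[of I]
    by (auto simp: encode_placed_def placement_of_def intro!: repr_coord_fraction split: option.split)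
  then show ?thesis
    by (auto simp: repr_solution_def solution_of_def enc_list_inst list_all2_conv_all_nth)
qed

lemma total_profit_nonneg:
  assumes "valid_instance d k I" "length S = length (items I)"
  shows "0 \<le> total_profit I S"
  unfolding total_profit_def
proof (rule sum_nonneg)
  fix i assume "i \<in> packed S"
  with assms have "0 \<le> profit (items I ! i)" by (simp add: packed_def valid_item(3))
  then show "0 \<le> real_of_rat (profit (items I ! i))" by simp
qed

context
  fixes I :: cp_instance and d k r :: nat and rotation :: bool and S :: solution
  assumes valid: "valid_instance d k I"
  defines "S \<equiv> solution_of I (solve r (knapsack_items rotation I) (capacities d I))"
begin

lemma fitting_solve_knapsack:
  "fitting (knapsack_items rotation I) (capacities d I)
    (solve r (knapsack_items rotation I) (capacities d I))"
  by (rule solve_fitting[OF wf_knapsack_items[OF valid] capacities_nonneg[OF valid]])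

lemma feasible_packing_solve: "feasible_packing rotation d I S"
  unfolding S_def by (rule feasible_packing_solution_of[OF valid fitting_solve_knapsack])

lemma total_profit_solve:
  assumes r: "1 \<le> r" and feasible: "feasible_packing rotation d I S'"
  shows "(real r - real (k + d)) * total_profit I S' \<le> real r * total_profit I S"
proof -
  let ?its = "knapsack_items rotation I" and ?Q = "real_of_int (den I)"
  let ?m = "length (containers I) + d"
  note gain_eq = gain_eq_total_profit[OF valid, where rotation = rotation]
  have "(int r - int ?m) * gain ?its (choice_of I S') \<le>
      int r * gain ?its (solve r ?its (capacities d I))"
    using solve_approximates[OF wf_knapsack_items[OF valid] capacities_nonneg[OF valid] r
        feasible_packing_choice_of(2)[OF valid feasible]] by simp
  then have "real_of_int ((int r - int ?m) * gain ?its (choice_of I S')) \<le>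
      real_of_int (int r * gain ?its (solve r ?its (capacities d I)))"
    by (simp only: of_int_le_iff)
  then have "(real r - real ?m) * total_profit I S' * ?Q \<le> real r * total_profit I S * ?Q"
    using fitting_solve_knapsack feasible_packing_choice_of[OF valid feasible]
    by (simp add: S_def mult.assoc gain_eq[OF agrees_solution_of[OF valid fitting_solve_knapsack]]
        gain_eq fitting_def)
  then have "(real r - real ?m) * total_profit I S' \<le> real r * total_profit I S"
    using den_pos[of I] by (simp only: mult_le_cancel_right_pos of_int_0_less_iff)
  moreover have "(real r - real (k + d)) * total_profit I S' \<le> (real r - real ?m) * total_profit I S'"
    using valid feasible by (intro mult_right_mono total_profit_nonneg[OF valid])
      (simp_all add: valid_instance_def feasible_packing_def)
  ultimately show ?thesis by linarith
qed

end

lemma pack_containers_approximates: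
  assumes valid: "valid_instance d k I" and r: "1 \<le> r" "real (k + d) \<le> \<epsilon> * real r"
  shows "\<exists>S. repr_solution (enc (pack_containers r d rotation I)) S \<and> feasible_packing rotation d I S \<and>
    (1 - \<epsilon>) * opt (container_packing rotation d k) I \<le> total_profit I S"
proof -
  let ?S = "solution_of I (solve r (knapsack_items rotation I) (capacities d I))"
  obtain S' where S': "feasible_packing rotation d I S'"
    "total_profit I S' = opt (container_packing rotation d k) I"
    using opt_container_packing_attained[OF valid] by blast
  have "(real r - \<epsilon> * real r) * total_profit I S' \<le> (real r - real (k + d)) * total_profit I S'"
    using r(2) S'(1) by (intro mult_right_mono total_profit_nonneg[OF valid])
      (simp_all add: feasible_packing_def)
  also have "\<dots> \<le> real r * total_profit I ?S"
    by (rule total_profit_solve[OF valid r(1) S'(1)])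
  finally have "real r * ((1 - \<epsilon>) * total_profit I S') \<le> real r * total_profit I ?S"
    by (simp add: algebra_simps)
  then have "(1 - \<epsilon>) * total_profit I S' \<le> total_profit I ?S" using r(1) by simp
  then show ?thesis
    using repr_solution_of[of I] feasible_packing_solve[OF valid, of rotation r]
    by (auto simp: pack_containers_def S'(2))
qed

theorem container_packing_PTAS: "admits_PTAS (container_packing rotation d k)"
  unfolding admits_PTAS_def
proof (intro allI impI)
  fix \<epsilon> :: real assume \<epsilon>: "0 < \<epsilon>"
  obtain n :: nat where "real (k + d) / \<epsilon> < real n" using reals_Archimedean2 by blast
  with \<epsilon> have r: "1 \<le> Suc n" "real (k + d) \<le> \<epsilon> * real (Suc n)"
    by (simp_all add: pos_divide_less_eq algebra_simps)
  let ?A = "pack_containers (Suc n) d rotation"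
  obtain P q where runs: "\<And>I. I \<in> {I. valid_instance d k I} \<Longrightarrow>
      \<exists>t. runs P (enc I) (enc (?A I)) t \<and> t \<le> poly q (esize I)"
    using ptime_runs[OF ptime_pack_containers[of d k "Suc n" rotation]] by blast
  have "poly_time_approx (container_packing rotation d k) (1 - \<epsilon>) P"
    unfolding poly_time_approx_def
    using runs pack_containers_approximates[OF _ r, where rotation = rotation]
    by (intro exI[of _ q]) (simp add: container_packing_def enc_eq_enc_instance, blast)
  then show "\<exists>P. poly_time_approx (container_packing rotation d k) (1 - \<epsilon>) P" by blast
qed

theorem theorem12:
  fixes d k :: nat
  shows "admits_PTAS (container_packing False d k) \<and> admits_PTAS (container_packing True d k)"
  by (simp add: container_packing_PTAS)

end
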